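(* Let $\Gamma_l\subset D^l$ ($l=\pm1$) be a $K_B$-bounded contour satisfying $$\mathrm{Var}_{\widetilde A_1}(B,\Gamma_l)<1,\qquad \mathrm{Var}_{\widetilde A_1}(B,\Gamma_l)\,\|\widetilde A_1\|<\tfrac14\,d_0(\Gamma_l)\,[1-\mathrm{Var}_{\widetilde A_1}(B,\Gamma_l)]^2 ,$$ and let $$\Omega^{(l)}:=\int_{\Gamma_l}d\mu\,\mu\,(H_1^{(-l)*}-\mu)^{-1}K_B'(\mu)(H_1^{(l)}-\mu)^{-1}.$$ The operators $\Omega^{(l)}$ ($l=\pm1$) possess the following properties: $$\|\Omega^{(l)}\|<1,\qquad \Omega^{(-l)}=\Omega^{(l)*},$$ $$-\frac{1}{2\pi\mathrm{i}}\int_\gamma dz\,[M_1(z,\Gamma_l)]^{-1}=(I_1+\Omega^{(l)})^{-1},$$ $$-\frac{1}{2\pi\mathrm{i}}\int_\gamma dz\,z\,[M_1(z,\Gamma_l)]^{-1}=(I_1+\Omega^{(l)})^{-1}H_1^{(-l)*}=H_1^{(l)}(I_1+\Omega^{(l)})^{-1},$$ where $\gamma$ stands for an arbitrary rectifiable closed contour going around the spectrum of $H_1^{(l)}$ inside the set $$\mathcal O(\widetilde A_1,\Gamma_l):=\{z\in\mathbb{C}:\operatorname{dist}\{z,\sigma(\widetilde A_1)\}\le d_0(\Gamma_l)[1-\mathrm{Var}_{\widetilde A_1}(B,\Gamma_l)]/2\}$$ in the positive direction. The integration along $\gamma$ is understood in the strong sense.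
   Context: Setting. $\mathcal H_0,\mathcal H_1$ are separable Hilbert spaces; $I_1$ is the identity in $\mathcal H_1$. $A_0$ is an unbounded selfadjoint operator in $\mathcal H_0$ whose spectrum is absolutely continuous and equal to $\Delta_0=[\alpha_0,+\infty)$, $\alpha_0>0$. $A_1$ is a bounded selfadjoint operator in $\mathcal H_1$. The (possibly unbounded) operators $T_{ij}:\mathcal H_j\to\mathcal H_i$ ($i,j\in\{0,1\}$, $i\ne j$) satisfy $T_{01}^*=T_{10}$ and $\mathcal D(T_{10})\supset\mathcal D(A_0^{1/2})$. Then $B_{10}:=T_{10}A_0^{-1/2}$ is bounded; put $B_{01}:=B_{10}^*$. Let $\widetilde A_1:=A_1-B_{10}B_{01}$, a bounded selfadjoint operator in $\mathcal H_1$; it is assumed that $\sigma(\widetilde A_1)\subset\Delta_0$. The function $K_B$. Let $E_0$ be the spectral measure of $A_0$, $E^0(\mu):=E_0([\alpha_0,\mu))$ and $K_B(\mu):=B_{10}E^0(\mu)B_{01}$. It is assumed that: $K_B$ is differentiable on $\Delta_0$ in the operator norm topology; $K_B'$ is continuous within $\Delta_0$ and admits analytic continuation (in the operator norm topology) from $\Delta_0$ to a simply connected domain $D^+\subset\mathbb{C}^+$ (the upper half-plane) whose boundary includes the entire interval $\Delta_0$. Consequently it is also continued to $D^-:=\{z:\overline z\in D^+\}$, and $[K_B'(\mu)]^*=K_B'(\overline\mu)$ for $\mu\in D^\pm$; the continuations are again denoted $K_B'$. It is assumed that $\|K_B'(\mu)\|\le C|\mu-\alpha_0|^{\gamma_0}$,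 $\mu\in D^\pm$, for some $C>0$ and $\gamma_0\in(-1,0]$. For $l=\pm1$ write $D^l$ for $D^\pm$. Contours. $\Gamma_l$ denotes a rectifiable Jordan curve in $D^l$ resulting from continuous deformation of the interval $\Delta_0$, the finite end point $\alpha_0$ being fixed (oriented from $\alpha_0$ to infinity). It is called $K_B$-bounded if $\mathrm{Var}_1(B,\Gamma_l):=\int_{\Gamma_l}|d\mu|\,(1+|\mu|)^{-1}\|K_B'(\mu)\|<\infty$, where $|d\mu|$ is Lebesgue (arc-length) measure on $\Gamma_l$. Put $d_0(\Gamma_l):=\operatorname{dist}\{\sigma(\widetilde A_1),\Gamma_l\}$, assumed positive, and $\mathrm{Var}_{\widetilde A_1}(B,\Gamma_l):=\int_{\Gamma_l}|d\mu|\,\|K_B'(\mu)\|/\operatorname{dist}\{\mu,\sigma(\widetilde A_1)\}$ (which is then finite). Transfer function. For $z\in\mathbb{C}\setminus\Gamma_l$, $M_1(z,\Gamma_l):=\widetilde A_1-z+\int_{\Gamma_l}d\mu\,K_B'(\mu)\frac{z}{z-\mu}$. Operators $H_1^{(\pm l)}$. For a bounded operator $Y$ in $\mathcal H_1$ whose spectrum is separated from a contour $\Gamma$, $V_1(Y,\Gamma):=\int_{\Gamma}d\mu\,K_B'(\mu)\,Y(Y-\mu)^{-1}$. Put $$r_{\min}(\Gamma):=\tfrac12 d_0(\Gamma)[1-\mathrm{Var}_{\widetilde A_1}(B,\Gamma)]-\sqrt{\tfrac14 d_0^2(\Gamma)[1-\mathrm{Var}_{\widetilde A_1}(B,\Gamma)]^2-d_0(\Gamma)\mathrm{Var}_{\widetilde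 A_1}(B,\Gamma)\|\widetilde A_1\|}.$$ For a $K_B$-bounded $\Gamma_l$ satisfying the two inequalities in the claim, the equation $X=V_1(\widetilde A_1+X,\Gamma_l)$ has a unique solution in the ball $\|X\|\le r_{\min}(\Gamma_l)$, denoted $X^{(l)}$; for given $l$ it is the same for all such $\Gamma_l\subset D^l$. Put $H_1^{(l)}:=\widetilde A_1+X^{(l)}$. The conjugate contour $\Gamma_{(-l)}=\{\overline\mu:\mu\in\Gamma_l\}\subset D^{(-l)}$ satisfies the same conditions and defines $X^{(-l)}$ and $H_1^{(-l)}=\widetilde A_1+X^{(-l)}$; $H_1^{(-l)*}$ is the adjoint of $H_1^{(-l)}$. The operator $\Omega^{(l)}$ does not depend on the choice of such a $\Gamma_l$. *)

theory Defs
  imports "HOL-Complex_Analysis.Complex_Analysis"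
begin

section \<open>Complex Hilbert spaces\<close>

class complex_normed_vector = real_normed_vector +
  fixes scaleC :: "complex \<Rightarrow> 'a \<Rightarrow> 'a"  (infixr \<open>*\<^sub>C\<close> 75)
  assumes scaleC_add_right: "c *\<^sub>C (x + y) = c *\<^sub>C x + c *\<^sub>C y"
    and scaleC_add_left: "(c + d) *\<^sub>C x = c *\<^sub>C x + d *\<^sub>C x"
    and scaleC_scaleC: "c *\<^sub>C (d *\<^sub>C x) = (c * d) *\<^sub>C x"
    and scaleC_of_real: "complex_of_real r *\<^sub>C x = r *\<^sub>R x"
    and norm_scaleC: "norm (c *\<^sub>C x) = cmod c * norm x"

text \<open>The inner product is conjugate-linear in its first argument and linear in the second.\<close>

class chilbert = complex_normed_vector + banach +
  fixes cinner :: "'a \<Rightarrow> 'a \<Rightarrow> complex"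
  assumes cinner_commute: "cinner x y = cnj (cinner y x)"
    and cinner_add_right: "cinner x (y + z) = cinner x y + cinner x z"
    and cinner_scaleC_right: "cinner x (c *\<^sub>C y) = c * cinner x y"
    and cinner_self: "cinner x x = complex_of_real ((norm x)\<^sup>2)"

lemma bounded_linear_scaleC_right:
  "bounded_linear (\<lambda>x. c *\<^sub>C (x::'a::complex_normed_vector))"
proof (rule bounded_linear_intro[where K = "cmod c"])
  show "c *\<^sub>C (r *\<^sub>R x) = r *\<^sub>R (c *\<^sub>C x)" for r and x :: 'a
    by (simp only: scaleC_of_real[symmetric] scaleC_scaleC mult.commute)
qed (simp_all add: scaleC_add_right norm_scaleC mult.commute)

text \<open>The operators below have the library type of bounded real-linear maps, with the
  operator norm; complex linearity is the separate predicate \<open>clinear_op\<close>.\<close>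

instantiation blinfun :: (real_normed_vector, complex_normed_vector) complex_normed_vector
begin

lift_definition scaleC_blinfun :: "complex \<Rightarrow> 'a \<Rightarrow>\<^sub>L 'b \<Rightarrow> 'a \<Rightarrow>\<^sub>L 'b"
  is "\<lambda>c T x. c *\<^sub>C T x"
  by (rule bounded_linear_compose[OF bounded_linear_scaleC_right])

instance
proof
  fix c d :: complex and r :: real and x y :: "'a \<Rightarrow>\<^sub>L 'b"
  show "c *\<^sub>C (x + y) = c *\<^sub>C x + c *\<^sub>C y"
    by transfer (simp add: scaleC_add_right)
  show "(c + d) *\<^sub>C x = c *\<^sub>C x + d *\<^sub>C x"
    by transfer (simp add: scaleC_add_left)
  show "c *\<^sub>C (d *\<^sub>C x) = (c * d) *\<^sub>C x"
    by transfer (simp add: scaleC_scaleC)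
  show "complex_of_real r *\<^sub>C x = r *\<^sub>R x"
    by transfer (simp add: scaleC_of_real)
  have le: "norm (e *\<^sub>C z) \<le> cmod e * norm z" for e and z :: "'a \<Rightarrow>\<^sub>L 'b"
  proof (rule norm_blinfun_bound)
    show "norm (blinfun_apply (e *\<^sub>C z) v) \<le> cmod e * norm z * norm v" for v
      using mult_left_mono[OF norm_blinfun[of z v] norm_ge_zero[of e]]
      by (simp add: scaleC_blinfun.rep_eq norm_scaleC mult.assoc)
  qed simp
  show "norm (c *\<^sub>C x) = cmod c * norm x"
  proof (cases "c = 0")
    case True
    then show ?thesis using le[of 0 x] by simp
  next
    case False
    have "inverse c *\<^sub>C (c *\<^sub>C x) = x"
      using False by transfer (simp add: scaleC_scaleC scaleC_of_real[of 1, simplified])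
    then have "norm x \<le> cmod (inverse c) * norm (c *\<^sub>C x)"
      using le[of "inverse c" "c *\<^sub>C x"] by simp
    from mult_left_mono[OF this norm_ge_zero[of c]]
    have "cmod c * norm x \<le> norm (c *\<^sub>C x)"
      using False by (simp add: norm_inverse flip: mult.assoc)
    then show ?thesis using le[of c x] by simp
  qed
qed

end

section \<open>Bounded operators\<close>

definition clinear_op :: "'a::complex_normed_vector \<Rightarrow>\<^sub>L 'b::complex_normed_vector \<Rightarrow> bool" where
  "clinear_op T \<longleftrightarrow> (\<forall>c x. T (c *\<^sub>C x) = c *\<^sub>C T x)"

definition adj :: "'a::chilbert \<Rightarrow>\<^sub>L 'b::chilbert \<Rightarrow> 'b \<Rightarrow>\<^sub>L 'a" where
  "adj T = (THE S :: 'b \<Rightarrow>\<^sub>L 'a. \<forall>x y. cinner (S y) x = cinner y (T x))"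

definition selfadjoint_op :: "'a::chilbert \<Rightarrow>\<^sub>L 'a \<Rightarrow> bool" where
  "selfadjoint_op T \<longleftrightarrow> clinear_op T \<and> adj T = T"

definition is_inverse_op :: "'a::real_normed_vector \<Rightarrow>\<^sub>L 'b::real_normed_vector \<Rightarrow> 'b \<Rightarrow>\<^sub>L 'a \<Rightarrow> bool" where
  "is_inverse_op T S \<longleftrightarrow> T o\<^sub>L S = id_blinfun \<and> S o\<^sub>L T = id_blinfun"

definition inv_op :: "'a::real_normed_vector \<Rightarrow>\<^sub>L 'b::real_normed_vector \<Rightarrow> 'b \<Rightarrow>\<^sub>L 'a" where
  "inv_op T = (THE S. is_inverse_op T S)"

definition spectrum :: "'a::complex_normed_vector \<Rightarrow>\<^sub>L 'a \<Rightarrow> complex set" where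
  "spectrum T = {z. \<not> (\<exists>S. is_inverse_op (T - z *\<^sub>C id_blinfun) S)}"

section \<open>Unbounded operators\<close>

text \<open>An operator with domain is a partial function, so that equality of operators includes
  equality of their domains and \<open>\<circ>\<^sub>m\<close> is composition on the natural domain.\<close>

type_synonym ('a, 'b) lop = "'a \<rightharpoonup> 'b"

definition linear_lop :: "('a::complex_normed_vector, 'b::complex_normed_vector) lop \<Rightarrow> bool" where
  "linear_lop T \<longleftrightarrow> T 0 = Some 0
     \<and> (\<forall>x\<in>dom T. \<forall>y\<in>dom T. T (x + y) = Some (the (T x) + the (T y)))
     \<and> (\<forall>c. \<forall>x\<in>dom T. T (c *\<^sub>C x) = Some (c *\<^sub>C the (T x)))"

definition densely_defined :: "('a::real_normed_vector, 'b) lop \<Rightarrow> bool" where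
  "densely_defined T \<longleftrightarrow> closure (dom T) = UNIV"

definition adj_lop :: "('a::chilbert, 'b::chilbert) lop \<Rightarrow> ('b, 'a) lop" where
  "adj_lop T = (\<lambda>y. if \<exists>z. \<forall>x\<in>dom T. cinner z x = cinner y (the (T x))
                    then Some (THE z. \<forall>x\<in>dom T. cinner z x = cinner y (the (T x)))
                    else None)"

definition selfadjoint_lop :: "('a::chilbert, 'a) lop \<Rightarrow> bool" where
  "selfadjoint_lop A \<longleftrightarrow> linear_lop A \<and> densely_defined A \<and> adj_lop A = A"

definition spectrum_lop :: "('a::complex_normed_vector, 'a) lop \<Rightarrow> complex set" where
  "spectrum_lop A = {z. \<not> (\<exists>R :: 'a \<Rightarrow>\<^sub>L 'a.
      (\<forall>x. R x \<in> dom A \<and> the (A (R x)) - z *\<^sub>C R x = x) \<and>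
      (\<forall>x\<in>dom A. R (the (A x) - z *\<^sub>C x) = x))}"

definition inv_lop :: "('a, 'b) lop \<Rightarrow> ('b, 'a) lop" where
  "inv_lop T = (\<lambda>y. if \<exists>x. T x = Some y then Some (THE x. T x = Some y) else None)"

text \<open>\<open>S = A\<^sup>1\<^sup>/\<^sup>2\<close>: the (unique) nonnegative selfadjoint operator with \<open>S\<^sup>2 = A\<close>.\<close>

definition is_sqrt_lop :: "('a::chilbert, 'a) lop \<Rightarrow> ('a, 'a) lop \<Rightarrow> bool" where
  "is_sqrt_lop S A \<longleftrightarrow> selfadjoint_lop S
     \<and> (\<forall>x\<in>dom S. 0 \<le> Re (cinner x (the (S x)))) \<and> S \<circ>\<^sub>m S = A"

section \<open>Spectral measures\<close>

text \<open>The measure \<open>\<langle>x, E(\<cdot>) x\<rangle>\<close>.\<close>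

definition spectral_measure_at :: "(real set \<Rightarrow> 'a::chilbert \<Rightarrow>\<^sub>L 'a) \<Rightarrow> 'a \<Rightarrow> real measure" where
  "spectral_measure_at E x = measure_of UNIV (sets borel) (\<lambda>B. ennreal (Re (cinner x (E B x))))"

text \<open>\<open>E\<close> is the projection-valued measure with \<open>A = \<integral> \<lambda> dE(\<lambda>)\<close>. The quadratic form on the
  domain determines \<open>A\<close> by polarization.\<close>

definition is_spectral_measure_of ::
    "(real set \<Rightarrow> 'a::chilbert \<Rightarrow>\<^sub>L 'a) \<Rightarrow> ('a, 'a) lop \<Rightarrow> bool" where
  "is_spectral_measure_of E A \<longleftrightarrow>
     (\<forall>B\<in>sets borel. selfadjoint_op (E B) \<and> E B o\<^sub>L E B = E B) \<and>
     E UNIV = id_blinfun \<and>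
     (\<forall>F :: nat \<Rightarrow> real set. range F \<subseteq> sets borel \<and> disjoint_family F \<longrightarrow>
        (\<forall>x. (\<lambda>n. E (F n) x) sums E (\<Union>n. F n) x)) \<and>
     dom A = {x. integrable (spectral_measure_at E x) (\<lambda>t. t\<^sup>2)} \<and>
     (\<forall>x\<in>dom A. cinner x (the (A x))
        = complex_of_real (integral\<^sup>L (spectral_measure_at E x) (\<lambda>t. t)))"

definition absolutely_continuous_spectrum :: "(real set \<Rightarrow> 'a::chilbert \<Rightarrow>\<^sub>L 'a) \<Rightarrow> bool" where
  "absolutely_continuous_spectrum E \<longleftrightarrow>
     (\<forall>x. absolutely_continuous lborel (spectral_measure_at E x))"

section \<open>Curves and integrals along them\<close>

definition curve_length :: "(real \<Rightarrow> complex) \<Rightarrow> real \<Rightarrow> real \<Rightarrow> ennreal" where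
  "curve_length g a b = (SUP ts \<in> {ts. sorted ts \<and> set ts \<subseteq> {a..b}}.
      ennreal (\<Sum>i<length ts - 1. dist (g (ts ! i)) (g (ts ! Suc i))))"

text \<open>Riemann--Stieltjes integral \<open>\<integral> dg(t) f(g(t))\<close> over \<open>[a, b]\<close>, i.e. the integral of \<open>f\<close>
  along the piece of the rectifiable curve \<open>g\<close> between the parameters \<open>a\<close> and \<open>b\<close>.\<close>

definition has_curve_integral ::
    "(complex \<Rightarrow> 'v::complex_normed_vector) \<Rightarrow> 'v \<Rightarrow> (real \<Rightarrow> complex) \<Rightarrow> real \<Rightarrow> real \<Rightarrow> bool" where
  "has_curve_integral f I g a b \<longleftrightarrow>
     (\<forall>e>0. \<exists>d>0. \<forall>p. p tagged_division_of {a..b} \<and> (\<lambda>x. ball x d) fine p \<longrightarrow>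
        norm ((\<Sum>(x, J)\<in>p. (g (Sup J) - g (Inf J)) *\<^sub>C f (g x)) - I) < e)"

definition curve_integral ::
    "(complex \<Rightarrow> 'v::complex_normed_vector) \<Rightarrow> (real \<Rightarrow> complex) \<Rightarrow> real \<Rightarrow> real \<Rightarrow> 'v" where
  "curve_integral f g a b = (THE I. has_curve_integral f I g a b)"

text \<open>Integral along the whole of an unbounded curve \<open>g : [0, \<infinity>) \<rightarrow> \<complex>\<close>. It is improper
  at both ends, since \<open>K\<^sub>B'\<close> may be singular at the finite end point.\<close>

definition contour_int ::
    "(real \<Rightarrow> complex) \<Rightarrow> (complex \<Rightarrow> 'v::complex_normed_vector) \<Rightarrow> 'v" where
  "contour_int g f = Lim (at_right 0 \<times>\<^sub>F at_top) (\<lambda>(a, b). curve_integral f g a b)"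

text \<open>A contour \<open>\<Gamma>\<close> is represented by its arc-length parametrization \<open>g\<close> on \<open>[0, \<infinity>)\<close>, so that
  \<open>|d\<mu>|\<close> becomes Lebesgue measure in the parameter. Any locally rectifiable curve
  running from \<open>\<alpha>\<close> to \<open>\<infinity>\<close> has exactly one such parametrization.\<close>

definition deformed_contour :: "real \<Rightarrow> complex set \<Rightarrow> (real \<Rightarrow> complex) \<Rightarrow> bool" where
  "deformed_contour \<alpha> D g \<longleftrightarrow>
     inj_on g {0..} \<and>
     (\<forall>s t. 0 \<le> s \<and> s \<le> t \<longrightarrow> curve_length g s t = ennreal (t - s)) \<and>
     g 0 = complex_of_real \<alpha> \<and> (\<forall>t>0. g t \<in> D) \<and>
     (\<exists>h :: real \<times> real \<Rightarrow> complex.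
        continuous_on ({0..1} \<times> {0..}) h \<and>
        h ` ({0..1} \<times> {0..}) \<subseteq> D \<union> complex_of_real ` {\<alpha>..} \<and>
        (\<forall>t\<ge>0. h (0, t) = complex_of_real (\<alpha> + t)) \<and>
        (\<forall>t\<ge>0. h (1, t) = g t) \<and>
        (\<forall>s\<in>{0..1}. h (s, 0) = complex_of_real \<alpha>) \<and>
        (\<forall>s\<in>{0..1}. filterlim (\<lambda>t. h (s, t)) at_infinity at_top))"

text \<open>Closed contours may consist of several closed curves, given by a list of paths.\<close>

definition rectifiable_loop :: "(real \<Rightarrow> complex) \<Rightarrow> bool" where
  "rectifiable_loop c \<longleftrightarrow> path c \<and> pathfinish c = pathstart c \<and> curve_length c 0 1 < \<infinity>"

definition goes_around :: "(real \<Rightarrow> complex) list \<Rightarrow> complex set \<Rightarrow> complex set \<Rightarrow> bool" where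
  "goes_around \<gamma> S U \<longleftrightarrow>
     (\<forall>c\<in>set \<gamma>. rectifiable_loop c \<and> path_image c \<subseteq> U - S) \<and>
     (\<forall>z\<in>S. (\<Sum>c\<leftarrow>\<gamma>. winding_number c z) = 1)"

text \<open>\<open>T\<close> is the strong integral of the operator-valued \<open>F\<close> along the closed contour \<open>\<gamma>\<close>.\<close>

definition has_strong_integral ::
    "(complex \<Rightarrow> 'a::complex_normed_vector \<Rightarrow>\<^sub>L 'a) \<Rightarrow> 'a \<Rightarrow>\<^sub>L 'a \<Rightarrow> (real \<Rightarrow> complex) list \<Rightarrow> bool" where
  "has_strong_integral F T \<gamma> \<longleftrightarrow>
     (\<forall>x. \<exists>Is. list_all2 (\<lambda>c I. has_curve_integral (\<lambda>z. F z x) I c 0 1) \<gamma> Is \<and> T x = sum_list Is)"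

section \<open>The operator matrix and its data\<close>

definition A1_tilde :: "'h1::chilbert \<Rightarrow>\<^sub>L 'h1 \<Rightarrow> 'h0::chilbert \<Rightarrow>\<^sub>L 'h1 \<Rightarrow> 'h1 \<Rightarrow>\<^sub>L 'h1" where
  "A1_tilde A\<^sub>1 B\<^sub>1\<^sub>0 = A\<^sub>1 - (B\<^sub>1\<^sub>0 o\<^sub>L adj B\<^sub>1\<^sub>0)"

definition K_B :: "real \<Rightarrow> (real set \<Rightarrow> 'h0::chilbert \<Rightarrow>\<^sub>L 'h0) \<Rightarrow> 'h0 \<Rightarrow>\<^sub>L 'h1::chilbert \<Rightarrow> real \<Rightarrow> 'h1 \<Rightarrow>\<^sub>L 'h1" where
  "K_B \<alpha>\<^sub>0 E\<^sub>0 B\<^sub>1\<^sub>0 \<mu> = B\<^sub>1\<^sub>0 o\<^sub>L E\<^sub>0 {\<alpha>\<^sub>0..<\<mu>} o\<^sub>L adj B\<^sub>1\<^sub>0"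

definition complex_differentiable_on :: "(complex \<Rightarrow> 'v::complex_normed_vector) \<Rightarrow> complex set \<Rightarrow> bool" where
  "complex_differentiable_on f S \<longleftrightarrow>
     (\<forall>z\<in>S. \<exists>L. ((\<lambda>w. inverse (w - z) *\<^sub>C (f w - f z)) \<longlongrightarrow> L) (at z))"

definition D_side :: "complex set \<Rightarrow> int \<Rightarrow> complex set" where
  "D_side D l = (if l = 1 then D else cnj ` D)"

text \<open>\<open>R\<^sub>0\<close> is \<open>A\<^sub>0\<^sup>1\<^sup>/\<^sup>2\<close>. The single function \<open>K'\<close> is the derivative of \<open>K\<^sub>B\<close> on \<open>\<Delta>\<^sub>0\<close> together with
  its continuations to \<open>D\<^sup>+\<close> and \<open>D\<^sup>-\<close>. Differentiability of \<open>K\<^sub>B\<close> and continuity of its derivative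
  are required on the open half-line only: the bound with \<open>\<gamma>\<^sub>0 < 0\<close> permits \<open>K'\<close> to be singular
  at \<open>\<alpha>\<^sub>0\<close>.\<close>

locale operator_matrix =
  fixes \<alpha>\<^sub>0 :: real
    and A\<^sub>0 :: "('h0::chilbert, 'h0) lop"
    and E\<^sub>0 :: "real set \<Rightarrow> 'h0 \<Rightarrow>\<^sub>L 'h0"
    and R\<^sub>0 :: "('h0, 'h0) lop"
    and A\<^sub>1 :: "'h1::chilbert \<Rightarrow>\<^sub>L 'h1"
    and T\<^sub>0\<^sub>1 :: "('h1, 'h0) lop"
    and T\<^sub>1\<^sub>0 :: "('h0, 'h1) lop"
    and B\<^sub>1\<^sub>0 :: "'h0 \<Rightarrow>\<^sub>L 'h1"
    and D :: "complex set"
    and K' :: "complex \<Rightarrow> 'h1 \<Rightarrow>\<^sub>L 'h1"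
    and C \<gamma>\<^sub>0 :: real
  assumes separable_H0: "separable_space (euclidean :: 'h0 topology)"
    and separable_H1: "separable_space (euclidean :: 'h1 topology)"
    and alpha0_pos: "\<alpha>\<^sub>0 > 0"
    and A0_selfadjoint: "selfadjoint_lop A\<^sub>0"
    and A0_spectrum: "spectrum_lop A\<^sub>0 = complex_of_real ` {\<alpha>\<^sub>0..}"
    and E0: "is_spectral_measure_of E\<^sub>0 A\<^sub>0"
    and A0_abs_cont: "absolutely_continuous_spectrum E\<^sub>0"
    and A1_selfadjoint: "selfadjoint_op A\<^sub>1"
    and T01: "linear_lop T\<^sub>0\<^sub>1" "densely_defined T\<^sub>0\<^sub>1"
    and T10: "linear_lop T\<^sub>1\<^sub>0" "adj_lop T\<^sub>0\<^sub>1 = T\<^sub>1\<^sub>0"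
    and R0: "is_sqrt_lop R\<^sub>0 A\<^sub>0"
    and dom_T10: "dom R\<^sub>0 \<subseteq> dom T\<^sub>1\<^sub>0"
    and B10: "T\<^sub>1\<^sub>0 \<circ>\<^sub>m inv_lop R\<^sub>0 = (\<lambda>x. Some (B\<^sub>1\<^sub>0 x))"
    and spectrum_A1_tilde: "spectrum (A1_tilde A\<^sub>1 B\<^sub>1\<^sub>0) \<subseteq> complex_of_real ` {\<alpha>\<^sub>0..}"
    and D_domain: "open D" "simply_connected D" "D \<subseteq> {z. Im z > 0}"
    and D_boundary: "complex_of_real ` {\<alpha>\<^sub>0..} \<subseteq> frontier D"
    and K_deriv: "\<And>\<mu>. \<mu> > \<alpha>\<^sub>0 \<Longrightarrow>
        (K_B \<alpha>\<^sub>0 E\<^sub>0 B\<^sub>1\<^sub>0 has_vector_derivative K' (complex_of_real \<mu>)) (at \<mu>)"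
    and K_continuous: "continuous_on (D \<union> complex_of_real ` {\<alpha>\<^sub>0<..}) K'"
    and K_analytic: "complex_differentiable_on K' D"
    and K_clinear: "\<And>\<mu>. \<mu> \<in> D \<Longrightarrow> clinear_op (K' \<mu>)"
    and K_conj: "\<And>\<mu>. \<mu> \<in> D \<Longrightarrow> K' (cnj \<mu>) = adj (K' \<mu>)"
    and C_pos: "C > 0"
    and gamma0: "-1 < \<gamma>\<^sub>0" "\<gamma>\<^sub>0 \<le> 0"
    and K_bound: "\<And>\<mu>. \<mu> \<in> D \<union> cnj ` D \<Longrightarrow>
        norm (K' \<mu>) \<le> C * cmod (\<mu> - complex_of_real \<alpha>\<^sub>0) powr \<gamma>\<^sub>0"

text \<open>In what follows \<open>A\<close> stands for the operator \<open>A1_tilde A\<^sub>1 B\<^sub>1\<^sub>0\<close> and \<open>g\<close> for a contour.\<close>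

definition K_B_bounded :: "(complex \<Rightarrow> 'h1::chilbert \<Rightarrow>\<^sub>L 'h1) \<Rightarrow> (real \<Rightarrow> complex) \<Rightarrow> bool" where
  "K_B_bounded K' g \<longleftrightarrow> (\<lambda>t. norm (K' (g t)) / (1 + cmod (g t))) integrable_on {0..}"

definition d0 :: "'h1::chilbert \<Rightarrow>\<^sub>L 'h1 \<Rightarrow> (real \<Rightarrow> complex) \<Rightarrow> real" where
  "d0 A g = setdist (spectrum A) (g ` {0..})"

definition Var_A :: "'h1::chilbert \<Rightarrow>\<^sub>L 'h1 \<Rightarrow> (complex \<Rightarrow> 'h1 \<Rightarrow>\<^sub>L 'h1) \<Rightarrow> (real \<Rightarrow> complex) \<Rightarrow> real" where
  "Var_A A K' g = integral {0..} (\<lambda>t. norm (K' (g t)) / infdist (g t) (spectrum A))"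

definition M1 :: "'h1::chilbert \<Rightarrow>\<^sub>L 'h1 \<Rightarrow> (complex \<Rightarrow> 'h1 \<Rightarrow>\<^sub>L 'h1) \<Rightarrow> (real \<Rightarrow> complex) \<Rightarrow> complex \<Rightarrow> 'h1 \<Rightarrow>\<^sub>L 'h1" where
  "M1 A K' g z = A - z *\<^sub>C id_blinfun + contour_int g (\<lambda>\<mu>. (z / (z - \<mu>)) *\<^sub>C K' \<mu>)"

definition V1 :: "(complex \<Rightarrow> 'h1::chilbert \<Rightarrow>\<^sub>L 'h1) \<Rightarrow> 'h1 \<Rightarrow>\<^sub>L 'h1 \<Rightarrow> (real \<Rightarrow> complex) \<Rightarrow> 'h1 \<Rightarrow>\<^sub>L 'h1" where
  "V1 K' Y g = contour_int g (\<lambda>\<mu>. K' \<mu> o\<^sub>L Y o\<^sub>L inv_op (Y - \<mu> *\<^sub>C id_blinfun))"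

definition r_min :: "'h1::chilbert \<Rightarrow>\<^sub>L 'h1 \<Rightarrow> (complex \<Rightarrow> 'h1 \<Rightarrow>\<^sub>L 'h1) \<Rightarrow> (real \<Rightarrow> complex) \<Rightarrow> real" where
  "r_min A K' g = d0 A g * (1 - Var_A A K' g) / 2
     - sqrt ((d0 A g)\<^sup>2 * (1 - Var_A A K' g)\<^sup>2 / 4 - d0 A g * Var_A A K' g * norm A)"

definition X1 :: "'h1::chilbert \<Rightarrow>\<^sub>L 'h1 \<Rightarrow> (complex \<Rightarrow> 'h1 \<Rightarrow>\<^sub>L 'h1) \<Rightarrow> (real \<Rightarrow> complex) \<Rightarrow> 'h1 \<Rightarrow>\<^sub>L 'h1" where
  "X1 A K' g = (THE X. clinear_op X \<and> norm X \<le> r_min A K' g \<and> X = V1 K' (A + X) g)"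

definition H1 :: "'h1::chilbert \<Rightarrow>\<^sub>L 'h1 \<Rightarrow> (complex \<Rightarrow> 'h1 \<Rightarrow>\<^sub>L 'h1) \<Rightarrow> (real \<Rightarrow> complex) \<Rightarrow> 'h1 \<Rightarrow>\<^sub>L 'h1" where
  "H1 A K' g = A + X1 A K' g"

text \<open>If \<open>g\<close> parametrizes \<open>\<Gamma>\<^sub>l\<close>, then \<open>conj_contour g\<close> parametrizes \<open>\<Gamma>\<^sub>(\<^sub>-\<^sub>l\<^sub>)\<close> and
  \<open>H1 A K' (conj_contour g)\<close> is \<open>H\<^sub>1\<^sup>(\<^sup>-\<^sup>l\<^sup>)\<close>.\<close>

definition conj_contour :: "(real \<Rightarrow> complex) \<Rightarrow> real \<Rightarrow> complex" where
  "conj_contour g = (\<lambda>t. cnj (g t))"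

definition Omega :: "'h1::chilbert \<Rightarrow>\<^sub>L 'h1 \<Rightarrow> (complex \<Rightarrow> 'h1 \<Rightarrow>\<^sub>L 'h1) \<Rightarrow> (real \<Rightarrow> complex) \<Rightarrow> 'h1 \<Rightarrow>\<^sub>L 'h1" where
  "Omega A K' g = contour_int g (\<lambda>\<mu>. \<mu> *\<^sub>C
     (inv_op (adj (H1 A K' (conj_contour g)) - \<mu> *\<^sub>C id_blinfun)
        o\<^sub>L K' \<mu> o\<^sub>L inv_op (H1 A K' g - \<mu> *\<^sub>C id_blinfun)))"

definition O_set :: "'h1::chilbert \<Rightarrow>\<^sub>L 'h1 \<Rightarrow> (complex \<Rightarrow> 'h1 \<Rightarrow>\<^sub>L 'h1) \<Rightarrow> (real \<Rightarrow> complex) \<Rightarrow> complex set" where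
  "O_set A K' g = {z. infdist z (spectrum A) \<le> d0 A g * (1 - Var_A A K' g) / 2}"

end

theory Submission
  imports Defs
begin

text \<open>
  Write \<open>H = H\<^sub>1\<^sup>(\<^sup>l\<^sup>)\<close>, \<open>G = H\<^sub>1\<^sup>(\<^sup>-\<^sup>l\<^sup>)\<^sup>*\<close> and \<open>L(z) = \<integral> d\<mu> \<mu> (z - \<mu>)\<^sup>-\<^sup>1 (G - \<mu>)\<^sup>-\<^sup>1 K'(\<mu>) (H - \<mu>)\<^sup>-\<^sup>1\<close>. Partial
  fractions turn the equations defining \<open>H\<close> and \<open>G\<close> into two factorizations
  \<open>M\<^sub>1(z) = W(z) (H - z)\<close> and \<open>M\<^sub>1(z) = (G - z) (1 + \<Omega> + L(z) (H - z))\<close>, where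
  \<open>W(z) = 1 + \<Omega> + (G - z) L(z)\<close> satisfies \<open>\<parallel>W(z) - 1\<parallel> < 1\<close> on a neighbourhood of \<open>\<O>\<close>. Comparing them
  gives \<open>G (1 + \<Omega>) = (1 + \<Omega>) H\<close> and then
  \<open>M\<^sub>1(z)\<^sup>-\<^sup>1 = (H - z)\<^sup>-\<^sup>1 (1 + \<Omega>)\<^sup>-\<^sup>1 - (1 + \<Omega>)\<^sup>-\<^sup>1 L(z) W(z)\<^sup>-\<^sup>1\<close>.
  The last term is holomorphic on a neighbourhood of \<open>\<O>\<close>, which has no holes because \<open>\<O>\<close> is a union of
  equal discs centred on the real axis; so only the resolvent of \<open>H\<close> contributes to the integral along \<open>\<gamma>\<close>.
\<close>

text \<open>One kernel bound carries the analysis. Let dist be the distance from a contour point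
  \<mu> to \<open>spectrum A\<close>. The spectrum lies in the disc of radius |A|, so |\<mu>| \<le>
  dist + |A|; also dist \<ge> d. Hence |\<mu>| / ((dist - a) (dist - b)) \<le> \<kappa> / dist for
  all a, b up to a radius slightly beyond that of \<O>. The same \<kappa> serves the contraction
  that produces X, the norm of \<Omega> and the norm of W - 1, and \<kappa> v < 1 is what the
  quadratic hypothesis gives; its strictness pays for the larger radius. This needs the sharp bound
  1 / dist for selfadjoint resolvents.

  The contour \<gamma> is merely rectifiable and may consist of several loops whose winding numbers
  are known only in sum. So integrals are limits of Riemann-Stieltjes sums, and no loop is deformed:
  the holomorphic term is integrated by a primitive on each component, the resolvent by a Liouville
  argument. Testing against vectors reduces both to scalar functions.\<close>

instantiation complex :: complex_normed_vector
begin

definition scaleC_complex :: "complex \<Rightarrow> complex \<Rightarrow> complex"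
  where "scaleC_complex c x = c * x"

instance
  by standard (auto simp: scaleC_complex_def algebra_simps scaleR_conv_of_real norm_mult)

end

lemma scaleC_one [simp]: "1 *\<^sub>C (x::'a::complex_normed_vector) = x"
  using scaleC_of_real[of 1 x] by simp

interpretation scaleC: bounded_bilinear "scaleC :: complex \<Rightarrow> 'a::complex_normed_vector \<Rightarrow> 'a"
proof
  fix r :: real and c :: complex and x :: 'a
  show "(r *\<^sub>R c) *\<^sub>C x = r *\<^sub>R (c *\<^sub>C x)"
    unfolding scaleR_conv_of_real scaleC_of_real[symmetric, of r "c *\<^sub>C x"] scaleC_scaleC ..
  show "c *\<^sub>C (r *\<^sub>R x) = r *\<^sub>R (c *\<^sub>C x)"
    by (simp only: scaleC_of_real[symmetric] scaleC_scaleC mult.commute)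
  show "\<exists>K. \<forall>(c::complex) (x::'a). norm (c *\<^sub>C x) \<le> norm c * norm x * K"
    by (rule exI[of _ 1]) (simp add: norm_scaleC)
qed (simp_all add: scaleC_add_left scaleC_add_right)

lemmas scaleC_simps [simp] = scaleC.zero_left scaleC.zero_right scaleC.minus_left scaleC.minus_right

section \<open>Riemann--Stieltjes integrals along curves\<close>

text \<open>Any majorant \<open>V\<close> of the variation will do. \<open>V t = t\<close> covers a
  curve parametrized by arc length, the accumulated length covers an arbitrary rectifiable
  loop.\<close>

definition var_bound :: "(real \<Rightarrow> real) \<Rightarrow> (real \<Rightarrow> complex) \<Rightarrow> real \<Rightarrow> real \<Rightarrow> bool" where
  "var_bound V g a b \<longleftrightarrow> (\<forall>u v. a \<le> u \<and> u \<le> v \<and> v \<le> b \<longrightarrow> cmod (g v - g u) \<le> V v - V u)"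

lemma var_boundD: "var_bound V g a b \<Longrightarrow> a \<le> u \<Longrightarrow> u \<le> v \<Longrightarrow> v \<le> b \<Longrightarrow> cmod (g v - g u) \<le> V v - V u"
  by (auto simp: var_bound_def)

lemma var_bound_subset: "var_bound V g a b \<Longrightarrow> a \<le> a' \<Longrightarrow> b' \<le> b \<Longrightarrow> var_bound V g a' b'"
  by (auto simp: var_bound_def)

lemma tagged_division_interval:
  fixes a b :: real
  assumes "p tagged_division_of {a..b}" "(x, J) \<in> p"
  obtains u v where "J = {u..v}" "u \<le> x" "x \<le> v" "a \<le> u" "v \<le> b" "Inf J = u" "Sup J = v"
proof -
  obtain u v where J: "J = cbox u v" using tagged_division_ofD(4)[OF assms] by blast
  have xJ: "x \<in> J" and sub: "J \<subseteq> {a..b}" using tagged_division_ofD(2,3)[OF assms] by auto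
  have "u \<le> x" "x \<le> v" using xJ J by auto
  moreover have "a \<le> u" "v \<le> b" using sub J calculation by auto
  ultimately show ?thesis using that[of u v] J by auto
qed

lemma fine_ball_mono: "(\<lambda>x. ball x d) fine p \<Longrightarrow> d \<le> d' \<Longrightarrow> (\<lambda>x. ball x d') fine p"
  using subset_ball[of d d'] unfolding fine_def by blast

definition rs_sum :: "(complex \<Rightarrow> 'v::complex_normed_vector) \<Rightarrow> (real \<Rightarrow> complex) \<Rightarrow> (real \<times> real set) set \<Rightarrow> 'v" where
  "rs_sum f g p = (\<Sum>(x, J)\<in>p. (g (Sup J) - g (Inf J)) *\<^sub>C f (g x))"

lemma has_curve_integral_rs_sum:
  "has_curve_integral f I g a b \<longleftrightarrow>
     (\<forall>e>0. \<exists>d>0. \<forall>p. p tagged_division_of {a..b} \<and> (\<lambda>x. ball x d) fine p \<longrightarrow> norm (rs_sum f g p - I) < e)"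
  unfolding has_curve_integral_def rs_sum_def ..

lemma has_curve_integralD:
  "has_curve_integral f I g a b \<Longrightarrow> 0 < e \<Longrightarrow>
     \<exists>d>0. \<forall>p. p tagged_division_of {a..b} \<longrightarrow> (\<lambda>x. ball x d) fine p \<longrightarrow> norm (rs_sum f g p - I) < e"
  unfolding has_curve_integral_rs_sum imp_conjL by blast

lemma has_curve_integralI:
  assumes "\<And>e. 0 < e \<Longrightarrow> \<exists>d>0. \<forall>p. p tagged_division_of {a..b} \<longrightarrow> (\<lambda>x. ball x d) fine p \<longrightarrow>
    norm (rs_sum f g p - I) < e"
  shows "has_curve_integral f I g a b"
  unfolding has_curve_integral_rs_sum imp_conjL using assms by blast

lemma fine_tagged_division:
  assumes "0 < d"
  obtains p where "p tagged_division_of {a..b::real}" "(\<lambda>x. ball x d) fine p"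
  using fine_division_exists_real[OF gauge_ball[OF assms]] by blast

lemma has_curve_integral_unique:
  assumes I: "has_curve_integral f I g a b" and J: "has_curve_integral f J g a b"
  shows "I = J"
proof (rule ccontr)
  assume "I \<noteq> J"
  define e where "e = norm (I - J) / 2"
  have e: "e > 0" using \<open>I \<noteq> J\<close> by (simp add: e_def)
  obtain d1 where d1: "d1 > 0" "\<And>p. p tagged_division_of {a..b} \<Longrightarrow> (\<lambda>x. ball x d1) fine p \<Longrightarrow> norm (rs_sum f g p - I) < e"
    using has_curve_integralD[OF I e] by meson
  obtain d2 where d2: "d2 > 0" "\<And>p. p tagged_division_of {a..b} \<Longrightarrow> (\<lambda>x. ball x d2) fine p \<Longrightarrow> norm (rs_sum f g p - J) < e"
    using has_curve_integralD[OF J e] by meson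
  obtain p where p: "p tagged_division_of {a..b}" "(\<lambda>x. ball x (min d1 d2)) fine p"
    using fine_tagged_division[of "min d1 d2" a b] d1(1) d2(1) by auto
  have f1: "(\<lambda>x. ball x d1) fine p" "(\<lambda>x. ball x d2) fine p"
    using fine_ball_mono[OF p(2)] by auto
  have "norm (I - J) \<le> norm (rs_sum f g p - J) + norm (rs_sum f g p - I)"
    using norm_triangle_ineq4[of "rs_sum f g p - J" "rs_sum f g p - I"] by simp
  also have "\<dots> < e + e" using d1(2)[OF p(1) f1(1)] d2(2)[OF p(1) f1(2)] by simp
  finally show False by (simp add: e_def)
qed

lemma curve_integral_eq:
  "has_curve_integral f I g a b \<Longrightarrow> curve_integral f g a b = I"
  unfolding curve_integral_def by (rule the_equality) (auto intro: has_curve_integral_unique)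

text \<open>Clamping \<open>x\<close> to the cell from \<open>t i\<close> to
  \<open>t (Suc i)\<close> moves it off \<open>t i\<close> only if the cell starts below
  \<open>x\<close>, so each summand is the increment of \<open>g (min x (t i))\<close> in
  \<open>i\<close> and the sum telescopes.\<close>

lemma sum_clamp:
  fixes t :: "nat \<Rightarrow> real" and g :: "real \<Rightarrow> 'a::ab_group_add"
  assumes "mono t" "t 0 \<le> x"
  shows "(\<Sum>i<m. g (max (t i) (min x (t (Suc i)))) - g (t i)) = g (min x (t m)) - g (t 0)"
proof (induction m)
  case 0
  then show ?case using assms by (simp add: min_def)
next
  case (Suc m)
  have "t m \<le> t (Suc m)" using assms(1) by (simp add: mono_def)
  then have "g (max (t m) (min x (t (Suc m)))) - g (t m) = g (min x (t (Suc m))) - g (min x (t m))"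
    by (cases "x \<le> t m") (auto simp: min_def max_def)
  then show ?case using Suc by simp
qed

text \<open>Clamping the end points of the intervals of \<open>p\<close> to each cell of the uniform partition realises
  the common refinement without intersecting intervals.\<close>

lemma rs_sum_step_bound:
  fixes h :: "real \<Rightarrow> 'v::complex_normed_vector"
  assumes p: "p tagged_division_of {a..b}" and fine: "(\<lambda>x. ball x d) fine p" and ab: "a \<le> b"
    and vb: "var_bound V g a b" and N: "0 < N" "(b - a) / real N < d"
    and t: "t = (\<lambda>i. a + real i * ((b - a) / real N))"
    and osc: "\<And>r s. r \<in> {a..b} \<Longrightarrow> s \<in> {a..b} \<Longrightarrow> \<bar>r - s\<bar> < 2 * d \<Longrightarrow> norm (h r - h s) \<le> e"
    and e: "0 \<le> e"
  shows "norm ((\<Sum>(x, J)\<in>p. (g (Sup J) - g (Inf J)) *\<^sub>C h x)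
           - (\<Sum>i<N. (g (t (Suc i)) - g (t i)) *\<^sub>C h (t i))) \<le> e * (V b - V a)"
proof -
  have mono: "mono t" unfolding t using ab N
    by (intro monoI add_left_mono mult_right_mono) auto
  have t0: "t 0 = a" and tN: "t N = b" using N by (auto simp: t)
  have tI: "t i \<in> {a..b}" if "i \<le> N" for i
    using monoD[OF mono, of 0 i] monoD[OF mono, of i N] that t0 tN by auto
  have tS: "t (Suc i) - t i < d" "t i \<le> t (Suc i)" for i
    using N divide_right_mono[OF ab, of "real N"]
    by (auto simp: t algebra_simps add_divide_distrib diff_divide_distrib)
  define c where "c i x = max (t i) (min x (t (Suc i)))" for i x
  define G where "G i J = g (c i (Sup J)) - g (c i (Inf J))" for i and J :: "real set"
  define U where "U i J = V (c i (Sup J)) - V (c i (Inf J))" for i and J :: "real set"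
  note fin = tagged_division_ofD(1)[OF p]
  have cells: "(\<Sum>i<N. g (c i (Sup J)) - g (c i (Inf J))) = g (Sup J) - g (Inf J)"
      "(\<Sum>i<N. V (c i (Sup J)) - V (c i (Inf J))) = V (Sup J) - V (Inf J)" if xJ: "(x, J) \<in> p" for x J
  proof -
    obtain u v where J: "Inf J = u" "Sup J = v" "u \<le> v" "a \<le> u" "v \<le> b"
      using tagged_division_interval[OF p xJ] order_trans by metis
    have "(\<Sum>i<N. g (c i v) - g (t i)) - (\<Sum>i<N. g (c i u) - g (t i)) = g v - g u"
      unfolding c_def using sum_clamp[OF mono, of v g N] sum_clamp[OF mono, of u g N] J t0 tN by simp
    then show "(\<Sum>i<N. g (c i (Sup J)) - g (c i (Inf J))) = g (Sup J) - g (Inf J)"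
      unfolding J by (simp add: sum_subtractf)
    have "(\<Sum>i<N. V (c i v) - V (t i)) - (\<Sum>i<N. V (c i u) - V (t i)) = V v - V u"
      unfolding c_def using sum_clamp[OF mono, of v V N] sum_clamp[OF mono, of u V N] J t0 tN by simp
    then show "(\<Sum>i<N. V (c i (Sup J)) - V (c i (Inf J))) = V (Sup J) - V (Inf J)"
      unfolding J by (simp add: sum_subtractf)
  qed
  \<comment> \<open>Both sums become double sums over pairs of an interval of \<open>p\<close> and a
    cell: the first by cutting each interval along the cells, the second by cutting each cell along
    the intervals.\<close>
  have S1: "(\<Sum>(x, J)\<in>p. (g (Sup J) - g (Inf J)) *\<^sub>C h x) = (\<Sum>(x, J)\<in>p. \<Sum>i<N. G i J *\<^sub>C h x)"
    by (intro sum.cong refl) (auto simp: G_def cells simp flip: scaleC.sum_left)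
  have S2: "(g (t (Suc i)) - g (t i)) *\<^sub>C h (t i) = (\<Sum>(x, J)\<in>p. G i J *\<^sub>C h (t i))" if "i < N" for i
  proof -
    have "(\<Sum>(x, J)\<in>p. G i J) = g (c i b) - g (c i a)"
      unfolding G_def by (rule additive_tagged_division_1[OF ab p])
    moreover have "c i b = t (Suc i)" "c i a = t i"
      using tI[of "Suc i"] tI[of i] that tS[of i] by (auto simp: c_def)
    ultimately show ?thesis by (simp add: case_prod_beta flip: scaleC.sum_left)
  qed
  have "(\<Sum>(x, J)\<in>p. (g (Sup J) - g (Inf J)) *\<^sub>C h x) - (\<Sum>i<N. (g (t (Suc i)) - g (t i)) *\<^sub>C h (t i))
      = (\<Sum>(x, J)\<in>p. \<Sum>i<N. G i J *\<^sub>C h x) - (\<Sum>i<N. \<Sum>(x, J)\<in>p. G i J *\<^sub>C h (t i))"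
    unfolding S1 by (simp add: S2)
  also have "\<dots> = (\<Sum>(x, J)\<in>p. \<Sum>i<N. G i J *\<^sub>C (h x - h (t i)))"
    by (simp add: case_prod_beta scaleC.diff_right sum_subtractf sum.swap[where A = "{..<N}" and B = p])
  also have "norm \<dots> \<le> (\<Sum>(x, J)\<in>p. \<Sum>i<N. e * U i J)"
  proof (rule sum_norm_le, clarify)
    fix x J assume xJ: "(x, J) \<in> p"
    obtain u v where J: "J = {u..v}" "Inf J = u" "Sup J = v" "u \<le> x" "x \<le> v" "a \<le> u" "v \<le> b"
      using tagged_division_interval[OF p xJ] by metis
    have Jb: "{u..v} \<subseteq> ball x d" using fine xJ J(1) by (auto simp: fine_def)
    show "norm (\<Sum>i<N. G i J *\<^sub>C (h x - h (t i))) \<le> (\<Sum>i<N. e * U i J)"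
    proof (rule sum_norm_le)
      fix i assume i: "i \<in> {..<N}"
      have ti: "t i \<in> {a..b}" "t (Suc i) \<in> {a..b}" using tI[of i] tI[of "Suc i"] i by auto
      have GU: "cmod (G i J) \<le> U i J"
        unfolding G_def U_def J using ti J tS(2)[of i]
        by (intro var_boundD[OF vb]) (auto simp: c_def)
      show "norm (G i J *\<^sub>C (h x - h (t i))) \<le> e * U i J"
      proof (cases "c i u = c i v")
        case True
        then show ?thesis by (simp add: G_def U_def J(2,3))
      next
        case False
        then have *: "u < t (Suc i)" "t i < v" using J(4,5) tS(2)[of i]
          by (auto simp: c_def max_def min_def split: if_splits)
        \<comment> \<open>A nonzero increment means that \<open>J\<close> meets the cell. A common
          point lies within \<open>d\<close> of the tag and within \<open>d\<close> of
          \<open>t i\<close>, which is why \<open>osc\<close> is assumed up to distance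
          \<open>2 * d\<close>.\<close>
        define y where "y = max u (t i)"
        have "y \<in> {u..v}" "t i \<le> y" "y \<le> t (Suc i)"
          using * J(4,5) tS(2)[of i] by (auto simp: y_def)
        then have "\<bar>x - y\<bar> < d" "\<bar>y - t i\<bar> < d"
          using Jb tS(1)[of i] by (auto simp: dist_real_def)
        then have "\<bar>x - t i\<bar> < 2 * d" by linarith
        then have "norm (h x - h (t i)) \<le> e" using osc ti J by auto
        then have "cmod (G i J) * norm (h x - h (t i)) \<le> U i J * e"
          using GU by (intro mult_mono') auto
        then show ?thesis by (simp add: norm_scaleC mult.commute)
      qed
    qed
  qed
  also have "\<dots> = e * (\<Sum>(x, J)\<in>p. V (Sup J) - V (Inf J))"
    unfolding sum_distrib_left U_def by (intro sum.cong refl) (auto simp: cells simp flip: sum_distrib_left)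
  also have "\<dots> = e * (V b - V a)" by (simp add: additive_tagged_division_1[OF ab p])
  finally show ?thesis .
qed

text \<open>Uniform left-endpoint sums \<open>S N\<close> are never compared with each other
  directly: any two are close to the sum over one fine tagged division, which makes them Cauchy, and
  the same estimate identifies their limit as the integral.\<close>

lemma has_curve_integral_exists:
  fixes f :: "complex \<Rightarrow> 'v::{complex_normed_vector, banach}"
  assumes ab: "a \<le> b" and vb: "var_bound V g a b" and cont: "continuous_on {a..b} (\<lambda>t. f (g t))"
  shows "\<exists>I. has_curve_integral f I g a b"
proof -
  define h where "h = (\<lambda>t. f (g t))"
  define t where "t N = (\<lambda>i. a + real i * ((b - a) / real N))" for N :: nat
  define S where "S N = (\<Sum>i<N. (g (t N (Suc i)) - g (t N i)) *\<^sub>C h (t N i))" for N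
  \<comment> \<open>The added 1 allows division by \<open>W\<close> when the curve has no
    variation.\<close>
  define W where "W = V b - V a + 1"
  have "cmod (g b - g a) \<le> V b - V a" by (rule var_boundD[OF vb]) (use ab in auto)
  then have V0: "0 \<le> V b - V a" using norm_ge_zero[of "g b - g a"] by linarith
  have W: "W > 0" "V b - V a \<le> W" using V0 by (auto simp: W_def)
  have uc: "uniformly_continuous_on {a..b} h"
    unfolding h_def by (rule compact_uniformly_continuous[OF cont]) simp
  have key: "\<exists>d>0. \<exists>N0. \<forall>N\<ge>N0. \<forall>p. p tagged_division_of {a..b} \<and> (\<lambda>x. ball x d) fine p \<longrightarrow>
      norm (rs_sum f g p - S N) \<le> e" if e: "e > 0" for e
  proof -
    have "e / W > 0" using e W by simp
    then obtain d0 where d0: "d0 > 0"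
      "\<And>r s. r \<in> {a..b} \<Longrightarrow> s \<in> {a..b} \<Longrightarrow> dist s r < d0 \<Longrightarrow> dist (h s) (h r) < e / W"
      using uc unfolding uniformly_continuous_on_def by meson
    define d where "d = d0 / 2"
    have d: "d > 0" using d0 by (simp add: d_def)
    obtain N0 where N0: "(b - a) / d < real N0" using reals_Archimedean2 by blast
    have "norm (rs_sum f g p - S N) \<le> e"
      if N: "N \<ge> Suc N0" and p: "p tagged_division_of {a..b}" "(\<lambda>x. ball x d) fine p" for N p
    proof -
      have Npos: "0 < N" using N by simp
      have "(b - a) / d < real N" using N0 N by linarith
      then have Nd: "(b - a) / real N < d"
        using d Npos by (simp add: field_simps)
      have "norm (rs_sum f g p - S N) \<le> e / W * (V b - V a)"
        unfolding S_def rs_sum_def h_def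
      proof (rule rs_sum_step_bound[OF p ab vb Npos Nd t_def])
        show "norm (f (g r) - f (g s)) \<le> e / W" if "r \<in> {a..b}" "s \<in> {a..b}" "\<bar>r - s\<bar> < 2 * d" for r s
          using d0(2)[of s r] that by (auto simp: d_def dist_norm h_def)
      qed (use e W in auto)
      also have "\<dots> \<le> e / W * W" using W e by (intro mult_left_mono) auto
      finally show ?thesis using W by simp
    qed
    then show ?thesis using d by blast
  qed
  have "Cauchy S"
  proof (rule metric_CauchyI)
    fix e :: real assume "e > 0"
    then have pos: "e / 3 > 0" by simp
    then obtain d N0 where d: "d > 0" and *: "\<And>N p. N \<ge> N0 \<Longrightarrow> p tagged_division_of {a..b} \<Longrightarrow> (\<lambda>x. ball x d) fine p \<Longrightarrow>
      norm (rs_sum f g p - S N) \<le> e / 3"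
      using key[of "e / 3"] pos by blast
    obtain p where p: "p tagged_division_of {a..b}" "(\<lambda>x. ball x d) fine p"
      using fine_tagged_division[OF d] by blast
    have "dist (S m) (S n) < e" if "m \<ge> N0" "n \<ge> N0" for m n
    proof -
      have "dist (S m) (S n) \<le> dist (rs_sum f g p) (S m)
            + dist (rs_sum f g p) (S n)"
        by (rule dist_triangle3)
      also have "\<dots> \<le> e / 3 + e / 3" using *[OF that(1) p] *[OF that(2) p] by (simp add: dist_norm)
      finally show ?thesis using \<open>e > 0\<close> by simp
    qed
    then show "\<exists>M. \<forall>m\<ge>M. \<forall>n\<ge>M. dist (S m) (S n) < e" by blast
  qed
  then obtain I where I: "S \<longlonglongrightarrow> I" using Cauchy_convergent convergent_def by blast
  have "has_curve_integral f I g a b"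
  proof (rule has_curve_integralI)
    fix e :: real assume e: "e > 0"
    then have pos: "e / 2 > 0" by simp
    then obtain d N0 where d: "d > 0" and *: "\<And>N p. N \<ge> N0 \<Longrightarrow> p tagged_division_of {a..b} \<Longrightarrow> (\<lambda>x. ball x d) fine p \<Longrightarrow>
      norm (rs_sum f g p - S N) \<le> e / 2"
      using key[of "e / 2"] pos by blast
    have "norm (rs_sum f g p - I) < e" if p: "p tagged_division_of {a..b}" "(\<lambda>x. ball x d) fine p" for p
    proof -
      have "(\<lambda>N. norm (rs_sum f g p - S N)) \<longlonglongrightarrow> norm (rs_sum f g p - I)" by (intro tendsto_intros I)
      then have "norm (rs_sum f g p - I) \<le> e / 2" by (rule Lim_bounded) (use * p in blast)
      then show ?thesis using e by simp
    qed
    then show "\<exists>d>0. \<forall>p. p tagged_division_of {a..b} \<longrightarrow> (\<lambda>x. ball x d) fine p \<longrightarrow> norm (rs_sum f g p - I) < e"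
      using d by blast
  qed
  then show ?thesis by blast
qed

text \<open>The map \<sigma> is either the identity or complex conjugation, with left inverse
  \<open>\<sigma>'\<close>. Conjugation carries integrals along \<open>g\<close> to integrals along
  the conjugate contour, as adjoints require.\<close>

lemma has_curve_integral_semilinear:
  assumes I: "has_curve_integral f I g a b" and L: "bounded_linear L" "\<And>c x. L (c *\<^sub>C x) = \<sigma> c *\<^sub>C L x"
    and \<sigma>: "\<And>w z. \<sigma> (w - z) = \<sigma> w - \<sigma> z" "\<And>z. \<sigma>' (\<sigma> z) = z"
  shows "has_curve_integral (\<lambda>z. L (f (\<sigma>' z))) (L I) (\<lambda>t. \<sigma> (g t)) a b"
proof (rule has_curve_integralI)
  interpret bounded_linear L by fact
  fix e :: real assume e: "e > 0"
  obtain K where K: "K > 0" "\<And>x. norm (L x) \<le> norm x * K" using pos_bounded by blast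
  obtain d where d: "d > 0" "\<And>p. p tagged_division_of {a..b} \<Longrightarrow> (\<lambda>x. ball x d) fine p \<Longrightarrow> norm (rs_sum f g p - I) < e / K"
    using has_curve_integralD[OF I divide_pos_pos[OF e K(1)]] by meson
  have "norm (rs_sum (\<lambda>z. L (f (\<sigma>' z))) (\<lambda>t. \<sigma> (g t)) p - L I) < e"
    if p: "p tagged_division_of {a..b}" "(\<lambda>x. ball x d) fine p" for p
  proof -
    have "rs_sum (\<lambda>z. L (f (\<sigma>' z))) (\<lambda>t. \<sigma> (g t)) p - L I = L (rs_sum f g p - I)"
      by (simp add: rs_sum_def diff sum L(2) \<sigma> case_prod_beta)
    also have "norm \<dots> < e"
      using K(2)[of "rs_sum f g p - I"] d(2)[OF p] K(1) by (simp add: field_simps)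
    finally show ?thesis .
  qed
  then show "\<exists>d>0. \<forall>p. p tagged_division_of {a..b} \<longrightarrow> (\<lambda>x. ball x d) fine p \<longrightarrow>
      norm (rs_sum (\<lambda>z. L (f (\<sigma>' z))) (\<lambda>t. \<sigma> (g t)) p - L I) < e"
    using d(1) by blast
qed

lemma has_curve_integral_linear:
  assumes "has_curve_integral f I g a b" "bounded_linear L" "\<And>c x. L (c *\<^sub>C x) = c *\<^sub>C L x"
  shows "has_curve_integral (\<lambda>z. L (f z)) (L I) g a b"
  using has_curve_integral_semilinear[of f I g a b L "\<lambda>z. z" "\<lambda>z. z"] assms by simp

lemma has_curve_integral_scaleC:
  "has_curve_integral f I g a b \<Longrightarrow> has_curve_integral (\<lambda>z. c *\<^sub>C f z) (c *\<^sub>C I) g a b"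
  by (rule has_curve_integral_linear[where L = "\<lambda>x. c *\<^sub>C x"])
    (auto simp: bounded_linear_scaleC_right scaleC_scaleC mult.commute)

lemma has_curve_integral_add:
  assumes "has_curve_integral f I g a b" "has_curve_integral f' I' g a b"
  shows "has_curve_integral (\<lambda>z. f z + f' z) (I + I') g a b"
proof (rule has_curve_integralI)
  fix e :: real assume "e > 0"
  then have e2: "e / 2 > 0" by simp
  obtain d where d: "d > 0" "\<And>p. p tagged_division_of {a..b} \<Longrightarrow> (\<lambda>x. ball x d) fine p \<Longrightarrow> norm (rs_sum f g p - I) < e / 2"
    using has_curve_integralD[OF assms(1) e2] by meson
  obtain d' where d': "d' > 0" "\<And>p. p tagged_division_of {a..b} \<Longrightarrow> (\<lambda>x. ball x d') fine p \<Longrightarrow> norm (rs_sum f' g p - I') < e / 2"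
    using has_curve_integralD[OF assms(2) e2] by meson
  have "norm (rs_sum (\<lambda>z. f z + f' z) g p - (I + I')) < e"
    if p: "p tagged_division_of {a..b}" "(\<lambda>x. ball x (min d d')) fine p" for p
  proof -
    have fine: "(\<lambda>x. ball x d) fine p" "(\<lambda>x. ball x d') fine p" using fine_ball_mono[OF p(2)] by auto
    have "rs_sum (\<lambda>z. f z + f' z) g p - (I + I') = (rs_sum f g p - I) + (rs_sum f' g p - I')"
      by (simp add: rs_sum_def scaleC_add_right case_prod_beta sum.distrib)
    also have "norm \<dots> < e / 2 + e / 2"
      by (intro norm_triangle_lt add_strict_mono d(2) d'(2) p fine)
    finally show ?thesis by simp
  qed
  moreover have "min d d' > 0" using d(1) d'(1) by simp
  ultimately show "\<exists>d>0. \<forall>p. p tagged_division_of {a..b} \<longrightarrow> (\<lambda>x. ball x d) fine p \<longrightarrow>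
      norm (rs_sum (\<lambda>z. f z + f' z) g p - (I + I')) < e" by blast
qed

lemma has_curve_integral_cong:
  assumes "has_curve_integral f I g a b" "\<And>t. t \<in> {a..b} \<Longrightarrow> f (g t) = h (g t)"
  shows "has_curve_integral h I g a b"
proof -
  have "rs_sum h g p = rs_sum f g p" if "p tagged_division_of {a..b}" for p
    unfolding rs_sum_def by (intro sum.cong refl) (use assms(2) tag_in_interval[OF that] in auto)
  then show ?thesis using assms(1) unfolding has_curve_integral_rs_sum by simp
qed

text \<open>Because all three integrals are assumed to exist, it is enough to test the one over the
  whole interval on divisions that respect the point \<open>b\<close>.\<close>

lemma has_curve_integral_combine:
  assumes ab: "has_curve_integral f I g a b" and bc: "has_curve_integral f J g b c"
    and ac: "has_curve_integral f L g a c" and le: "a \<le> b" "b \<le> c"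
  shows "L = I + J"
proof (rule ccontr)
  assume "L \<noteq> I + J"
  define e where "e = norm (L - (I + J)) / 3"
  have e: "e > 0" using \<open>L \<noteq> I + J\<close> by (simp add: e_def)
  let ?S = "rs_sum f g"
  obtain d1 where d1: "d1 > 0" "\<And>p. p tagged_division_of {a..b} \<Longrightarrow> (\<lambda>x. ball x d1) fine p \<Longrightarrow> norm (?S p - I) < e"
    using has_curve_integralD[OF ab e] by meson
  obtain d2 where d2: "d2 > 0" "\<And>p. p tagged_division_of {b..c} \<Longrightarrow> (\<lambda>x. ball x d2) fine p \<Longrightarrow> norm (?S p - J) < e"
    using has_curve_integralD[OF bc e] by meson
  obtain d3 where d3: "d3 > 0" "\<And>p. p tagged_division_of {a..c} \<Longrightarrow> (\<lambda>x. ball x d3) fine p \<Longrightarrow> norm (?S p - L) < e"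
    using has_curve_integralD[OF ac e] by meson
  define d where "d = min d1 (min d2 d3)"
  have d: "d > 0" "d \<le> d1" "d \<le> d2" "d \<le> d3" using d1(1) d2(1) d3(1) by (simp_all add: d_def)
  obtain p where p: "p tagged_division_of {a..b}" "(\<lambda>x. ball x d) fine p" using fine_tagged_division[OF d(1)] by blast
  obtain q where q: "q tagged_division_of {b..c}" "(\<lambda>x. ball x d) fine q" using fine_tagged_division[OF d(1)] by blast
  have "interior {a..b} \<inter> interior {b..c} = {}" by simp
  from tagged_division_Un[OF p(1) q(1) this] have pq: "(p \<union> q) tagged_division_of {a..c}"
    unfolding ivl_disj_un_two_touch(4)[OF le] .
  have "?S (p \<union> q) = ?S p + ?S q"
    unfolding rs_sum_def
  proof (rule sum.union_inter_neutral)
    \<comment> \<open>A pair belonging to both divisions can only be the degenerate interval at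
      \<open>b\<close>, which contributes nothing.\<close>
    show "\<forall>x\<in>p \<inter> q. (case x of (x, J) \<Rightarrow> (g (Sup J) - g (Inf J)) *\<^sub>C f (g x)) = 0"
    proof clarify
      fix x J assume xJ: "(x, J) \<in> p" "(x, J) \<in> q"
      obtain u v where uv: "Inf J = u" "Sup J = v" "u \<le> x" "x \<le> v" "v \<le> b"
        by (rule tagged_division_interval[OF p(1) xJ(1)]) blast
      obtain u' where "Inf J = u'" "b \<le> u'"
        by (rule tagged_division_interval[OF q(1) xJ(2)]) blast
      then have "Inf J = Sup J" using uv by linarith
      then show "(g (Sup J) - g (Inf J)) *\<^sub>C f (g x) = 0" by simp
    qed
  qed (rule tagged_division_ofD(1)[OF p(1)] tagged_division_ofD(1)[OF q(1)])+
  then have "L - (I + J) = (?S p - I) + (?S q - J) - (?S (p \<union> q) - L)" by simp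
  also have "norm \<dots> \<le> norm (?S p - I) + norm (?S q - J) + norm (?S (p \<union> q) - L)"
    using norm_triangle_ineq4[of "(?S p - I) + (?S q - J)" "?S (p \<union> q) - L"]
      norm_triangle_ineq[of "?S p - I" "?S q - J"] by linarith
  also have "\<dots> < e + e + e"
    using d1(2)[OF p(1) fine_ball_mono[OF p(2) d(2)]] d2(2)[OF q(1) fine_ball_mono[OF q(2) d(3)]]
      d3(2)[OF pq fine_Un[OF fine_ball_mono[OF p(2) d(4)] fine_ball_mono[OF q(2) d(4)]]] by linarith
  finally show False by (simp add: e_def)
qed

lemma has_curve_integral_bound:
  assumes I: "has_curve_integral f I g a b" and ab: "a \<le> b" and vb: "var_bound V g a b"
    and M: "\<And>t. t \<in> {a..b} \<Longrightarrow> norm (f (g t)) \<le> M"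
  shows "norm I \<le> M * (V b - V a)"
proof (rule field_le_epsilon)
  fix e :: real assume e: "e > 0"
  obtain d where d: "d > 0" "\<And>p. p tagged_division_of {a..b} \<Longrightarrow> (\<lambda>x. ball x d) fine p \<Longrightarrow> norm (rs_sum f g p - I) < e"
    using has_curve_integralD[OF I e] by meson
  obtain p where p: "p tagged_division_of {a..b}" "(\<lambda>x. ball x d) fine p" using fine_tagged_division[OF d(1)] by blast
  let ?S = "rs_sum f g p"
  have "norm ?S \<le> (\<Sum>(x, J)\<in>p. M * (V (Sup J) - V (Inf J)))"
    unfolding rs_sum_def
  proof (rule sum_norm_le, clarify)
    fix x J assume "(x, J) \<in> p"
    then obtain u v where J: "J = {u..v}" "u \<le> x" "x \<le> v" "a \<le> u" "v \<le> b" "Inf J = u" "Sup J = v"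
      using tagged_division_interval[OF p(1)] by metis
    have "cmod (g v - g u) * norm (f (g x)) \<le> (V v - V u) * M"
      using J by (intro mult_mono' var_boundD[OF vb] M) auto
    then show "norm ((g (Sup J) - g (Inf J)) *\<^sub>C f (g x)) \<le> M * (V (Sup J) - V (Inf J))"
      using J by (simp add: norm_scaleC mult.commute)
  qed
  also have "\<dots> = M * (V b - V a)"
    unfolding additive_tagged_division_1[OF ab p(1), symmetric] by (simp add: sum_distrib_left case_prod_beta)
  finally have "norm ?S \<le> M * (V b - V a)" .
  moreover have "norm I \<le> norm ?S + norm (?S - I)"
    using norm_triangle_ineq4[of ?S "?S - I"] by simp
  ultimately show "norm I \<le> M * (V b - V a) + e" using d(2)[OF p] by linarith
qed

text \<open>A division that is fine for the mesh of the curve integral and for the gauge of \<phi>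
  compares the two sums term by term. Integrability of \<phi> thus suffices, without
  continuity.\<close>

lemma has_curve_integral_norm_le_integral:
  assumes I: "has_curve_integral f I g a b" and vb: "var_bound (\<lambda>t. t) g a b"
    and N: "(\<phi> has_integral N) {a..b}" and M: "\<And>t. t \<in> {a..b} \<Longrightarrow> norm (f (g t)) \<le> \<phi> t"
  shows "norm I \<le> N"
proof (rule field_le_epsilon)
  fix e :: real assume e: "e > 0"
  then have e2: "e / 2 > 0" by simp
  obtain d where d: "d > 0" "\<And>p. p tagged_division_of {a..b} \<Longrightarrow> (\<lambda>x. ball x d) fine p \<Longrightarrow> norm (rs_sum f g p - I) < e / 2"
    using has_curve_integralD[OF I e2] by meson
  obtain G where G: "gauge G" "\<And>p. p tagged_division_of {a..b} \<Longrightarrow> G fine p \<Longrightarrow>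
        norm ((\<Sum>(x, J)\<in>p. measure lborel J *\<^sub>R \<phi> x) - N) < e / 2"
    using N e2 unfolding has_integral_real by meson
  obtain p where p: "p tagged_division_of {a..b}" "(\<lambda>x. G x \<inter> ball x d) fine p"
    using fine_division_exists_real[OF gauge_Int[OF G(1) gauge_ball[OF d(1)]]] by blast
  have fine: "G fine p" "(\<lambda>x. ball x d) fine p" using p(2) by (auto simp: fine_def)
  let ?S = "rs_sum f g p"
  have "norm ?S \<le> (\<Sum>(x, J)\<in>p. measure lborel J *\<^sub>R \<phi> x)"
    unfolding rs_sum_def
  proof (rule sum_norm_le, clarify)
    fix x J assume "(x, J) \<in> p"
    then obtain u v where J: "J = {u..v}" "u \<le> x" "x \<le> v" "a \<le> u" "v \<le> b" "Inf J = u" "Sup J = v"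
      using tagged_division_interval[OF p(1)] by metis
    have "cmod (g v - g u) * norm (f (g x)) \<le> (v - u) * \<phi> x"
      using J by (intro mult_mono' var_boundD[OF vb] M) auto
    then show "norm ((g (Sup J) - g (Inf J)) *\<^sub>C f (g x)) \<le> measure lborel J *\<^sub>R \<phi> x"
      using J by (simp add: norm_scaleC mult.commute)
  qed
  moreover have "\<bar>(\<Sum>(x, J)\<in>p. measure lborel J *\<^sub>R \<phi> x) - N\<bar> < e / 2" using G(2)[OF p(1) fine(1)] by simp
  moreover have "norm I \<le> norm ?S + norm (?S - I)"
    using norm_triangle_ineq4[of ?S "?S - I"] by simp
  ultimately show "norm I \<le> N + e" using d(2)[OF p(1) fine(2)] by linarith
qed

text \<open>A fundamental theorem that differentiates neither the path nor \<open>q\<close>. The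
  function \<open>q\<close> depends on the parameter and must match the integrand only up to an
  error small relative to \<open>V\<close>. It is used with a holomorphic primitive along the path,
  a continuous logarithm, and a multiple of the path itself.\<close>

lemma has_curve_integral_local_primitive:
  assumes ab: "a \<le> b" and vb: "var_bound V g a b"
    and prim: "\<And>e. e > 0 \<Longrightarrow> \<exists>d>0. \<forall>u s v. a \<le> u \<and> u \<le> s \<and> s \<le> v \<and> v \<le> b \<and> v - u < d \<longrightarrow>
        norm ((g v - g u) *\<^sub>C f (g s) - (q v - q u)) \<le> e * (V v - V u)"
  shows "has_curve_integral f (q b - q a) g a b"
proof (rule has_curve_integralI)
  fix e :: real assume e: "e > 0"
  have "cmod (g b - g a) \<le> V b - V a" by (rule var_boundD[OF vb]) (use ab in auto)
  then have V0: "0 \<le> V b - V a" using norm_ge_zero[of "g b - g a"] by linarith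
  define e' where "e' = e / (V b - V a + 1)"
  have e': "e' > 0" using V0 e by (simp add: e'_def)
  obtain d where d: "d > 0" "\<And>u s v. a \<le> u \<Longrightarrow> u \<le> s \<Longrightarrow> s \<le> v \<Longrightarrow> v \<le> b \<Longrightarrow> v - u < d \<Longrightarrow>
        norm ((g v - g u) *\<^sub>C f (g s) - (q v - q u)) \<le> e' * (V v - V u)"
    using prim[OF e'] by blast
  have "norm (rs_sum f g p - (q b - q a)) < e"
    if p: "p tagged_division_of {a..b}" and fine: "(\<lambda>x. ball x (d/2)) fine p" for p
  proof -
    have "rs_sum f g p - (q b - q a)
        = (\<Sum>(x, J)\<in>p. (g (Sup J) - g (Inf J)) *\<^sub>C f (g x) - (q (Sup J) - q (Inf J)))"
      unfolding additive_tagged_division_1[OF ab p(1), symmetric]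
      by (simp add: rs_sum_def sum_subtractf case_prod_beta)
    also have "norm \<dots> \<le> (\<Sum>(x, J)\<in>p. e' * (V (Sup J) - V (Inf J)))"
    proof (rule sum_norm_le, clarify)
      fix x J assume xJ: "(x, J) \<in> p"
      then obtain u v where J: "J = {u..v}" "u \<le> x" "x \<le> v" "a \<le> u" "v \<le> b" "Inf J = u" "Sup J = v"
        using tagged_division_interval[OF p(1)] by metis
      have "{u..v} \<subseteq> ball x (d/2)" using fine xJ J(1) by (auto simp: fine_def)
      moreover have "u \<in> {u..v}" "v \<in> {u..v}" using J by auto
      ultimately have "u \<in> ball x (d/2)" "v \<in> ball x (d/2)" by blast+
      then have "v - u < d" unfolding mem_ball dist_real_def by linarith
      then show "norm ((g (Sup J) - g (Inf J)) *\<^sub>C f (g x) - (q (Sup J) - q (Inf J))) \<le> e' * (V (Sup J) - V (Inf J))"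
        using d(2) J by simp
    qed
    also have "\<dots> = e' * (V b - V a)"
      unfolding additive_tagged_division_1[OF ab p(1), symmetric] by (simp add: sum_distrib_left case_prod_beta)
    also have "\<dots> < e' * (V b - V a + 1)" using e' by simp
    also have "\<dots> = e" using V0 by (simp add: e'_def)
    finally show ?thesis .
  qed
  then show "\<exists>d>0. \<forall>p. p tagged_division_of {a..b} \<longrightarrow> (\<lambda>x. ball x d) fine p \<longrightarrow> norm (rs_sum f g p - (q b - q a)) < e"
    using half_gt_zero[OF d(1)] by blast
qed

section \<open>Improper integrals along an unbounded contour\<close>

definition has_contour_int ::
    "(real \<Rightarrow> complex) \<Rightarrow> (complex \<Rightarrow> 'v::complex_normed_vector) \<Rightarrow> 'v \<Rightarrow> bool" where
  "has_contour_int g f I \<longleftrightarrow> (\<exists>C. (\<forall>a b. 0 < a \<and> a \<le> b \<longrightarrow> has_curve_integral f (C a b) g a b) \<and>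
     ((\<lambda>(a, b). C a b) \<longlongrightarrow> I) (at_right 0 \<times>\<^sub>F at_top))"

lemma ends_filter_nontrivial: "at_right (0::real) \<times>\<^sub>F (at_top :: real filter) \<noteq> bot"
  by (simp add: prod_filter_eq_bot)

lemma eventually_ends:
  assumes "0 < a" 
  shows "eventually (\<lambda>(a', b'). 0 < a' \<and> a' < a \<and> b < b') (at_right (0::real) \<times>\<^sub>F (at_top :: real filter))"
proof -
  have "eventually (\<lambda>a'. 0 < a' \<and> a' < a) (at_right 0)"
    using eventually_at_right_real[OF assms] by simp
  from eventually_prodI[OF this eventually_gt_at_top[of b]] show ?thesis
    by (auto elim!: eventually_mono)
qed

text \<open>\<open>curve_integral\<close> and \<open>contour_int\<close> are given by descriptions
  and say nothing until existence is known. \<open>has_contour_int\<close> therefore carries the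
  integrals over all compact pieces together with their limit, and the value is read off only
  here.\<close>

lemma contour_int_eq:
  assumes "has_contour_int g f I"
  shows "contour_int g f = I"
proof -
  obtain C where C: "\<And>a b. 0 < a \<Longrightarrow> a \<le> b \<Longrightarrow> has_curve_integral f (C a b) g a b"
    "((\<lambda>(a, b). C a b) \<longlongrightarrow> I) (at_right 0 \<times>\<^sub>F at_top)"
    using assms unfolding has_contour_int_def by blast
  have "eventually (\<lambda>p. (\<lambda>(a, b). C a b) p = (\<lambda>(a, b). curve_integral f g a b) p) (at_right 0 \<times>\<^sub>F at_top)"
    using eventually_ends[OF zero_less_one, of 1]
    by eventually_elim (auto simp: curve_integral_eq[OF C(1)])
  from Lim_transform_eventually[OF C(2) this] show ?thesis
    unfolding contour_int_def by (rule tendsto_Lim[OF ends_filter_nontrivial])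
qed

lemma has_contour_int_unique: "has_contour_int g f I \<Longrightarrow> has_contour_int g f J \<Longrightarrow> I = J"
  using contour_int_eq by blast

lemma has_contour_int_semilinear:
  assumes I: "has_contour_int g f I" and L: "bounded_linear L" "\<And>c x. L (c *\<^sub>C x) = \<sigma> c *\<^sub>C L x"
    and \<sigma>: "\<And>w z. \<sigma> (w - z) = \<sigma> w - \<sigma> z" "\<And>z. \<sigma>' (\<sigma> z) = z"
  shows "has_contour_int (\<lambda>t. \<sigma> (g t)) (\<lambda>z. L (f (\<sigma>' z))) (L I)"
proof -
  obtain C where C: "\<And>a b. 0 < a \<Longrightarrow> a \<le> b \<Longrightarrow> has_curve_integral f (C a b) g a b"
    "((\<lambda>p. C (fst p) (snd p)) \<longlongrightarrow> I) (at_right 0 \<times>\<^sub>F at_top)"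
    using I unfolding has_contour_int_def case_prod_beta by blast
  show ?thesis
    unfolding has_contour_int_def case_prod_beta
    using has_curve_integral_semilinear[OF C(1) L \<sigma>] bounded_linear.tendsto[OF L(1) C(2)]
    by (intro exI[of _ "\<lambda>a b. L (C a b)"]) blast
qed

lemma has_contour_int_linear:
  assumes "has_contour_int g f I" "bounded_linear L" "\<And>c x. L (c *\<^sub>C x) = c *\<^sub>C L x"
  shows "has_contour_int g (\<lambda>z. L (f z)) (L I)"
  using has_contour_int_semilinear[of g f I L "\<lambda>z. z" "\<lambda>z. z"] assms by simp

lemma has_contour_int_conj_linear:
  assumes "has_contour_int g f I" "bounded_linear L" "\<And>c x. L (c *\<^sub>C x) = cnj c *\<^sub>C L x"
  shows "has_contour_int (conj_contour g) (\<lambda>z. L (f (cnj z))) (L I)"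
  using has_contour_int_semilinear[of g f I L cnj cnj] assms by (simp add: conj_contour_def)

lemma has_contour_int_scaleC: "has_contour_int g f I \<Longrightarrow> has_contour_int g (\<lambda>z. c *\<^sub>C f z) (c *\<^sub>C I)"
  by (rule has_contour_int_linear[where L = "\<lambda>x. c *\<^sub>C x"])
    (auto simp: bounded_linear_scaleC_right scaleC_scaleC mult.commute)

lemma has_contour_int_add:
  assumes "has_contour_int g f I" "has_contour_int g f' I'"
  shows "has_contour_int g (\<lambda>z. f z + f' z) (I + I')"
proof -
  obtain C where C: "\<And>a b. 0 < a \<Longrightarrow> a \<le> b \<Longrightarrow> has_curve_integral f (C a b) g a b"
    "((\<lambda>p. C (fst p) (snd p)) \<longlongrightarrow> I) (at_right 0 \<times>\<^sub>F at_top)"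
    using assms(1) unfolding has_contour_int_def case_prod_beta by blast
  obtain C' where C': "\<And>a b. 0 < a \<Longrightarrow> a \<le> b \<Longrightarrow> has_curve_integral f' (C' a b) g a b"
    "((\<lambda>p. C' (fst p) (snd p)) \<longlongrightarrow> I') (at_right 0 \<times>\<^sub>F at_top)"
    using assms(2) unfolding has_contour_int_def case_prod_beta by blast
  show ?thesis
    unfolding has_contour_int_def case_prod_beta
    using has_curve_integral_add[OF C(1) C'(1)] tendsto_add[OF C(2) C'(2)]
    by (intro exI[of _ "\<lambda>a b. C a b + C' a b"]) blast
qed

lemma has_contour_int_diff:
  assumes "has_contour_int g f I" "has_contour_int g f' I'"
  shows "has_contour_int g (\<lambda>z. f z - f' z) (I - I')"
  using has_contour_int_add[OF assms(1) has_contour_int_scaleC[OF assms(2), of "-1"]] by simp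

lemma has_contour_int_cong:
  assumes "has_contour_int g f I" "\<And>t. t > 0 \<Longrightarrow> f (g t) = h (g t)"
  shows "has_contour_int g h I"
proof -
  obtain C where C: "\<And>a b. 0 < a \<Longrightarrow> a \<le> b \<Longrightarrow> has_curve_integral f (C a b) g a b"
    "((\<lambda>(a, b). C a b) \<longlongrightarrow> I) (at_right 0 \<times>\<^sub>F at_top)"
    using assms(1) unfolding has_contour_int_def by blast
  have "has_curve_integral h (C a b) g a b" if "0 < a" "a \<le> b" for a b
    by (rule has_curve_integral_cong[OF C(1)[OF that]]) (use that assms(2) in auto)
  then show ?thesis unfolding has_contour_int_def using C(2) by blast
qed

text \<open>Monotone convergence along intervals that exhaust the open half-line; the end point 0,
  where the weight may be singular, is a null set.\<close>

lemma exhaustion_integral: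
  fixes \<phi> :: "real \<Rightarrow> real"
  assumes int: "\<phi> integrable_on {0..}" and nn: "\<And>t. t > 0 \<Longrightarrow> 0 \<le> \<phi> t"
  shows "(\<lambda>n. integral {1 / real (Suc n)..real (Suc n)} \<phi>) \<longlonglongrightarrow> integral {0..} \<phi>"
proof -
  let ?J = "\<lambda>n. {1 / real (Suc n)..real (Suc n)}"
  define F where "F n x = (if x \<in> ?J n then \<phi> x else 0)" for n and x :: real
  have neg: "negligible {x \<in> {0..} - {0<..}. \<phi> x \<noteq> 0}" "negligible {x \<in> {0<..} - {0..}. \<phi> x \<noteq> 0}"
    by (rule negligible_subset[of "{0}"]; auto)+
  have int0: "\<phi> integrable_on {0<..}"
    using neg integrable_spike_set[OF int] by blast
  have sub: "?J n \<subseteq> {0<..}" for n by (auto simp: field_simps intro: less_le_trans[of 0 "1 / (1 + real n)"])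
  have intJ: "\<phi> integrable_on ?J n" for n
    by (rule integrable_on_subinterval[OF int]) (auto intro: order_trans[of 0 "1 / (1 + real n)"])
  have eq: "integral {0<..} (F n) = integral (?J n) \<phi>" for n
    unfolding F_def integral_restrict_Int using sub[of n] by (simp add: Int_absorb2)
  have bd: "integral (?J n) \<phi> \<le> integral {0<..} \<phi>" for n
    by (rule integral_subset_le) (use sub intJ int0 nn in auto)
  have "(\<lambda>n. integral {0<..} (F n)) \<longlonglongrightarrow> integral {0<..} \<phi>"
  proof (rule conjunct2[OF monotone_convergence_increasing])
    show "F n integrable_on {0<..}" for n
      unfolding F_def integrable_restrict_Int using sub[of n] intJ[of n] by (simp add: Int_absorb2)
    show "F n x \<le> F (Suc n) x" if "x \<in> {0<..}" for n x
    proof -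
      have "1 / real (Suc (Suc n)) \<le> 1 / real (Suc n)" by (simp add: field_simps)
      then show ?thesis using nn[of x] that by (auto simp: F_def)
    qed
    show "(\<lambda>n. F n x) \<longlonglongrightarrow> \<phi> x" if "x \<in> {0<..}" for x
    proof (rule tendsto_eventually)
      have x: "x > 0" using that by simp
      obtain m where m: "1 / x < real m" "x < real m"
        using reals_Archimedean2[of "max (1 / x) x"] by auto
      show "\<forall>\<^sub>F n in sequentially. F n x = \<phi> x"
        unfolding eventually_sequentially
      proof (intro exI[of _ m] allI impI)
        fix n assume "m \<le> n"
        then have "real m \<le> real (Suc n)" by simp
        then have "1 / x \<le> real (Suc n)" "x \<le> real (Suc n)" using m by linarith+
        then show "F n x = \<phi> x" using x by (simp add: F_def field_simps)
      qed
    qed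
    have "0 \<le> integral (?J n) \<phi>" for n
      by (rule integral_nonneg[OF intJ]) (use sub[of n] nn in auto)
    then show "bounded (range (\<lambda>n. integral {0<..} (F n)))"
      unfolding eq bounded_iff using bd by (intro exI[of _ "integral {0<..} \<phi>"]) auto
  qed
  moreover have "integral {0<..} \<phi> = integral {0..} \<phi>"
    by (rule integral_spike_set[OF neg(2,1)])
  ultimately show ?thesis by (simp add: eq)
qed

text \<open>Enlarging a compact piece changes its integral by at most the growth of the integral of
  \<phi> (\<open>C_diff\<close>), and that growth is bounded by the total. So the pieces along one
  exhausting sequence are Cauchy, and \<open>I_diff\<close> turns this into a limit in both end
  points independently.\<close>

lemma has_contour_int_exists:
  fixes f :: "complex \<Rightarrow> 'v::{complex_normed_vector, banach}"
  assumes vb: "\<And>b. var_bound (\<lambda>t. t) g 0 b" and cont: "continuous_on {0<..} (\<lambda>t. f (g t))"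
    and int: "\<phi> integrable_on {0..}" and le: "\<And>t. t > 0 \<Longrightarrow> norm (f (g t)) \<le> \<phi> t"
    and nn: "\<And>t. t \<ge> 0 \<Longrightarrow> 0 \<le> \<phi> t"
  shows "\<exists>I. has_contour_int g f I \<and> norm I \<le> integral {0..} \<phi>"
proof -
  define N where "N = integral {0..} \<phi>"
  define \<Phi> where "\<Phi> a b = integral {a..b} \<phi>" for a b
  define C where "C a b = curve_integral f g a b" for a b
  have C: "has_curve_integral f (C a b) g a b" if "0 < a" "a \<le> b" for a b
  proof -
    have "\<exists>I. has_curve_integral f I g a b"
      by (rule has_curve_integral_exists[OF that(2) var_bound_subset[OF vb[of b]] continuous_on_subset[OF cont]])
        (use that in auto)
    then show ?thesis unfolding C_def using curve_integral_eq by force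
  qed
  have intab: "\<phi> integrable_on {a..b}" if "0 < a" for a b
    by (rule integrable_on_subinterval[OF int]) (use that in auto)
  have C_le: "norm (C a b) \<le> \<Phi> a b" if "0 < a" "a \<le> b" for a b
    unfolding \<Phi>_def
    by (rule has_curve_integral_norm_le_integral[OF C[OF that] var_bound_subset[OF vb[of b]]
          integrable_integral[OF intab[OF that(1)]]])
      (use that le in auto)
  have C_diff: "norm (C a b - C a' b') \<le> \<Phi> a b - \<Phi> a' b'" if "0 < a" "a \<le> a'" "a' \<le> b'" "b' \<le> b" for a b a' b'
  proof -
    have "C a b = C a a' + C a' b"
      by (rule has_curve_integral_combine[OF C C C]) (use that in auto)
    moreover have "C a' b = C a' b' + C b' b"
      by (rule has_curve_integral_combine[OF C C C]) (use that in auto)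
    moreover have "\<Phi> a a' + \<Phi> a' b = \<Phi> a b"
      unfolding \<Phi>_def by (rule Henstock_Kurzweil_Integration.integral_combine) (use that intab in auto)
    moreover have "\<Phi> a' b' + \<Phi> b' b = \<Phi> a' b"
      unfolding \<Phi>_def by (rule Henstock_Kurzweil_Integration.integral_combine) (use that intab in auto)
    moreover have "norm (C a a' + C b' b) \<le> \<Phi> a a' + \<Phi> b' b"
      by (rule norm_triangle_le) (use that in \<open>auto intro!: add_mono C_le\<close>)
    ultimately show ?thesis by (simp add: algebra_simps)
  qed
  have \<Phi>_le: "\<Phi> a b \<le> N" if "0 < a" for a b
    unfolding \<Phi>_def N_def using that
    by (intro integral_subset_le intab int) (auto intro: nn)
  define s where "s n = 1 / real (Suc n)" for n
  have s: "0 < s n" "s n \<le> real (Suc n)" "s (Suc n) \<le> s n" for n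
    by (auto simp: s_def field_simps)
  have s_mono: "s n \<le> s m" if "m \<le> n" for m n
    using that by (simp add: s_def field_simps)
  have lim: "(\<lambda>n. \<Phi> (s n) (real (Suc n))) \<longlonglongrightarrow> N"
    unfolding \<Phi>_def N_def s_def by (rule exhaustion_integral[OF int]) (simp add: nn)
  have "Cauchy (\<lambda>n. C (s n) (real (Suc n)))"
  proof (rule CauchyI')
    fix e :: real assume "e > 0"
    then obtain M where M: "\<And>n. n \<ge> M \<Longrightarrow> \<bar>\<Phi> (s n) (real (Suc n)) - N\<bar> < e"
      using lim unfolding LIMSEQ_def dist_real_def by blast
    have "norm (C (s m) (real (Suc m)) - C (s n) (real (Suc n))) < e" if mn: "m \<ge> M" "n > m" for m n
    proof -
      have "norm (C (s n) (real (Suc n)) - C (s m) (real (Suc m))) \<le> \<Phi> (s n) (real (Suc n)) - \<Phi> (s m) (real (Suc m))"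
        by (rule C_diff) (use s s_mono[of m n] mn in auto)
      also have "\<dots> < e" using M[of m] \<Phi>_le[OF s(1), of n "real (Suc n)"] mn by linarith
      finally show ?thesis by (simp add: norm_minus_commute)
    qed
    then show "\<exists>M. \<forall>m\<ge>M. \<forall>n>m. dist (C (s m) (real (Suc m))) (C (s n) (real (Suc n))) < e"
      unfolding dist_norm by blast
  qed
  then obtain I where I: "(\<lambda>n. C (s n) (real (Suc n))) \<longlonglongrightarrow> I"
    using Cauchy_convergent convergent_def by blast
  have I_diff: "norm (I - C a b) \<le> N - \<Phi> a b" if ab: "0 < a" "a \<le> b" for a b
  proof -
    have "(\<lambda>n. norm (C (s n) (real (Suc n)) - C a b)) \<longlonglongrightarrow> norm (I - C a b)"
      by (intro tendsto_intros I)
    moreover obtain m where m: "1 / a < real m" "b < real m"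
      using reals_Archimedean2[of "max (1 / a) b"] by auto
    have "norm (C (s n) (real (Suc n)) - C a b) \<le> N - \<Phi> a b" if "n \<ge> m" for n
    proof -
      have "real m \<le> real (Suc n)" using that by simp
      then have *: "1 / a \<le> real (Suc n)" "b \<le> real (Suc n)" using m by linarith+
      then have "s n \<le> a" using ab by (simp add: s_def field_simps)
      then have "norm (C (s n) (real (Suc n)) - C a b) \<le> \<Phi> (s n) (real (Suc n)) - \<Phi> a b"
        using ab * s by (intro C_diff) auto
      then show ?thesis using \<Phi>_le[OF s(1), of n "real (Suc n)"] by linarith
    qed
    ultimately show ?thesis by (intro Lim_bounded) auto
  qed
  have "((\<lambda>(a, b). C a b) \<longlongrightarrow> I) (at_right 0 \<times>\<^sub>F at_top)"
  proof (rule tendstoI)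
    fix e :: real assume "e > 0"
    then obtain n where n: "\<bar>\<Phi> (s n) (real (Suc n)) - N\<bar> < e"
      using lim unfolding LIMSEQ_def dist_real_def by blast
    show "eventually (\<lambda>p. dist (case p of (a, b) \<Rightarrow> C a b) I < e) (at_right 0 \<times>\<^sub>F at_top)"
      using eventually_ends[OF s(1)[of n], of "real (Suc n)"]
    proof (eventually_elim, clarsimp)
      fix a b assume ab: "0 < a" "a < s n" "1 + real n < b"
      have "0 \<le> norm (C a b - C (s n) (real (Suc n)))" by simp
      also have "\<dots> \<le> \<Phi> a b - \<Phi> (s n) (real (Suc n))"
        by (rule C_diff) (use ab s[of n] in auto)
      finally have "\<Phi> (s n) (real (Suc n)) \<le> \<Phi> a b" by simp
      moreover have "norm (I - C a b) \<le> N - \<Phi> a b"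
        by (rule I_diff) (use ab s(2)[of n] in auto)
      ultimately show "dist (C a b) I < e" using n by (simp add: dist_norm norm_minus_commute)
    qed
  qed
  moreover have "norm I \<le> N"
  proof (rule Lim_bounded)
    show "(\<lambda>n. norm (C (s n) (real (Suc n)))) \<longlonglongrightarrow> norm I" by (intro tendsto_intros I)
    show "\<forall>n\<ge>0. norm (C (s n) (real (Suc n))) \<le> N"
      using C_le[OF s(1,2)] \<Phi>_le[OF s(1)] order_trans by blast
  qed
  ultimately show ?thesis unfolding has_contour_int_def N_def using C by blast
qed

section \<open>Holomorphic functions along rectifiable paths\<close>

text \<open>On a short arc around \<open>x = c s\<close> the mean value inequality is applied to
  \<open>F w - f x * w\<close>, whose derivative is small there. Only increments of the path occur,
  so rectifiability is enough.\<close>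

lemma has_curve_integral_primitive:
  assumes S: "open S" "\<And>z. z \<in> S \<Longrightarrow> (F has_field_derivative f z) (at z)"
    and c: "continuous_on {a..b} c" "c ` {a..b} \<subseteq> S" and vb: "var_bound V c a b" and ab: "a \<le> b"
  shows "has_curve_integral f (F (c b) - F (c a)) c a b"
proof (rule has_curve_integral_local_primitive[OF ab vb, where q = "\<lambda>t. F (c t)"])
  fix e :: real assume e: "e > 0"
  have "F holomorphic_on S" unfolding holomorphic_on_def field_differentiable_def
    using S(2) has_field_derivative_at_within by blast
  then have "deriv F holomorphic_on S" by (rule holomorphic_deriv[OF _ S(1)])
  then have "f holomorphic_on S" by (rule holomorphic_transform) (auto intro: DERIV_imp_deriv S(2))
  then have contf: "continuous_on S f" by (rule holomorphic_on_imp_continuous_on)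
  define K where "K = c ` {a..b}"
  have K: "compact K" unfolding K_def by (rule compact_continuous_image[OF c(1)]) simp
  obtain r where r: "r > 0" "(\<Union>x\<in>K. ball x r) \<subseteq> S"
    using compact_subset_open_imp_ball_epsilon_subset[OF K S(1)] c(2) unfolding K_def by blast
  \<comment> \<open>The mean value inequality leaves the curve, so uniform continuity of
    \<open>f\<close> is needed on a compact neighbourhood of its image.\<close>
  define K' where "K' = {x + y |x y. x \<in> K \<and> y \<in> cball 0 (r / 2)}"
  have K': "compact K'" unfolding K'_def by (rule compact_sums[OF K]) simp
  have in_K': "w \<in> K'" if "x \<in> K" "dist x w \<le> r / 2" for x w
    unfolding K'_def mem_Collect_eq
    by (rule exI[of _ x], rule exI[of _ "w - x"]) (use that in \<open>auto simp: dist_norm norm_minus_commute\<close>)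
  have "K' \<subseteq> S"
  proof
    fix w assume "w \<in> K'"
    then obtain x y where "x \<in> K" "norm y \<le> r / 2" "w = x + y" unfolding K'_def by auto
    then have "w \<in> ball x r" using r(1) by (simp add: dist_norm)
    then show "w \<in> S" using r(2) \<open>x \<in> K\<close> by blast
  qed
  then have "uniformly_continuous_on K' f"
    using compact_uniformly_continuous[OF continuous_on_subset[OF contf] K'] by blast
  then obtain d1 where d1: "d1 > 0" "\<And>x w. x \<in> K' \<Longrightarrow> w \<in> K' \<Longrightarrow> dist w x < d1 \<Longrightarrow> dist (f w) (f x) < e"
    unfolding uniformly_continuous_on_def using e by meson
  define \<eta> where "\<eta> = min d1 (r / 2)"
  have \<eta>: "\<eta> > 0" using d1(1) r(1) by (simp add: \<eta>_def)
  have "uniformly_continuous_on {a..b} c"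
    by (rule compact_uniformly_continuous[OF c(1)]) simp
  then obtain d where d: "d > 0" "\<And>s t. s \<in> {a..b} \<Longrightarrow> t \<in> {a..b} \<Longrightarrow> dist t s < d \<Longrightarrow> dist (c t) (c s) < \<eta>"
    unfolding uniformly_continuous_on_def using \<eta> by meson
  have "norm ((c v - c u) *\<^sub>C f (c s) - (F (c v) - F (c u))) \<le> e * (V v - V u)"
    if uv: "a \<le> u" "u \<le> s" "s \<le> v" "v \<le> b" "v - u < d" for u s v
  proof -
    define x where "x = c s"
    have x: "x \<in> K" using uv by (auto simp: x_def K_def)
    have cu: "c u \<in> ball x \<eta>" "c v \<in> ball x \<eta>"
      using d(2)[of s u] d(2)[of s v] uv unfolding x_def mem_ball dist_commute[of "c s"]
      by (simp_all add: dist_real_def)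
    have "\<eta> \<le> r" using r(1) by (simp add: \<eta>_def)
    then have bS: "ball x \<eta> \<subseteq> S" using r(2) x subset_ball[of \<eta> r x] by blast
    have "norm ((F (c v) - f x * c v) - (F (c u) - f x * c u)) \<le> e * norm (c v - c u)"
    proof (rule field_differentiable_bound[of "ball x \<eta>" _ "\<lambda>w. f w - f x"])
      show "((\<lambda>w. F w - f x * w) has_field_derivative f w - f x) (at w within ball x \<eta>)" if "w \<in> ball x \<eta>" for w
      proof -
        have "w \<in> S" using bS that by blast
        from has_field_derivative_at_within[OF S(2)[OF this]] show ?thesis
          by (auto intro!: derivative_eq_intros)
      qed
      show "norm (f w - f x) \<le> e" if "w \<in> ball x \<eta>" for w
      proof -
        have w: "dist x w < d1" "dist x w \<le> r / 2" using that by (auto simp: \<eta>_def)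
        have "x \<in> K'" by (rule in_K'[OF x]) (use r(1) in simp)
        then have "dist (f w) (f x) < e" by (rule d1(2)[OF _ in_K'[OF x w(2)]]) (use w(1) in \<open>simp add: dist_commute\<close>)
        then show ?thesis by (simp add: dist_norm)
      qed
    qed (use cu in auto)
    also have "\<dots> \<le> e * (V v - V u)"
      using e uv by (intro mult_left_mono var_boundD[OF vb]) auto
    finally show ?thesis
      by (simp add: x_def scaleC_complex_def algebra_simps norm_minus_commute)
  qed
  then show "\<exists>d>0. \<forall>u s v. a \<le> u \<and> u \<le> s \<and> s \<le> v \<and> v \<le> b \<and> v - u < d \<longrightarrow>
        norm ((c v - c u) *\<^sub>C f (c s) - (F (c v) - F (c u))) \<le> e * (V v - V u)"
    using d(1) by blast
qed

text \<open>The mean value inequality for \<open>exp z - z\<close>, whose derivative vanishes at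
  0.\<close>

lemma exp_diff_approx:
  assumes "0 < (e::real)"
  obtains d where "0 < d" "\<And>z w. cmod z < d \<Longrightarrow> cmod w < d \<Longrightarrow>
      cmod ((exp z - exp w) - (z - w)) \<le> e * cmod (z - w)"
proof -
  have "isCont (\<lambda>z::complex. exp z - 1) 0" by (intro continuous_intros)
  then obtain d where d: "d > 0" "\<And>z::complex. dist z 0 < d \<Longrightarrow> dist (exp z - 1) (exp 0 - 1) < e"
    using assms unfolding continuous_at_eps_delta by blast
  have "cmod ((exp z - z) - (exp w - w)) \<le> e * cmod (z - w)" if "cmod z < d" "cmod w < d" for z w
  proof (rule field_differentiable_bound[of "ball 0 d" _ "\<lambda>z. exp z - 1"])
    show "((\<lambda>z. exp z - z) has_field_derivative exp u - 1) (at u within ball 0 d)" for u :: complex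
      by (auto intro!: derivative_eq_intros)
    show "cmod (exp u - 1) \<le> e" if "u \<in> ball 0 d" for u
      using d(2)[of u] that by (simp add: dist_norm)
  qed (use that in \<open>auto simp: dist_norm\<close>)
  then show ?thesis using that[OF d(1)] by (simp add: algebra_simps)
qed

text \<open>The winding number is the increment of a continuous logarithm \<open>q\<close> of
  \<open>c - \<zeta>\<close>. Since the local primitive criterion does not differentiate
  \<open>q\<close>, its continuity is enough.\<close>

lemma has_curve_integral_winding_number:
  assumes c: "path c" "\<zeta> \<notin> path_image c" and vb: "var_bound V c 0 1"
  shows "has_curve_integral (\<lambda>w. 1 / (w - \<zeta>)) (2 * of_real pi * \<i> * winding_number c \<zeta>) c 0 1"
proof -
  obtain q where q: "path q" "pathfinish q - pathstart q = 2 * of_real pi * \<i> * winding_number c \<zeta>"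
      and cq: "\<And>t. t \<in> {0..1} \<Longrightarrow> c t = \<zeta> + exp (q t)"
    using winding_number_as_continuous_log[OF c] by metis
  define m where "m = infdist \<zeta> (path_image c)"
  have m: "m > 0" unfolding m_def
    using c by (meson closed_path_image infdist_pos_not_in_closed path_image_nonempty)
  have mle: "m \<le> cmod (c t - \<zeta>)" if "t \<in> {0..1}" for t
    unfolding m_def using infdist_le[of "c t" "path_image c" \<zeta>] that
    by (auto simp: path_image_def dist_norm norm_minus_commute)
  have "has_curve_integral (\<lambda>w. 1 / (w - \<zeta>)) (q 1 - q 0) c 0 1"
  proof (rule has_curve_integral_local_primitive[OF zero_le_one vb])
    fix e :: real assume e: "e > 0"
    \<comment> \<open>The bound 1/2 lets the error be absorbed, giving |z - w| \<le> 2 |exp z - exp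
      w|; the bound \<open>e * m / 2\<close> compensates this factor 2 and the division by the
      distance \<open>m\<close> of the path from \<zeta>.\<close>
    define e' where "e' = min (1/2) (e * m / 2)"
    have e': "e' > 0" "e' \<le> 1/2" "e' \<le> e * m / 2" using e m by (auto simp: e'_def)
    obtain \<eta> where \<eta>: "\<eta> > 0" "\<And>z w. cmod z < \<eta> \<Longrightarrow> cmod w < \<eta> \<Longrightarrow>
      cmod ((exp z - exp w) - (z - w)) \<le> e' * cmod (z - w)"
      using exp_diff_approx[OF e'(1)] by blast
    have "uniformly_continuous_on {0..1} q"
      using q(1) unfolding path_def by (rule compact_uniformly_continuous) simp
    then obtain d where d: "d > 0" "\<And>s t. s \<in> {0..1} \<Longrightarrow> t \<in> {0..1} \<Longrightarrow> dist t s < d \<Longrightarrow> dist (q t) (q s) < \<eta>"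
      unfolding uniformly_continuous_on_def using \<eta>(1) by meson
    have "norm ((c v - c u) *\<^sub>C (1 / (c s - \<zeta>)) - (q v - q u)) \<le> e * (V v - V u)"
      if uv: "0 \<le> u" "u \<le> s" "s \<le> v" "v \<le> 1" "v - u < d" for u s v
    proof -
      define z where "z = q v - q s"
      define w where "w = q u - q s"
      have zw: "cmod z < \<eta>" "cmod w < \<eta>"
        using d(2)[of s v] d(2)[of s u] uv by (auto simp: z_def w_def dist_norm)
      have I: "u \<in> {0..1}" "s \<in> {0..1}" "v \<in> {0..1}" using uv by auto
      have quot: "(c v - c u) / (c s - \<zeta>) = exp z - exp w"
        using I by (simp add: cq z_def w_def exp_diff diff_divide_distrib)
      have zwq: "z - w = q v - q u" by (simp add: z_def w_def)
      have le: "cmod ((exp z - exp w) - (z - w)) \<le> e' * cmod (z - w)" by (rule \<eta>(2)[OF zw])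
      also have "\<dots> \<le> 1/2 * cmod (z - w)" by (rule mult_right_mono[OF e'(2)]) simp
      finally have "cmod (z - w) \<le> 2 * cmod (exp z - exp w)"
        using norm_triangle_ineq4[of "exp z - exp w" "(exp z - exp w) - (z - w)"] by simp
      also have "cmod (exp z - exp w) \<le> (V v - V u) / m"
        unfolding quot[symmetric] norm_divide
        using uv m mle[OF I(2)] order_trans[OF norm_ge_zero var_boundD[OF vb, of u v]]
        by (intro frac_le var_boundD[OF vb]) auto
      finally have "e' * cmod (z - w) \<le> (e * m / 2) * (2 * ((V v - V u) / m))"
        using e' m e by (intro mult_mono) auto
      also have "\<dots> = e * (V v - V u)" using m by simp
      finally show ?thesis using le by (simp add: scaleC_complex_def quot zwq)
    qed
    then show "\<exists>d>0. \<forall>u s v. 0 \<le> u \<and> u \<le> s \<and> s \<le> v \<and> v \<le> 1 \<and> v - u < d \<longrightarrow>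
        norm ((c v - c u) *\<^sub>C (1 / (c s - \<zeta>)) - (q v - q u)) \<le> e * (V v - V u)"
      using d(1) by blast
  qed
  then show ?thesis using q(2) by (simp add: pathfinish_def pathstart_def)
qed

lemma curve_length_add_dist:
  assumes "a \<le> u" "u \<le> v"
  shows "curve_length g a u + ennreal (dist (g u) (g v)) \<le> curve_length g a v"
proof -
  let ?A = "\<lambda>u. {ts. sorted ts \<and> set ts \<subseteq> {a..u}}"
  let ?S = "\<lambda>ts. \<Sum>i<length ts - 1. dist (g (ts ! i)) (g (ts ! Suc i))"
  have ne: "?A u \<noteq> {}" by (auto intro: exI[of _ "[]"])
  have "curve_length g a u + ennreal (dist (g u) (g v)) = (SUP ts\<in>?A u. ennreal (?S ts) + ennreal (dist (g u) (g v)))"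
    unfolding curve_length_def by (rule ennreal_SUP_add_left[OF ne, symmetric])
  also have "\<dots> \<le> curve_length g a v"
    unfolding curve_length_def
  proof (rule SUP_mono)
    fix ts assume ts: "ts \<in> ?A u"
    define n where "n = length ts"
    \<comment> \<open>In the polygon through \<open>ts @ [u, v]\<close> the edge with index
      \<open>n\<close> runs from \<open>u\<close> to \<open>v\<close>; the edge
      \<open>n - 1\<close>, from the last point of \<open>ts\<close> to \<open>u\<close>, is simply
      dropped.\<close>
    have "?S ts + dist (g u) (g v) = (\<Sum>i\<in>insert n {..<n - 1}. dist (g ((ts @ [u, v]) ! i)) (g ((ts @ [u, v]) ! Suc i)))"
      by (subst sum.insert) (auto simp: n_def nth_append add.commute intro!: sum.cong)
    also have "\<dots> \<le> ?S (ts @ [u, v])"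
      by (rule sum_mono2) (auto simp: n_def)
    finally have le: "?S ts + dist (g u) (g v) \<le> ?S (ts @ [u, v])" .
    have "ennreal (?S ts) + ennreal (dist (g u) (g v)) \<le> ennreal (?S (ts @ [u, v]))"
      by (rule order_trans[OF eq_refl[OF ennreal_plus[symmetric]] ennreal_leI[OF le]])
        (simp_all add: sum_nonneg)
    moreover have "ts @ [u, v] \<in> ?A v"
      using ts assms by (auto simp: sorted_append)
    ultimately show "\<exists>ts'\<in>?A v. ennreal (?S ts) + ennreal (dist (g u) (g v)) \<le> ennreal (?S ts')" by blast
  qed
  finally show ?thesis .
qed

lemma rectifiable_var_bound:
  assumes "curve_length c 0 1 < \<infinity>"
  obtains V where "var_bound V c 0 1"
proof -
  have mono: "curve_length c 0 u \<le> curve_length c 0 v" if "0 \<le> u" "u \<le> v" for u v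
    using curve_length_add_dist[OF that, of c] by (meson add_increasing2 order_trans zero_le order_refl)
  have "var_bound (\<lambda>t. enn2real (curve_length c 0 t)) c 0 1"
    unfolding var_bound_def
  proof (intro allI impI, elim conjE)
    fix u v :: real assume uv: "0 \<le> u" "u \<le> v" "v \<le> 1"
    have fin: "curve_length c 0 v < top" "curve_length c 0 u < top"
      using mono[of v 1] mono[of u 1] assms uv by (auto simp: le_less_trans)
    obtain x y where xy: "curve_length c 0 u = ennreal x" "curve_length c 0 v = ennreal y" "0 \<le> x" "0 \<le> y"
      using fin by (metis ennreal_enn2real enn2real_nonneg less_top_ennreal order.strict_implies_not_eq)
    have "ennreal x + ennreal (dist (c u) (c v)) \<le> ennreal y"
      using curve_length_add_dist[OF uv(1,2), of c] xy by simp
    then have "x + dist (c u) (c v) \<le> y"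
      using xy by (simp add: ennreal_plus[symmetric] del: ennreal_plus)
    then show "cmod (c v - c u) \<le> enn2real (curve_length c 0 v) - enn2real (curve_length c 0 u)"
      using xy by (simp add: dist_norm norm_minus_commute)
  qed
  then show ?thesis by (rule that)
qed

lemma curve_length_ge_dist: "s \<le> t \<Longrightarrow> ennreal (dist (g s) (g t)) \<le> curve_length g s t"
  using curve_length_add_dist[of s s t g] by (meson add_increasing order_refl order_trans zero_le)

text \<open>Replaces differentiation under the integral sign: for Cauchy kernels the remainder of
  first order is explicit, and integrating it gives a quadratic bound.\<close>

lemma quadratic_remainder_imp_derivative:
  fixes F :: "complex \<Rightarrow> 'v::complex_normed_vector"
  assumes d: "d > 0" and le: "\<And>w. cmod (w - z) < d \<Longrightarrow> norm (F w - F z - (w - z) *\<^sub>C L) \<le> K * (cmod (w - z))\<^sup>2"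
  shows "((\<lambda>w. inverse (w - z) *\<^sub>C (F w - F z)) \<longlongrightarrow> L) (at z)"
proof (subst Lim_null, rule Lim_null_comparison)
  show "((\<lambda>w. K * cmod (w - z)) \<longlongrightarrow> 0) (at z)"
    by (auto intro!: tendsto_eq_intros)
  show "\<forall>\<^sub>F w in at z. norm (inverse (w - z) *\<^sub>C (F w - F z) - L) \<le> K * cmod (w - z)"
    unfolding eventually_at
  proof (intro exI[of _ d] conjI d ballI impI)
    fix w assume "w \<noteq> z \<and> dist w z < d"
    then have w: "cmod (w - z) < d" "w - z \<noteq> 0" by (auto simp: dist_norm)
    have "inverse (w - z) *\<^sub>C (F w - F z) - L = inverse (w - z) *\<^sub>C (F w - F z - (w - z) *\<^sub>C L)"
      using w by (simp add: scaleC.diff_right scaleC_scaleC)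
    also have "norm \<dots> \<le> inverse (cmod (w - z)) * (K * (cmod (w - z))\<^sup>2)"
      unfolding norm_scaleC norm_inverse by (intro mult_left_mono le w) simp
    also have "\<dots> = K * cmod (w - z)" using w by (simp add: power2_eq_square)
    finally show "norm (inverse (w - z) *\<^sub>C (F w - F z) - L) \<le> K * cmod (w - z)" .
  qed
qed

lemma cauchy_kernel_remainder:
  fixes z z' w :: complex
  assumes "w \<noteq> z" "w \<noteq> z'"
  shows "1 / (w - z') - 1 / (w - z) - (z' - z) * (1 / (w - z)\<^sup>2) = (z' - z)\<^sup>2 / ((w - z') * (w - z)\<^sup>2)"
proof -
  have "w - z \<noteq> 0" "w - z' \<noteq> 0" using assms by auto
  then show ?thesis by (simp add: divide_simps power2_eq_square) (simp add: algebra_simps)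
qed

text \<open>The exact remainder of the Cauchy kernel is integrated against \<open>u\<close>. On the
  disc of half the distance \<delta> to the path its denominators stay above \<delta>/2 and
  \<delta>^2.\<close>

lemma loop_cauchy_transform_differentiable:
  fixes u :: "complex \<Rightarrow> complex"
  assumes c: "path c" and vb: "var_bound V c 0 1" and u: "continuous_on (path_image c) u"
    and z: "z \<notin> path_image c"
  shows "(\<lambda>z. curve_integral (\<lambda>w. u w / (w - z)) c 0 1) field_differentiable (at z)"
proof -
  define \<delta> where "\<delta> = infdist z (path_image c)"
  have \<delta>: "\<delta> > 0" unfolding \<delta>_def
    using c z by (meson closed_path_image infdist_pos_not_in_closed path_image_nonempty)
  have far: "\<delta> \<le> cmod (c t - z)" if "t \<in> {0..1}" for t
    unfolding \<delta>_def using infdist_le[of "c t" "path_image c" z] that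
    by (auto simp: path_image_def dist_norm norm_minus_commute)
  have far': "\<delta> / 2 \<le> cmod (c t - z')" if "t \<in> {0..1}" "cmod (z' - z) < \<delta> / 2" for t z'
    using far[OF that(1)] that(2) norm_triangle_ineq[of "c t - z'" "z' - z"] by simp
  have cc: "continuous_on {0..1} c" using c by (simp add: path_def)
  have uc: "continuous_on {0..1} (\<lambda>t. u (c t))"
    using continuous_on_compose2[OF u cc] by (simp add: path_image_def)
  have "compact ((\<lambda>t. u (c t)) ` {0..1})" by (rule compact_continuous_image[OF uc]) simp
  then have "bounded ((\<lambda>t. u (c t)) ` {0..1})" by (rule compact_imp_bounded)
  then obtain M where "\<forall>x\<in>(\<lambda>t. u (c t)) ` {0..1}. cmod x \<le> M"
    unfolding bounded_iff by blast
  then have M: "\<And>t. t \<in> {0..1} \<Longrightarrow> cmod (u (c t)) \<le> M" by blast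
  have "cmod (u (c 0)) \<le> M" by (rule M) simp
  then have M0: "0 \<le> M" using norm_ge_zero[of "u (c 0)"] by linarith
  have ex: "has_curve_integral (\<lambda>w. u w * h w) (curve_integral (\<lambda>w. u w * h w) c 0 1) c 0 1"
    if "continuous_on {0..1} (\<lambda>t. h (c t))" for h
  proof -
    have "\<exists>I. has_curve_integral (\<lambda>w. u w * h w) I c 0 1"
      by (rule has_curve_integral_exists[OF zero_le_one vb continuous_on_mult[OF uc that]])
    then show ?thesis using curve_integral_eq by fastforce
  qed
  have c1: "continuous_on {0..1} (\<lambda>t. 1 / (c t - z'))" if "cmod (z' - z) < \<delta> / 2" for z'
    using far'[OF _ that] \<delta> by (intro continuous_intros cc) force
  have c2: "continuous_on {0..1} (\<lambda>t. 1 / (c t - z)\<^sup>2)"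
    using far \<delta> by (intro continuous_intros cc) force
  define F where "F z' = curve_integral (\<lambda>w. u w * (1 / (w - z'))) c 0 1" for z'
  define L where "L = curve_integral (\<lambda>w. u w * (1 / (w - z)\<^sup>2)) c 0 1"
  have "((\<lambda>w. inverse (w - z) *\<^sub>C (F w - F z)) \<longlongrightarrow> L) (at z)"
  proof (rule quadratic_remainder_imp_derivative)
    fix z' assume z': "cmod (z' - z) < \<delta> / 2"
    have z0: "cmod (z - z) < \<delta> / 2" using \<delta> by simp
    let ?r = "\<lambda>w. u w * (1 / (w - z')) + (-1) *\<^sub>C (u w * (1 / (w - z))) + (z - z') *\<^sub>C (u w * (1 / (w - z)\<^sup>2))"
    have "has_curve_integral ?r (F z' + (-1) *\<^sub>C F z + (z - z') *\<^sub>C L) c 0 1"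
      unfolding F_def L_def
      by (intro has_curve_integral_add has_curve_integral_scaleC ex[OF c1[OF z']] ex[OF c1[OF z0]] ex[OF c2])
    then have "norm (F z' + (-1) *\<^sub>C F z + (z - z') *\<^sub>C L)
        \<le> M * ((cmod (z' - z))\<^sup>2 / ((\<delta> / 2) * \<delta>\<^sup>2)) * (V 1 - V 0)"
    proof (rule has_curve_integral_bound[OF _ zero_le_one vb])
      fix t :: real assume t: "t \<in> {0..1}"
      have ne: "c t \<noteq> z" "c t \<noteq> z'" using far[OF t] far'[OF t z'] \<delta> by auto
      have "?r (c t) = u (c t) * (1 / (c t - z') - 1 / (c t - z) - (z' - z) * (1 / (c t - z)\<^sup>2))"
        by (simp add: scaleC_complex_def algebra_simps diff_divide_distrib)
      then have eq: "?r (c t) = u (c t) * ((z' - z)\<^sup>2 / ((c t - z') * (c t - z)\<^sup>2))"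
        unfolding cauchy_kernel_remainder[OF ne] .
      moreover have "(cmod (z' - z))\<^sup>2 / (cmod (c t - z') * (cmod (c t - z))\<^sup>2) \<le> (cmod (z' - z))\<^sup>2 / ((\<delta> / 2) * \<delta>\<^sup>2)"
        using \<delta> far[OF t] far'[OF t z'] by (intro divide_left_mono mult_mono power_mono mult_pos_pos) auto
      ultimately show "norm (?r (c t)) \<le> M * ((cmod (z' - z))\<^sup>2 / ((\<delta> / 2) * \<delta>\<^sup>2))"
        unfolding eq norm_mult norm_divide norm_power
        using M[OF t] M0 by (intro mult_mono) auto
    qed
    then show "norm (F z' - F z - (z' - z) *\<^sub>C L) \<le> M / ((\<delta> / 2) * \<delta>\<^sup>2) * (V 1 - V 0) * (cmod (z' - z))\<^sup>2"
      by (simp add: scaleC.diff_left algebra_simps)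
  qed (use \<delta> in simp)
  then have "(F has_field_derivative L) (at z)"
    unfolding has_field_derivative_iff scaleC_complex_def by (simp add: divide_inverse mult.commute)
  then show ?thesis
    unfolding F_def field_differentiable_def by auto
qed

section \<open>Neighbourhoods of real sets\<close>

lemma infdist_real_set_mono:
  assumes S: "S \<subseteq> \<real>" and le: "\<bar>y\<bar> \<le> \<bar>y'\<bar>"
  shows "infdist (Complex x y) S \<le> infdist (Complex x y') S"
proof (cases "S = {}")
  case False
  have "infdist (Complex x y) S \<le> dist (Complex x y') s" if "s \<in> S" for s
  proof -
    have s: "Im s = 0" using S that complex_is_Real_iff by blast
    have "y\<^sup>2 \<le> y'\<^sup>2" using le by (simp add: abs_le_square_iff)
    then have "dist (Complex x y) s \<le> dist (Complex x y') s"
      by (simp add: dist_norm cmod_def s)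
    then show ?thesis using infdist_le[OF that, of "Complex x y"] by linarith
  qed
  then show ?thesis unfolding infdist_notempty[OF False, of "Complex x y'"]
    using False by (intro cINF_greatest) auto
qed (simp add: infdist_def)

text \<open>A component of such a neighbourhood has no holes: from any point outside, the vertical ray
  away from the real axis stays outside.\<close>

lemma simply_connected_component_real_neighbourhood:
  fixes \<rho> :: real and S :: "complex set"
  assumes S: "S \<subseteq> \<real>"
  defines "U \<equiv> {z. infdist z S < \<rho>}"
  shows "simply_connected (connected_component_set U a)"
proof -
  define Y where "Y = connected_component_set U a"
  have "open U" unfolding U_def
    by (rule open_Collect_less) (intro continuous_intros)+
  then have oY: "open Y" unfolding Y_def by (rule open_connected_component)
  have out: "Complex x (y + s * t) \<notin> Y" if z: "Complex x y \<notin> Y" and t: "t \<ge> 0" and s: "s = (if 0 \<le> y then 1 else -1)" for x y t s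
  proof
    assume zt: "Complex x (y + s * t) \<in> Y"
    \<comment> \<open>The vertical segment from the given point to the far one. The distance to
      \<open>S\<close> is greatest at the far end, so if that end lies in \<open>U\<close> the whole
      segment does, and being connected it stays in one component.\<close>
    define T where "T = (\<lambda>\<tau>. Complex x (y + s * \<tau>)) ` {0..t}"
    have "continuous_on {0..t} (\<lambda>\<tau>. Complex x (y + s * \<tau>))"
      unfolding Complex_eq by (intro continuous_intros)
    then have cT: "connected T" unfolding T_def by (rule connected_continuous_image) simp
    have tU: "Complex x (y + s * t) \<in> U" using zt connected_component_subset unfolding Y_def by blast
    have "T \<subseteq> U"
    proof
      fix w assume "w \<in> T"
      then obtain \<tau> where \<tau>: "0 \<le> \<tau>" "\<tau> \<le> t" "w = Complex x (y + s * \<tau>)" by (auto simp: T_def)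
      have "\<bar>y + s * \<tau>\<bar> \<le> \<bar>y + s * t\<bar>" using \<tau> s by (cases "0 \<le> y") auto
      then show "w \<in> U"
        using infdist_real_set_mono[OF S, of "y + s * \<tau>" "y + s * t" x] \<tau>(3) tU by (simp add: U_def)
    qed
    moreover have "Complex x (y + s * t) \<in> T" using t by (auto simp: T_def)
    ultimately have "T \<subseteq> connected_component_set U (Complex x (y + s * t))"
      using cT by (intro connected_component_maximal)
    also have "\<dots> = Y" using zt connected_component_eq unfolding Y_def by metis
    finally have "T \<subseteq> Y" .
    moreover have "Complex x (y + s * 0) \<in> T" unfolding T_def by (rule imageI) (use t in simp)
    ultimately have "Complex x (y + s * 0) \<in> Y" by blast
    then show False using z by simp
  qed
  have "\<not> bounded C" if C: "C \<in> components (- Y)" for C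
  proof
    assume bC: "bounded C"
    obtain z where z: "z \<in> C" using in_components_nonempty[OF C] by blast
    have zY: "Complex (Re z) (Im z) \<notin> Y" using z in_components_subset[OF C] by auto
    define s :: real where "s = (if 0 \<le> Im z then 1 else -1)"
    define R where "R = (\<lambda>t. Complex (Re z) (Im z + s * t)) ` {0..}"
    have "continuous_on {0..} (\<lambda>t. Complex (Re z) (Im z + s * t))"
      unfolding Complex_eq by (intro continuous_intros)
    then have cR: "connected R" unfolding R_def by (rule connected_continuous_image) simp
    have "R \<subseteq> - Y" using out[OF zY _ s_def] by (auto simp: R_def)
    moreover have "z \<in> R" unfolding R_def by (auto intro!: image_eqI[of _ _ 0])
    ultimately have "R \<subseteq> C" using components_maximal[OF C cR] z by blast
    then have "bounded R" using bC bounded_subset by blast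
    then obtain B where B: "\<And>t. t \<ge> 0 \<Longrightarrow> cmod (Complex (Re z) (Im z + s * t)) \<le> B"
      unfolding bounded_iff R_def by auto
    have "\<bar>Im z + s * t\<bar> \<le> B" if "t \<ge> 0" for t
      using B[OF that] abs_Im_le_cmod[of "Complex (Re z) (Im z + s * t)"] by simp
    from this[of "\<bar>B\<bar> + 1"] show False by (auto simp: s_def split: if_splits)
  qed
  then show ?thesis
    unfolding Y_def[symmetric] using simply_connected_eq_unbounded_complement_components[OF oY]
    by (simp add: Y_def)
qed

text \<open>The neighbourhood may be disconnected when \<open>S\<close> has gaps, but a loop stays
  in one component; that component is simply connected, so \<open>f\<close> has a primitive
  there.\<close>

lemma loop_integral_real_neighbourhood:
  assumes S: "S \<subseteq> \<real>" and f: "f holomorphic_on {z. infdist z S < \<rho>}"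
    and c: "path c" "pathfinish c = pathstart c" "path_image c \<subseteq> {z. infdist z S < \<rho>}"
    and vb: "var_bound V c 0 1"
  shows "has_curve_integral f 0 c 0 1"
proof -
  define U where "U = {z. infdist z S < \<rho>}"
  define Y where "Y = connected_component_set U (c 0)"
  have "open U" unfolding U_def
    by (rule open_Collect_less) (intro continuous_intros)+
  then have oY: "open Y" unfolding Y_def by (rule open_connected_component)
  have YU: "Y \<subseteq> U" unfolding Y_def by (rule connected_component_subset)
  have "simply_connected Y" unfolding Y_def U_def by (rule simply_connected_component_real_neighbourhood[OF S])
  moreover have "f holomorphic_on Y" using f YU holomorphic_on_subset unfolding U_def by blast
  ultimately obtain F where F: "\<And>z. z \<in> Y \<Longrightarrow> (F has_field_derivative f z) (at z)"
    using simply_connected_eq_global_primitive[OF oY] by blast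
  have "path_image c \<subseteq> Y" unfolding Y_def
    by (rule connected_component_maximal) (use c connected_path_image[OF c(1)] in \<open>auto simp: U_def path_image_def\<close>)
  then have "has_curve_integral f (F (c 1) - F (c 0)) c 0 1"
    using c(1) by (intro has_curve_integral_primitive[OF oY F _ _ vb]) (auto simp: path_def path_image_def)
  then show ?thesis using c(2) by (simp add: pathfinish_def pathstart_def)
qed

section \<open>Operators on complex Hilbert spaces\<close>

lemma cinner_add_left: "cinner (x + y) (z::'a::chilbert) = cinner x z + cinner y z"
  by (metis cinner_add_right cinner_commute complex_cnj_add)

lemma cinner_scaleC_left: "cinner (c *\<^sub>C x) (y::'a::chilbert) = cnj c * cinner x y"
  by (metis cinner_commute cinner_scaleC_right complex_cnj_mult)

lemma cinner_zero [simp]: "cinner x (0::'a::chilbert) = 0" "cinner 0 x = 0"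
  using cinner_scaleC_right[of x 0 0] cinner_scaleC_left[of 0 0 x] by simp_all

lemma cinner_minus [simp]: "cinner x (- y) = - cinner x (y::'a::chilbert)" "cinner (- x) y = - cinner x y"
  using cinner_scaleC_right[of x "-1" y] cinner_scaleC_left[of "-1" x y] by simp_all

lemma cinner_diff_right: "cinner x (y - z) = cinner x y - cinner x (z::'a::chilbert)"
  using cinner_add_right[of x y "- z"] by simp

lemma cinner_diff_left: "cinner (x - y) z = cinner x z - cinner y (z::'a::chilbert)"
  using cinner_add_left[of x "- y" z] by simp

lemma cinner_scaleR_right: "cinner x (r *\<^sub>R y) = complex_of_real r * cinner x (y::'a::chilbert)"
  by (metis cinner_scaleC_right scaleC_of_real)

lemma cinner_scaleR_left: "cinner (r *\<^sub>R x) y = complex_of_real r * cinner x (y::'a::chilbert)"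
  by (metis cinner_scaleC_left complex_cnj_complex_of_real scaleC_of_real)

lemmas cinner_simps = cinner_add_left cinner_add_right cinner_diff_left cinner_diff_right
  cinner_scaleC_left cinner_scaleC_right cinner_scaleR_left cinner_scaleR_right

lemma Re_cinner_commute: "Re (cinner y x) = Re (cinner x (y::'a::chilbert))"
  by (metis cinner_commute cnj.sel(1))

lemma power2_norm_eq_cinner: "(norm x)\<^sup>2 = Re (cinner x (x::'a::chilbert))"
  by (simp add: cinner_self)

lemma cinner_Cauchy_Schwarz: "cmod (cinner x y) \<le> norm x * norm (y::'a::chilbert)"
proof (cases "y = 0")
  case False
  define n where "n = (norm y)\<^sup>2"
  define c where "c = cinner y x / complex_of_real n"
  define k where "k = (cmod (cinner y x))\<^sup>2"
  have n: "n > 0" using False by (simp add: n_def)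
  have k: "cinner x y * cinner y x = complex_of_real k"
    by (simp only: k_def complex_norm_square cinner_commute[of x y] mult.commute)
  have cc: "cnj c = cinner x y / complex_of_real n"
    by (simp add: c_def cinner_commute[of x y])
  have "cinner (x - c *\<^sub>C y) (x - c *\<^sub>C y)
      = cinner x x - c * cinner x y - cnj c * cinner y x + cnj c * c * cinner y y"
    by (simp only: cinner_simps) (simp add: algebra_simps)
  also have "\<dots> = complex_of_real ((norm x)\<^sup>2) - complex_of_real k / complex_of_real n"
    unfolding cinner_self[of x] cinner_self[of y] cc n_def[symmetric] k[symmetric]
    using n by (simp add: c_def power2_eq_square)
  finally have "cinner (x - c *\<^sub>C y) (x - c *\<^sub>C y) = complex_of_real ((norm x)\<^sup>2 - k / n)" by simp
  then have "0 \<le> (norm x)\<^sup>2 - k / n"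
    unfolding cinner_self of_real_eq_iff by (metis zero_le_power2)
  then have "k \<le> (norm x * norm y)\<^sup>2" using n by (simp add: field_simps power_mult_distrib flip: n_def)
  then have "cmod (cinner y x) \<le> norm x * norm y"
    unfolding k_def by (rule power2_le_imp_le) simp
  then show ?thesis by (metis cinner_commute complex_mod_cnj)
qed simp

lemma bounded_linear_cinner_right: "bounded_linear (\<lambda>y::'a::chilbert. cinner x y)"
  by (rule bounded_linear_intro[where K = "norm x"])
    (auto simp: cinner_simps scaleR_conv_of_real mult.commute intro: order_trans[OF cinner_Cauchy_Schwarz])

lemma bounded_linear_cinner_left: "bounded_linear (\<lambda>x::'a::chilbert. cinner x y)"
  by (rule bounded_linear_intro[where K = "norm y"])
    (auto simp: cinner_simps scaleR_conv_of_real mult.commute intro: order_trans[OF cinner_Cauchy_Schwarz])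

lemma cinner_ext: "(\<And>y. cinner y a = cinner y b) \<Longrightarrow> a = (b::'a::chilbert)"
  using cinner_self[of "a - b"] by (simp add: cinner_diff_right)

lemma cinner_ext_left: "(\<And>y. cinner a y = cinner b y) \<Longrightarrow> a = (b::'a::chilbert)"
  using cinner_self[of "a - b"] by (simp add: cinner_diff_left)

lemma quadratic_nonneg_imp_linear_zero:
  fixes a b :: real
  assumes "\<And>t. 0 \<le> t\<^sup>2 * a + 2 * t * b" "0 \<le> a"
  shows "b = 0"
proof (rule ccontr)
  assume "b \<noteq> 0"
  \<comment> \<open>The minimiser would be \<open>- b / a\<close>; the shift by 1 also covers
    \<open>a = 0\<close>.\<close>
  define t where "t = - b / (a + 1)"
  have "a + 1 \<noteq> 0" using assms(2) by simp
  then have "t\<^sup>2 * a + 2 * t * b = - (b\<^sup>2 * (a + 2) / (a + 1)\<^sup>2)"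
    by (simp add: t_def power2_eq_square divide_simps) (simp add: algebra_simps)
  also have "\<dots> < 0"
    using assms(2) \<open>b \<noteq> 0\<close> by simp
  finally show False using assms(1)[of t] by simp
qed

text \<open>The representing vector minimises \<open>\<parallel>x\<parallel>\<^sup>2 - 2 Re f(x)\<close>.\<close>

lemma riesz_representation:
  fixes f :: "'a::chilbert \<Rightarrow> complex"
  assumes f: "bounded_linear f" "\<And>c x. f (c *\<^sub>C x) = c * f x"
  shows "\<exists>z. \<forall>x. f x = cinner z x"
proof -
  interpret bounded_linear f by fact
  obtain K where K: "K > 0" "\<And>x. norm (f x) \<le> norm x * K" using pos_bounded by blast
  define \<phi> where "\<phi> x = (norm x)\<^sup>2 - 2 * Re (f x)" for x
  have low: "- (K\<^sup>2) \<le> \<phi> x" for x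
  proof -
    have "Re (f x) \<le> norm x * K" using complex_Re_le_cmod[of "f x"] K(2)[of x] by linarith
    then show ?thesis using zero_le_power2[of "norm x - K"]
      unfolding \<phi>_def power2_diff by (simp add: algebra_simps)
  qed
  define m where "m = Inf (range \<phi>)"
  have bdd: "bdd_below (range \<phi>)" using low by (intro bdd_belowI[of _ "- (K\<^sup>2)"]) auto
  have m_le: "m \<le> \<phi> x" for x unfolding m_def by (rule cInf_lower) (use bdd in auto)
  have "\<exists>x. \<phi> x < m + inverse (real (Suc n))" for n
    using cInf_lessD[of "range \<phi>" "m + inverse (real (Suc n))"] by (auto simp: m_def)
  then obtain x where x: "\<And>n. \<phi> (x n) < m + inverse (real (Suc n))" by metis
  \<comment> \<open>The parallelogram identity, with the midpoint value bounded below by the infimum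
    \<open>m\<close>: this makes a minimising sequence Cauchy.\<close>
  have par: "(norm (u - v))\<^sup>2 \<le> 2 * (\<phi> u - m) + 2 * (\<phi> v - m)" for u v
  proof -
    have "\<phi> u + \<phi> v - 2 * \<phi> ((1/2) *\<^sub>R (u + v)) = (norm (u - v))\<^sup>2 / 2"
      unfolding \<phi>_def power2_norm_eq_cinner
      by (simp add: cinner_simps scaleR add scaleR_conv_of_real Re_cinner_commute[of v u] field_simps)
    then show ?thesis using m_le[of "(1/2) *\<^sub>R (u + v)"] by simp
  qed
  have "Cauchy x"
  proof (rule metric_CauchyI)
    fix e :: real assume e: "e > 0"
    then obtain N where N: "inverse (real (Suc N)) < e\<^sup>2 / 4"
      using reals_Archimedean[of "e\<^sup>2 / 4"] by auto
    have small: "\<phi> (x k) - m < e\<^sup>2 / 4" if "k \<ge> N" for k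
    proof -
      have "\<phi> (x k) - m < inverse (real (Suc k))" using x[of k] by (simp only: diff_less_eq add.commute)
      also have "\<dots> \<le> inverse (real (Suc N))" using that by simp
      also note N
      finally show ?thesis .
    qed
    have "dist (x i) (x j) < e" if ij: "i \<ge> N" "j \<ge> N" for i j
    proof -
      have "(norm (x i - x j))\<^sup>2 < e\<^sup>2"
        using par[of "x i" "x j"] small[OF ij(1)] small[OF ij(2)] by (simp add: field_simps)
      then show ?thesis using e by (simp add: dist_norm power2_less_imp_less)
    qed
    then show "\<exists>M. \<forall>i\<ge>M. \<forall>j\<ge>M. dist (x i) (x j) < e" by blast
  qed
  then obtain z where z: "x \<longlonglongrightarrow> z" using Cauchy_convergent convergent_def by blast
  have "(\<lambda>n. \<phi> (x n)) \<longlonglongrightarrow> \<phi> z"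
    unfolding \<phi>_def by (intro tendsto_intros z tendsto)
  moreover have "(\<lambda>n. m + inverse (real (Suc n))) \<longlonglongrightarrow> m + 0"
    by (intro tendsto_intros LIMSEQ_inverse_real_of_nat)
  ultimately have "\<phi> z \<le> m + 0" by (rule LIMSEQ_le) (use x less_imp_le in blast)
  then have min: "\<phi> z \<le> \<phi> y" for y using m_le[of y] by simp
  have Re_eq: "Re (cinner z h) = Re (f h)" for h
  proof -
    have "0 \<le> t\<^sup>2 * (norm h)\<^sup>2 + 2 * t * (Re (cinner z h) - Re (f h))" for t
      using min[of "z + t *\<^sub>R h"] unfolding \<phi>_def power2_norm_eq_cinner
      by (simp add: cinner_simps scaleR add Re_cinner_commute[of h z] algebra_simps power2_eq_square)
    from quadratic_nonneg_imp_linear_zero[OF this] show ?thesis by simp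
  qed
  \<comment> \<open>Stationarity along real directions gives only real parts; the imaginary part
    comes from the direction \<open>\<i> *\<^sub>C h\<close>.\<close>
  have "f h = cinner z h" for h
    using Re_eq[of h] Re_eq[of "\<i> *\<^sub>C h"] by (simp add: f(2) cinner_simps complex_eq_iff)
  then show ?thesis by blast
qed

declare scaleC_blinfun.rep_eq [simp]

lemma clinear_opD: "clinear_op T \<Longrightarrow> T (c *\<^sub>C x) = c *\<^sub>C T x"
  by (simp add: clinear_op_def)

lemma clinear_id [simp]: "clinear_op id_blinfun" by (simp add: clinear_op_def)
lemma clinear_zero [simp]: "clinear_op 0" by (simp add: clinear_op_def)
lemma clinear_add [intro]: "clinear_op S \<Longrightarrow> clinear_op T \<Longrightarrow> clinear_op (S + T)"
  by (simp add: clinear_op_def blinfun.add_left scaleC_add_right)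
lemma clinear_diff [intro]: "clinear_op S \<Longrightarrow> clinear_op T \<Longrightarrow> clinear_op (S - T)"
  by (simp add: clinear_op_def blinfun.diff_left scaleC.diff_right)
lemma clinear_scaleC [intro]: "clinear_op T \<Longrightarrow> clinear_op (c *\<^sub>C T)"
  by (simp add: clinear_op_def scaleC_scaleC mult.commute)
lemma clinear_compose [intro]: "clinear_op S \<Longrightarrow> clinear_op T \<Longrightarrow> clinear_op (S o\<^sub>L T)"
  by (simp add: clinear_op_def)

lemma norm_blinfun_compose_le:
  "norm S \<le> a \<Longrightarrow> norm T \<le> b \<Longrightarrow> norm (S o\<^sub>L T) \<le> a * b"
  by (rule order_trans[OF norm_blinfun_compose]) (auto intro!: mult_mono order_trans[OF norm_ge_zero])

subsection \<open>Adjoints\<close>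

lemma adj_eqI:
  fixes T :: "'a::chilbert \<Rightarrow>\<^sub>L 'b::chilbert" and S :: "'b \<Rightarrow>\<^sub>L 'a"
  assumes "\<And>x y. cinner (S y) x = cinner y (T x)"
  shows "adj T = S"
  unfolding adj_def
proof (rule the_equality)
  show "\<forall>x y. cinner (S y) x = cinner y (T x)" using assms by blast
  fix S' :: "'b \<Rightarrow>\<^sub>L 'a"
  assume S': "\<forall>x y. cinner (S' y) x = cinner y (T x)"
  show "S' = S"
    by (rule blinfun_eqI, rule cinner_ext_left) (simp add: S' assms)
qed

lemma adj_exists:
  fixes T :: "'a::chilbert \<Rightarrow>\<^sub>L 'b::chilbert"
  assumes T: "clinear_op T"
  shows "\<exists>S :: 'b \<Rightarrow>\<^sub>L 'a. \<forall>x y. cinner (S y) x = cinner y (T x)"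
proof -
  have "\<exists>z. \<forall>x. cinner y (T x) = cinner z x" for y
    by (rule riesz_representation)
      (auto intro: bounded_linear_compose[OF bounded_linear_cinner_right blinfun.bounded_linear_right]
        simp: clinear_opD[OF T] cinner_simps)
  then obtain s where s: "\<And>x y. cinner y (T x) = cinner (s y) x" by metis
  have "bounded_linear s"
  proof (rule bounded_linear_intro[where K = "norm T"])
    show "s (x + y) = s x + s y" for x y
      by (rule cinner_ext_left) (simp add: cinner_simps flip: s)
    show "s (r *\<^sub>R x) = r *\<^sub>R s x" for r x
      by (rule cinner_ext_left) (simp add: cinner_simps flip: s)
    show "norm (s y) \<le> norm y * norm T" for y
    proof (cases "s y = 0")
      case False
      have "(norm (s y))\<^sup>2 = Re (cinner y (T (s y)))" by (simp add: power2_norm_eq_cinner s)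
      also have "\<dots> \<le> norm y * norm (T (s y))"
        by (rule order_trans[OF complex_Re_le_cmod cinner_Cauchy_Schwarz])
      also have "\<dots> \<le> norm y * (norm T * norm (s y))"
        by (intro mult_left_mono norm_blinfun) simp
      finally show ?thesis using False by (simp add: power2_eq_square)
    qed simp
  qed
  then have "blinfun_apply (Blinfun s) = s" by (rule bounded_linear_Blinfun_apply)
  then show ?thesis using s by (intro exI[of _ "Blinfun s"]) simp
qed

lemma cinner_adj_left: "clinear_op T \<Longrightarrow> cinner (adj T y) x = cinner y (T x)"
  using adj_exists[of T] adj_eqI[of _ T] by metis

lemma cinner_adj_right: "clinear_op T \<Longrightarrow> cinner x (adj T y) = cinner (T x) y"
  by (metis cinner_adj_left cinner_commute)

lemma clinear_adj [intro]: "clinear_op T \<Longrightarrow> clinear_op (adj T)"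
  unfolding clinear_op_def[of "adj T"]
  by (intro allI cinner_ext_left) (simp add: cinner_adj_left cinner_simps)

lemma adj_adj: "clinear_op T \<Longrightarrow> adj (adj T) = T"
  by (rule adj_eqI) (simp add: cinner_adj_right)

lemma adj_diff: "clinear_op S \<Longrightarrow> clinear_op T \<Longrightarrow> adj (S - T) = adj S - adj T"
  by (rule adj_eqI) (simp add: cinner_adj_left cinner_simps blinfun.diff_left)

lemma adj_scaleC: "clinear_op T \<Longrightarrow> adj (c *\<^sub>C T) = cnj c *\<^sub>C adj T"
  by (rule adj_eqI) (simp add: cinner_adj_left cinner_simps)

lemma adj_id [simp]: "adj id_blinfun = id_blinfun"
  by (rule adj_eqI) simp

lemma adj_compose: "clinear_op S \<Longrightarrow> clinear_op T \<Longrightarrow> adj (S o\<^sub>L T) = adj T o\<^sub>L adj S"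
  by (rule adj_eqI) (simp add: cinner_adj_left)

lemma norm_adj_le:
  assumes "clinear_op T" shows "norm (adj T) \<le> norm T"
proof (rule norm_blinfun_bound)
  fix y
  show "norm (adj T y) \<le> norm T * norm y"
  proof (cases "adj T y = 0")
    case False
    have "(norm (adj T y))\<^sup>2 = Re (cinner y (T (adj T y)))"
      by (simp add: power2_norm_eq_cinner cinner_adj_left assms)
    also have "\<dots> \<le> norm y * norm (T (adj T y))"
      by (rule order_trans[OF complex_Re_le_cmod cinner_Cauchy_Schwarz])
    also have "\<dots> \<le> norm y * (norm T * norm (adj T y))"
      by (intro mult_left_mono norm_blinfun) simp
    finally show ?thesis using False by (simp add: power2_eq_square mult.commute)
  qed simp
qed simp

lemma norm_adj: "clinear_op T \<Longrightarrow> norm (adj T) = norm T"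
  using norm_adj_le[of T] norm_adj_le[of "adj T"] adj_adj[of T] clinear_adj[of T] by simp

lemma selfadjoint_cinner: "selfadjoint_op T \<Longrightarrow> cinner (T x) y = cinner x (T y)"
  unfolding selfadjoint_op_def using cinner_adj_left by metis

subsection \<open>Inverses and spectra\<close>

lemma is_inverse_op_apply:
  assumes "is_inverse_op T S"
  shows "T (S x) = x" "S (T y) = y"
proof -
  have "(T o\<^sub>L S) x = x" "(S o\<^sub>L T) y = y" using assms by (simp_all add: is_inverse_op_def)
  then show "T (S x) = x" "S (T y) = y" by simp_all
qed

lemma is_inverse_opI:
  fixes T :: "'a::real_normed_vector \<Rightarrow>\<^sub>L 'b::real_normed_vector" and S :: "'b \<Rightarrow>\<^sub>L 'a"
  shows "(\<And>x. T (S x) = x) \<Longrightarrow> (\<And>x. S (T x) = x) \<Longrightarrow> is_inverse_op T S"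
  unfolding is_inverse_op_def by (auto intro!: blinfun_eqI)

lemma inv_op_eq:
  assumes "is_inverse_op T S" shows "inv_op T = S"
  unfolding inv_op_def
proof (rule the_equality, rule assms)
  fix S' assume S': "is_inverse_op T S'"
  show "S' = S"
    by (rule blinfun_eqI) (metis is_inverse_op_apply[OF assms] is_inverse_op_apply[OF S'])
qed

lemma is_inverse_inv_op: "is_inverse_op T S \<Longrightarrow> is_inverse_op T (inv_op T)"
  using inv_op_eq by metis

lemma is_inverse_clinear: "is_inverse_op T S \<Longrightarrow> clinear_op T \<Longrightarrow> clinear_op S"
  unfolding clinear_op_def by (metis is_inverse_op_apply)

lemma is_inverse_compose:
  "is_inverse_op S S' \<Longrightarrow> is_inverse_op T T' \<Longrightarrow> is_inverse_op (S o\<^sub>L T) (T' o\<^sub>L S')"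
  by (rule is_inverse_opI) (simp_all add: is_inverse_op_apply)

lemma is_inverse_adj:
  assumes "is_inverse_op T S" "clinear_op T"
  shows "is_inverse_op (adj T) (adj S)"
  using assms is_inverse_clinear[OF assms] unfolding is_inverse_op_def
  by (simp flip: adj_compose)

lemma is_inverse_norm_le:
  assumes S: "is_inverse_op T S" and m: "m > 0" "\<And>x. m * norm x \<le> norm (T x)"
  shows "norm S \<le> 1 / m"
proof (rule norm_blinfun_bound)
  show "norm (S x) \<le> 1 / m * norm x" for x
    using m(2)[of "S x"] m(1) by (simp add: is_inverse_op_apply[OF S] field_simps)
qed (use m in simp)

text \<open>In place of a Neumann series: a right and a left inverse are the Banach fixed points of
  S \<mapsto> 1 - F S and S \<mapsto> 1 - S F, and a right and a left inverse always
  coincide.\<close>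

lemma invertible_id_plus:
  fixes F :: "'a::banach \<Rightarrow>\<^sub>L 'a"
  assumes F: "norm F < 1"
  shows "\<exists>S. is_inverse_op (id_blinfun + F) S"
proof -
  have "\<exists>!S. id_blinfun - (F o\<^sub>L S) = S"
  proof (rule banach_fix_type[of "norm F"])
    show "\<forall>S T. dist (id_blinfun - (F o\<^sub>L S)) (id_blinfun - (F o\<^sub>L T)) \<le> norm F * dist S T"
    proof (intro allI)
      fix S T :: "'a \<Rightarrow>\<^sub>L 'a"
      have "(id_blinfun - (F o\<^sub>L S)) - (id_blinfun - (F o\<^sub>L T)) = F o\<^sub>L (T - S)"
        by (rule blinfun_eqI) (simp add: blinfun.diff_left blinfun.diff_right)
      then show "dist (id_blinfun - (F o\<^sub>L S)) (id_blinfun - (F o\<^sub>L T)) \<le> norm F * dist S T"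
        using norm_blinfun_compose[of F "T - S"] by (simp add: dist_norm norm_minus_commute)
    qed
  qed (use F in auto)
  then obtain S where S: "id_blinfun - (F o\<^sub>L S) = S" by blast
  have "\<exists>!S. id_blinfun - (S o\<^sub>L F) = S"
  proof (rule banach_fix_type[of "norm F"])
    show "\<forall>S T. dist (id_blinfun - (S o\<^sub>L F)) (id_blinfun - (T o\<^sub>L F)) \<le> norm F * dist S T"
    proof (intro allI)
      fix S T :: "'a \<Rightarrow>\<^sub>L 'a"
      have "(id_blinfun - (S o\<^sub>L F)) - (id_blinfun - (T o\<^sub>L F)) = (T - S) o\<^sub>L F"
        by (rule blinfun_eqI) (simp add: blinfun.diff_left blinfun.diff_right)
      then show "dist (id_blinfun - (S o\<^sub>L F)) (id_blinfun - (T o\<^sub>L F)) \<le> norm F * dist S T"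
        using norm_blinfun_compose[of "T - S" F] by (simp add: dist_norm norm_minus_commute mult.commute)
    qed
  qed (use F in auto)
  then obtain S' where S': "id_blinfun - (S' o\<^sub>L F) = S'" by blast
  have r: "S x + F (S x) = x" for x
    using arg_cong[OF S, of "\<lambda>T. blinfun_apply T x"] by (simp add: blinfun.diff_left algebra_simps)
  have l: "S' x + S' (F x) = x" for x
    using arg_cong[OF S', of "\<lambda>T. blinfun_apply T x"] by (simp add: blinfun.diff_left algebra_simps)
  have "S' x = S x" for x
    using l[of "S x"] r[of x] by (metis blinfun.add_right)
  then have "is_inverse_op (id_blinfun + F) S"
    using l r by (intro is_inverse_opI) (simp_all add: blinfun.add_left blinfun.add_right)
  then show ?thesis by blast
qed

lemma not_in_spectrum: "z \<notin> spectrum T \<Longrightarrow> is_inverse_op (T - z *\<^sub>C id_blinfun) (inv_op (T - z *\<^sub>C id_blinfun))"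
  unfolding spectrum_def using is_inverse_inv_op by blast

section \<open>Resolvent bounds for selfadjoint operators\<close>

lemma infdist_Complex_le:
  assumes S: "S \<subseteq> \<real>"
  shows "(infdist (Complex a b) S)\<^sup>2 \<le> (infdist (Complex a 0) S)\<^sup>2 + b\<^sup>2"
\<comment> \<open>Pythagoras for each real point of \<open>S\<close>. The split keeps
  \<open>r\<^sup>2 - b\<^sup>2\<close> positive under the root; \<open>infdist\<close> to the empty
  set is 0, so the other case is trivial.\<close>
proof (cases "S = {} \<or> (infdist (Complex a b) S)\<^sup>2 \<le> b\<^sup>2")
  case False
  define r where "r = infdist (Complex a b) S"
  have r: "b\<^sup>2 < r\<^sup>2" "S \<noteq> {}" using False by (auto simp: r_def)
  have "sqrt (r\<^sup>2 - b\<^sup>2) \<le> dist (Complex a 0) s" if "s \<in> S" for s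
  proof -
    have s: "Im s = 0" using S that complex_is_Real_iff by blast
    have "r \<le> sqrt ((a - Re s)\<^sup>2 + b\<^sup>2)"
      using infdist_le[OF that, of "Complex a b"] by (simp add: r_def dist_norm cmod_def s)
    then have "r\<^sup>2 \<le> (a - Re s)\<^sup>2 + b\<^sup>2"
      using infdist_nonneg[of "Complex a b" S] unfolding r_def
      by (metis abs_of_nonneg real_sqrt_abs real_sqrt_le_iff)
    then have "sqrt (r\<^sup>2 - b\<^sup>2) \<le> sqrt ((a - Re s)\<^sup>2)" by (intro real_sqrt_le_mono) simp
    then show ?thesis by (simp add: dist_norm cmod_def s)
  qed
  then have "sqrt (r\<^sup>2 - b\<^sup>2) \<le> infdist (Complex a 0) S"
    unfolding infdist_notempty[OF r(2)] using r(2) by (intro cINF_greatest) auto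
  then have "r\<^sup>2 - b\<^sup>2 \<le> (infdist (Complex a 0) S)\<^sup>2"
    by (rule sqrt_le_D)
  then show ?thesis by (simp add: r_def)
next
  case True
  then have "(infdist (Complex a b) S)\<^sup>2 \<le> b\<^sup>2" by (rule disjE, simp add: infdist_def)
  then show ?thesis using zero_le_power2[of "infdist (Complex a 0) S"] by linarith
qed

text \<open>This stands in for the spectral radius formula in the resolvent bound: applied to
  \<open>P = (A - a)\<^sup>2 - m\<close> with \<open>m\<close> the infimum of \<open>\<parallel>(A - a) x\<parallel>\<^sup>2\<close> over unit vectors, it shows that \<open>P\<close> has
  no bounded inverse.\<close>

lemma nonneg_op_norm_le:
  fixes P :: "'a::chilbert \<Rightarrow>\<^sub>L 'a"
  assumes P: "\<And>x y. cinner (P x) y = cinner x (P y)" and nn: "\<And>x. 0 \<le> Re (cinner x (P x))"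
  shows "(norm (P x))\<^sup>2 \<le> (norm P + 1) * Re (cinner x (P x))"
proof -
  define K where "K = norm P + 1"
  have K: "K > 0" "norm P \<le> K" unfolding K_def by (simp_all add: add_nonneg_pos)
  \<comment> \<open>A gradient step: it lowers the quadratic form by at least |P x|^2 / K, and the
    form must remain nonnegative at \<open>y\<close>.\<close>
  define y where "y = x - (1 / K) *\<^sub>R P x"
  have "Re (cinner (P x) (P (P x))) \<le> norm (P x) * norm (P (P x))"
    by (rule order_trans[OF complex_Re_le_cmod cinner_Cauchy_Schwarz])
  also have "\<dots> \<le> norm (P x) * (K * norm (P x))"
    using norm_blinfun[of P "P x"] K(2) mult_right_mono[OF K(2) norm_ge_zero[of "P x"]]
    by (intro mult_left_mono) auto
  finally have PP: "Re (cinner (P x) (P (P x))) \<le> K * (norm (P x))\<^sup>2"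
    by (simp add: power2_eq_square mult_ac)
  have "Re (cinner y (P y)) = Re (cinner x (P x)) - 2 / K * (norm (P x))\<^sup>2 + (1 / K)\<^sup>2 * Re (cinner (P x) (P (P x)))"
    unfolding y_def power2_norm_eq_cinner
    by (simp add: cinner_simps blinfun.diff_right blinfun.scaleR_right P[symmetric] power2_eq_square algebra_simps)
  also have "\<dots> \<le> Re (cinner x (P x)) - 2 / K * (norm (P x))\<^sup>2 + (1 / K)\<^sup>2 * (K * (norm (P x))\<^sup>2)"
    by (intro add_left_mono mult_left_mono PP) simp
  also have "\<dots> = Re (cinner x (P x)) - (norm (P x))\<^sup>2 / K"
    using K(1) by (simp add: power2_eq_square field_simps)
  finally have "(norm (P x))\<^sup>2 / K \<le> Re (cinner x (P x))" using nn[of y] by linarith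
  then show ?thesis using K(1) unfolding K_def[symmetric] by (simp add: field_simps)
qed

text \<open>If the bound failed, sqrt m would be less than the distance \<delta> from a to the
  spectrum, so a + sqrt m and a - sqrt m would be resolvent points and P = (A - a - sqrt m)(A - a +
  sqrt m) invertible. But the form of P has infimum 0 on unit vectors, and for a nonnegative
  operator a small form value forces a small image.\<close>

lemma selfadjoint_real_lower_bound:
  fixes A :: "'a::chilbert \<Rightarrow>\<^sub>L 'a"
  assumes A: "selfadjoint_op A"
  shows "infdist (complex_of_real a) (spectrum A) * norm x \<le> norm (A x - a *\<^sub>R x)"
proof (rule ccontr)
  assume contra: "\<not> ?thesis"
  define \<delta> where "\<delta> = infdist (complex_of_real a) (spectrum A)"
  have x0: "x \<noteq> 0" using contra by auto
  have \<delta>0: "0 \<le> \<delta>" unfolding \<delta>_def by (rule infdist_nonneg)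
  define q where "q x = (norm (A x - a *\<^sub>R x))\<^sup>2" for x
  define m where "m = Inf (q ` {x. norm x = 1})"
  define u where "u = (1 / norm x) *\<^sub>R x"
  have u: "norm u = 1" using x0 by (simp add: u_def)
  have q0: "0 \<le> q x" for x by (simp add: q_def)
  have bdd: "bdd_below (q ` {x. norm x = 1})" using q0 by (intro bdd_belowI[of _ 0]) auto
  have m0: "0 \<le> m" unfolding m_def by (rule cINF_greatest) (use u q0 in auto)
  have q_scale: "q (r *\<^sub>R y) = r\<^sup>2 * q y" for r y
  proof -
    have "A (r *\<^sub>R y) - a *\<^sub>R (r *\<^sub>R y) = r *\<^sub>R (A y - a *\<^sub>R y)"
      by (simp add: blinfun.scaleR_right scaleR_diff_right mult.commute)
    then show ?thesis by (simp add: q_def power_mult_distrib)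
  qed
  have m_le: "m * (norm y)\<^sup>2 \<le> q y" for y
  proof (cases "y = 0")
    case False
    define v where "v = (1 / norm y) *\<^sub>R y"
    have "norm v = 1" using False by (simp add: v_def)
    then have "m \<le> q v" unfolding m_def by (intro cINF_lower bdd) simp
    moreover have "y = norm y *\<^sub>R v" using False by (simp add: v_def)
    then have "q y = (norm y)\<^sup>2 * q v" using q_scale[of "norm y" v] by simp
    ultimately show ?thesis by (simp add: mult.commute mult_right_mono)
  qed (use q0 in simp)
  have "norm (A x - a *\<^sub>R x) < \<delta> * norm x" using contra unfolding \<delta>_def by simp
  then have "q x < \<delta>\<^sup>2 * (norm x)\<^sup>2"
    unfolding q_def power_mult_distrib[symmetric] by (intro power_strict_mono) auto
  then have "m * (norm x)\<^sup>2 < \<delta>\<^sup>2 * (norm x)\<^sup>2" using m_le[of x] by linarith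
  then have "m < \<delta>\<^sup>2" using x0 by simp
  then have sm: "sqrt m < \<delta>" using \<delta>0 by (simp add: real_less_lsqrt)
  have out: "complex_of_real b \<notin> spectrum A" if "\<bar>b - a\<bar> < \<delta>" for b
  proof
    assume "complex_of_real b \<in> spectrum A"
    from infdist_le[OF this, of "complex_of_real a"] show False
      using that unfolding \<delta>_def[symmetric]
      by (simp add: dist_norm norm_minus_commute flip: of_real_diff)
  qed
  define S where "S b = inv_op (A - complex_of_real b *\<^sub>C id_blinfun)" for b
  have S: "is_inverse_op (A - complex_of_real b *\<^sub>C id_blinfun) (S b)" if "\<bar>b - a\<bar> < \<delta>" for b
    unfolding S_def by (rule not_in_spectrum[OF out[OF that]])
  have sm0: "0 \<le> sqrt m" using m0 by simp
  define P where "P = (A - complex_of_real (a + sqrt m) *\<^sub>C id_blinfun) o\<^sub>L (A - complex_of_real (a - sqrt m) *\<^sub>C id_blinfun)"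
  define R where "R = S (a - sqrt m) o\<^sub>L S (a + sqrt m)"
  have inv: "is_inverse_op P R"
    unfolding P_def R_def by (rule is_inverse_compose; rule S) (use sm sm0 in auto)
  have Peq: "P y = (A (A y - a *\<^sub>R y) - a *\<^sub>R (A y - a *\<^sub>R y)) - m *\<^sub>R y" for y
  proof -
    define w where "w = A y - a *\<^sub>R y"
    have Ay: "A y = w + a *\<^sub>R y" by (simp add: w_def)
    have ss: "sqrt m *\<^sub>R sqrt m *\<^sub>R y = m *\<^sub>R y" using m0 by simp
    have 1: "(A - complex_of_real (a - sqrt m) *\<^sub>C id_blinfun) y = w + sqrt m *\<^sub>R y"
      by (simp add: blinfun.diff_left blinfun.scaleR_left scaleC_of_real w_def scaleR_diff_left del: of_real_diff)
    have 2: "(A - complex_of_real (a + sqrt m) *\<^sub>C id_blinfun) v = A v - a *\<^sub>R v - sqrt m *\<^sub>R v" for v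
      by (simp add: blinfun.diff_left blinfun.add_left blinfun.scaleR_left scaleC_of_real scaleR_add_left del: of_real_add)
    have "P y = A w + sqrt m *\<^sub>R A y - a *\<^sub>R (w + sqrt m *\<^sub>R y) - sqrt m *\<^sub>R (w + sqrt m *\<^sub>R y)"
      unfolding P_def blinfun_apply_blinfun_compose 1 2 by (simp add: blinfun.add_right blinfun.scaleR_right)
    also have "\<dots> = A w - a *\<^sub>R w - m *\<^sub>R y"
      unfolding Ay scaleR_add_right ss by (simp add: mult.commute)
    finally show ?thesis by (simp add: w_def)
  qed
  have Asym: "cinner (A y - a *\<^sub>R y) z = cinner y (A z - a *\<^sub>R z)" for y z
    by (simp add: cinner_simps selfadjoint_cinner[OF A])
  have Psym: "cinner (P y) z = cinner y (P z)" for y z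
    by (simp add: Peq cinner_diff_left[of _ "m *\<^sub>R y"] cinner_diff_right[of _ _ "m *\<^sub>R z"] Asym
        cinner_scaleR_left cinner_scaleR_right)
  have form: "Re (cinner y (P y)) = q y - m * (norm y)\<^sup>2" for y
    by (simp add: Peq cinner_diff_right[of _ _ "m *\<^sub>R y"] Asym[symmetric] cinner_scaleR_right q_def
        power2_norm_eq_cinner)
  have nn: "0 \<le> Re (cinner y (P y))" for y using m_le[of y] by (simp add: form)
  \<comment> \<open>Chosen so that a unit vector whose form value is below \<open>1 / L\<close>
    leads to 1 \<le> (L - 1) / L.\<close>
  define L where "L = (norm R)\<^sup>2 * (norm P + 1) + 1"
  have L: "L > 0" unfolding L_def by (intro add_nonneg_pos mult_nonneg_nonneg) auto
  have "q ` {x. norm x = 1} \<noteq> {}" using u by auto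
  from cInf_lessD[OF this, of "m + 1 / L"] obtain v where v: "norm v = 1" "q v < m + 1 / L"
    using L by (auto simp: m_def)
  have "norm v \<le> norm R * norm (P v)"
    using norm_blinfun[of R "P v"] by (simp add: is_inverse_op_apply(2)[OF inv])
  then have "1 \<le> (norm R * norm (P v))\<^sup>2" using v(1) by (simp add: one_le_power)
  also have "\<dots> = (norm R)\<^sup>2 * (norm (P v))\<^sup>2" by (rule power_mult_distrib)
  also have "\<dots> \<le> (norm R)\<^sup>2 * ((norm P + 1) * Re (cinner v (P v)))"
    by (intro mult_left_mono nonneg_op_norm_le Psym nn) simp
  also have "\<dots> = (L - 1) * Re (cinner v (P v))" by (simp add: L_def)
  also have "\<dots> \<le> (L - 1) * (1 / L)"
  proof (rule mult_left_mono)
    show "Re (cinner v (P v)) \<le> 1 / L" using v by (simp add: form)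
    show "0 \<le> L - 1" unfolding L_def by simp
  qed
  also have "\<dots> < 1" using L by (simp add: field_simps)
  finally show False by simp
qed

lemma selfadjoint_lower_bound:
  fixes A :: "'a::chilbert \<Rightarrow>\<^sub>L 'a"
  assumes A: "selfadjoint_op A" and real: "spectrum A \<subseteq> \<real>"
  shows "infdist \<mu> (spectrum A) * norm x \<le> norm ((A - \<mu> *\<^sub>C id_blinfun) x)"
proof -
  define a b where "a = Re \<mu>" and "b = Im \<mu>"
  have \<mu>: "\<mu> = Complex a b" by (simp add: a_def b_def)
  have of_real: "complex_of_real a = Complex a 0" by (simp add: complex_eq_iff)
  have "Im (cinner x (A x - a *\<^sub>R x)) = 0"
  proof -
    have "cinner x (A x - a *\<^sub>R x) = cinner (A x - a *\<^sub>R x) x"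
      by (simp add: cinner_simps selfadjoint_cinner[OF A])
    then have "cinner x (A x - a *\<^sub>R x) = cnj (cinner x (A x - a *\<^sub>R x))" by (metis cinner_commute)
    then show ?thesis by (metis cnj.sel(2) equal_neg_zero)
  qed
  \<comment> \<open>The form of the symmetric operator \<open>A - a\<close> is real, so the factor
    \<open>\<i> * b\<close> makes the cross term imaginary and the two parts of
    \<open>A - \<mu>\<close> add by Pythagoras.\<close>
  then have cross: "Re (cinner (A x - a *\<^sub>R x) ((\<i> * complex_of_real b) *\<^sub>C x)) = 0"
    unfolding cinner_scaleC_right cinner_commute[of "A x - a *\<^sub>R x" x] by simp
  have eq: "(A - \<mu> *\<^sub>C id_blinfun) x = (A x - a *\<^sub>R x) - (\<i> * complex_of_real b) *\<^sub>C x"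
    by (simp add: blinfun.diff_left blinfun.add_left blinfun.scaleR_left \<mu> Complex_eq scaleC_add_left scaleC_of_real)
  have "(norm ((A - \<mu> *\<^sub>C id_blinfun) x))\<^sup>2 = (norm (A x - a *\<^sub>R x))\<^sup>2 + b\<^sup>2 * (norm x)\<^sup>2"
  proof -
    have "(norm ((A - \<mu> *\<^sub>C id_blinfun) x))\<^sup>2 = (norm (A x - a *\<^sub>R x))\<^sup>2 + (norm ((\<i> * complex_of_real b) *\<^sub>C x))\<^sup>2"
      unfolding eq power2_norm_eq_cinner cinner_diff_left[of "A x - a *\<^sub>R x"] cinner_diff_right[of _ "A x - a *\<^sub>R x"]
      using cross by (simp only: minus_complex.sel Re_cinner_commute[of "(\<i> * complex_of_real b) *\<^sub>C x" "A x - a *\<^sub>R x"])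
    then show ?thesis by (simp add: norm_scaleC norm_mult power_mult_distrib)
  qed
  moreover have "(infdist (Complex a 0) (spectrum A))\<^sup>2 * (norm x)\<^sup>2 \<le> (norm (A x - a *\<^sub>R x))\<^sup>2"
    unfolding power_mult_distrib[symmetric] of_real[symmetric]
    by (intro power_mono selfadjoint_real_lower_bound[OF A]) (simp add: infdist_nonneg)
  moreover have "(infdist \<mu> (spectrum A))\<^sup>2 * (norm x)\<^sup>2
      \<le> ((infdist (Complex a 0) (spectrum A))\<^sup>2 + b\<^sup>2) * (norm x)\<^sup>2"
    unfolding \<mu> by (intro mult_right_mono infdist_Complex_le real) simp
  ultimately have "(infdist \<mu> (spectrum A) * norm x)\<^sup>2 \<le> (norm ((A - \<mu> *\<^sub>C id_blinfun) x))\<^sup>2"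
    by (simp add: power_mult_distrib algebra_simps)
  then show ?thesis by (rule power2_le_imp_le) simp
qed

text \<open>Factor Y - \<mu> = (A - \<mu>)(1 + S (Y - A)) with S the resolvent of A; the
  perturbation has norm below 1. The norm bound then comes from the lower bound for A - \<mu>
  reduced by r.\<close>

lemma selfadjoint_perturbed_resolvent:
  fixes A :: "'a::chilbert \<Rightarrow>\<^sub>L 'a"
  assumes A: "selfadjoint_op A" and real: "spectrum A \<subseteq> \<real>" and r: "norm (Y - A) \<le> r" "r < infdist \<mu> (spectrum A)"
  defines "R \<equiv> inv_op (Y - \<mu> *\<^sub>C id_blinfun)"
  shows "is_inverse_op (Y - \<mu> *\<^sub>C id_blinfun) R" "norm R \<le> 1 / (infdist \<mu> (spectrum A) - r)"
proof -
  define \<delta> where "\<delta> = infdist \<mu> (spectrum A)"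
  have r0: "0 \<le> r" using r(1) norm_ge_zero order_trans by blast
  then have \<delta>: "\<delta> > 0" using r by (simp add: \<delta>_def)
  have "\<mu> \<notin> spectrum A" using \<delta> infdist_zero[of \<mu> "spectrum A"] unfolding \<delta>_def by auto
  from not_in_spectrum[OF this] obtain S where S: "is_inverse_op (A - \<mu> *\<^sub>C id_blinfun) S" by blast
  have "norm S \<le> 1 / \<delta>"
    by (rule is_inverse_norm_le[OF S \<delta>]) (unfold \<delta>_def, rule selfadjoint_lower_bound[OF A real])
  then have "norm (S o\<^sub>L (Y - A)) \<le> 1 / \<delta> * r" by (rule norm_blinfun_compose_le[OF _ r(1)])
  also have "\<dots> < 1" using r(2) \<delta> by (simp add: \<delta>_def field_simps)
  finally obtain W where W: "is_inverse_op (id_blinfun + (S o\<^sub>L (Y - A))) W" using invertible_id_plus by blast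
  have "(A - \<mu> *\<^sub>C id_blinfun) o\<^sub>L (id_blinfun + (S o\<^sub>L (Y - A))) = Y - \<mu> *\<^sub>C id_blinfun"
  proof (rule blinfun_eqI)
    fix x
    have "(A - \<mu> *\<^sub>C id_blinfun) (S (Y x - A x)) = Y x - A x" by (rule is_inverse_op_apply(1)[OF S])
    then show "((A - \<mu> *\<^sub>C id_blinfun) o\<^sub>L (id_blinfun + (S o\<^sub>L (Y - A)))) x = (Y - \<mu> *\<^sub>C id_blinfun) x"
      by (simp add: blinfun.add_left blinfun.add_right blinfun.diff_left)
  qed
  then have "is_inverse_op (Y - \<mu> *\<^sub>C id_blinfun) (W o\<^sub>L S)"
    using is_inverse_compose[OF S W] by simp
  then show inv: "is_inverse_op (Y - \<mu> *\<^sub>C id_blinfun) R" unfolding R_def by (rule is_inverse_inv_op)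
  show "norm R \<le> 1 / (infdist \<mu> (spectrum A) - r)"
  proof (rule is_inverse_norm_le[OF inv])
    show "0 < infdist \<mu> (spectrum A) - r" using r by simp
    fix x
    have "\<delta> * norm x \<le> norm ((A - \<mu> *\<^sub>C id_blinfun) x)"
      unfolding \<delta>_def by (rule selfadjoint_lower_bound[OF A real])
    moreover have "(A - \<mu> *\<^sub>C id_blinfun) x = (Y - \<mu> *\<^sub>C id_blinfun) x - (Y - A) x"
      by (simp add: blinfun.diff_left)
    moreover have "norm ((Y - A) x) \<le> r * norm x"
      using norm_blinfun[of "Y - A" x] mult_right_mono[OF r(1) norm_ge_zero[of x]] by linarith
    ultimately have "\<delta> * norm x \<le> norm ((Y - \<mu> *\<^sub>C id_blinfun) x) + r * norm x"
      using norm_triangle_ineq4[of "(Y - \<mu> *\<^sub>C id_blinfun) x" "(Y - A) x"] by simp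
    then show "(infdist \<mu> (spectrum A) - r) * norm x \<le> norm ((Y - \<mu> *\<^sub>C id_blinfun) x)"
      by (simp add: \<delta>_def algebra_simps)
  qed
qed

section \<open>Operator-valued contour integrals\<close>

lemma has_contour_int_clinear:
  fixes F :: "complex \<Rightarrow> 'a::chilbert \<Rightarrow>\<^sub>L 'b::chilbert"
  assumes I: "has_contour_int g F I" and F: "\<And>t. t > 0 \<Longrightarrow> clinear_op (F (g t))"
  shows "clinear_op I"
  unfolding clinear_op_def
proof (intro allI)
  fix c x
  \<comment> \<open>The defect of complex linearity is itself a contour integral, with an integrand
    that vanishes on the contour.\<close>
  have "has_contour_int g (\<lambda>z. F z (c *\<^sub>C x) - c *\<^sub>C F z x) (I (c *\<^sub>C x) - c *\<^sub>C I x)"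
    by (rule has_contour_int_linear[OF I, where L = "\<lambda>T. blinfun_apply T (c *\<^sub>C x) - c *\<^sub>C blinfun_apply T x"])
      (auto intro!: bounded_linear_sub blinfun.bounded_linear_left
        bounded_linear_compose[OF bounded_linear_scaleC_right blinfun.bounded_linear_left]
        simp: scaleC.diff_right scaleC_scaleC mult.commute)
  moreover have "has_contour_int g (\<lambda>z. F z (c *\<^sub>C x) - c *\<^sub>C F z x) 0"
    by (rule has_contour_int_cong[OF has_contour_int_scaleC[OF I, of 0, THEN has_contour_int_linear[OF _ blinfun.bounded_linear_left, of _ _ _ 0], simplified]])
      (simp_all add: clinear_opD[OF F])
  ultimately show "I (c *\<^sub>C x) = c *\<^sub>C I x" using has_contour_int_unique by fastforce
qed

text \<open>The form \<langle>T x, y\<rangle> is conjugate-linear in T, so integrating it moves the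
  contour to its conjugate. There it is compared with \<langle>x, T' y\<rangle>, which is linear in
  T', and scalar integrals are unique.\<close>

lemma has_contour_int_adj:
  fixes F :: "complex \<Rightarrow> 'a::chilbert \<Rightarrow>\<^sub>L 'b::chilbert" and F' :: "complex \<Rightarrow> 'b \<Rightarrow>\<^sub>L 'a"
  assumes I: "has_contour_int g F I" and J: "has_contour_int (conj_contour g) F' J"
    and F: "\<And>t x y. t > 0 \<Longrightarrow> cinner (F' (cnj (g t)) y) x = cinner y (F (g t) x)"
  shows "adj I = J"
proof (rule adj_eqI)
  fix x y
  have lin: "bounded_linear (\<lambda>T::'a \<Rightarrow>\<^sub>L 'b. cinner (T x) y)"
    by (rule bounded_linear_compose[OF bounded_linear_cinner_left blinfun.bounded_linear_left])
  have "has_contour_int (conj_contour g) (\<lambda>z. cinner (F (cnj z) x) y) (cinner (I x) y)"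
    by (rule has_contour_int_conj_linear[OF I lin]) (simp add: cinner_simps scaleC_complex_def)
  then have 1: "has_contour_int (conj_contour g) (\<lambda>z. cinner x (F' z y)) (cinner (I x) y)"
  proof (rule has_contour_int_cong)
    fix t :: real assume "t > 0"
    from F[OF this, of y x] show "cinner (F (cnj (conj_contour g t)) x) y = cinner x (F' (conj_contour g t) y)"
      by (metis cinner_commute complex_cnj_cnj conj_contour_def)
  qed
  have lin': "bounded_linear (\<lambda>T::'b \<Rightarrow>\<^sub>L 'a. cinner x (T y))"
    by (rule bounded_linear_compose[OF bounded_linear_cinner_right blinfun.bounded_linear_left])
  have "has_contour_int (conj_contour g) (\<lambda>z. cinner x (F' z y)) (cinner x (J y))"
    by (rule has_contour_int_linear[OF J lin']) (simp add: cinner_simps scaleC_complex_def)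
  then have "cinner x (J y) = cinner (I x) y" using 1 by (rule has_contour_int_unique)
  then show "cinner (J y) x = cinner y (I x)" by (metis cinner_commute)
qed

lemma has_contour_int_compose_left:
  "has_contour_int g F I \<Longrightarrow> clinear_op T \<Longrightarrow> has_contour_int g (\<lambda>z. T o\<^sub>L F z) (T o\<^sub>L I)"
  by (rule has_contour_int_linear[where L = "\<lambda>S. T o\<^sub>L S"])
    (auto intro: blinfun_eqI simp: clinear_opD bounded_bilinear.bounded_linear_right[OF bounded_bilinear_blinfun_compose])

lemma has_contour_int_compose_right:
  "has_contour_int g F I \<Longrightarrow> has_contour_int g (\<lambda>z. F z o\<^sub>L T) (I o\<^sub>L T)"
  by (rule has_contour_int_linear[where L = "\<lambda>S. S o\<^sub>L T"])
    (auto intro: blinfun_eqI simp: bounded_bilinear.bounded_linear_left[OF bounded_bilinear_blinfun_compose])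

section \<open>Resolvents\<close>

text \<open>The sign convention is (Y - z)^(-1), so integrating once around the spectrum gives -2
  \<pi> i times the identity; hence the minus signs in the result.\<close>

definition resolvent :: "'a::complex_normed_vector \<Rightarrow>\<^sub>L 'a \<Rightarrow> complex \<Rightarrow> 'a \<Rightarrow>\<^sub>L 'a" where
  "resolvent Y z = inv_op (Y - z *\<^sub>C id_blinfun)"

lemma resolvent_inverse: "z \<notin> spectrum Y \<Longrightarrow> is_inverse_op (Y - z *\<^sub>C id_blinfun) (resolvent Y z)"
  unfolding resolvent_def by (rule not_in_spectrum)

lemma clinear_minus_scalar: "clinear_op Y \<Longrightarrow> clinear_op (Y - z *\<^sub>C id_blinfun)"
  by (intro clinear_diff clinear_scaleC clinear_id)

lemma clinear_resolvent: "clinear_op Y \<Longrightarrow> z \<notin> spectrum Y \<Longrightarrow> clinear_op (resolvent Y z)"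
  using is_inverse_clinear[OF resolvent_inverse clinear_minus_scalar] .

lemma resolvent_apply:
  assumes "z \<notin> spectrum Y"
  shows "Y (resolvent Y z x) = x + z *\<^sub>C resolvent Y z x"
    "resolvent Y z (Y x) = x + resolvent Y z (z *\<^sub>C x)"
  using is_inverse_op_apply(1)[OF resolvent_inverse[OF assms], of x]
    is_inverse_op_apply(2)[OF resolvent_inverse[OF assms], of x]
  by (simp_all add: blinfun.diff_left blinfun.diff_right algebra_simps)

lemma resolvent_identity:
  assumes Y: "clinear_op Y" and z: "z \<notin> spectrum Y" and w: "w \<notin> spectrum Y"
  shows "resolvent Y w - resolvent Y z = (w - z) *\<^sub>C (resolvent Y w o\<^sub>L resolvent Y z)"
proof (rule blinfun_eqI)
  fix x
  let ?u = "resolvent Y z x"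
  have "resolvent Y w (Y ?u) = ?u + w *\<^sub>C resolvent Y w ?u"
    using resolvent_apply(2)[OF w, of ?u] clinear_opD[OF clinear_resolvent[OF Y w]] by simp
  moreover have "resolvent Y w (Y ?u) = resolvent Y w x + z *\<^sub>C resolvent Y w ?u"
    using resolvent_apply(1)[OF z, of x] clinear_opD[OF clinear_resolvent[OF Y w]]
    by (simp add: blinfun.add_right)
  ultimately show "(resolvent Y w - resolvent Y z) x = ((w - z) *\<^sub>C (resolvent Y w o\<^sub>L resolvent Y z)) x"
    by (simp add: blinfun.diff_left scaleC.diff_left algebra_simps)
qed

lemma resolvent_near:
  fixes Y :: "'a::chilbert \<Rightarrow>\<^sub>L 'a"
  assumes Y: "clinear_op Y" and z: "z \<notin> spectrum Y"
  obtains r where "r > 0" "\<And>w. cmod (w - z) < r \<Longrightarrow> w \<notin> spectrum Y \<and> norm (resolvent Y w) \<le> 2 * norm (resolvent Y z)"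
proof
  let ?R = "resolvent Y z"
  \<comment> \<open>This makes |w - z| |R(z)| at most 1/2. The added 1 keeps the denominator nonzero
    even if the resolvent is 0, as on the zero space.\<close>
  define r where "r = 1 / (2 * (norm ?R + 1))"
  show r: "r > 0" unfolding r_def by (simp add: add_nonneg_pos)
  fix w assume w: "cmod (w - z) < r"
  have "norm ?R + 1 > 0" by (simp add: add_nonneg_pos)
  then have "r * (norm ?R + 1) = 1 / 2" by (simp add: r_def)
  moreover have "cmod (w - z) * norm ?R \<le> r * (norm ?R + 1)"
    using w r by (intro mult_mono) auto
  ultimately have small: "cmod (w - z) * norm ?R \<le> 1 / 2" by simp
  have "norm ((z - w) *\<^sub>C ?R) < 1" using small by (simp add: norm_scaleC norm_minus_commute)
  then obtain S where S: "is_inverse_op (id_blinfun + (z - w) *\<^sub>C ?R) S" using invertible_id_plus by blast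
  have "(Y - z *\<^sub>C id_blinfun) o\<^sub>L (id_blinfun + (z - w) *\<^sub>C ?R) = Y - w *\<^sub>C id_blinfun"
  proof (rule blinfun_eqI)
    fix x
    have "(Y - z *\<^sub>C id_blinfun) (x + (z - w) *\<^sub>C ?R x) = (Y - z *\<^sub>C id_blinfun) x + (z - w) *\<^sub>C x"
      by (simp only: blinfun.add_right clinear_opD[OF clinear_minus_scalar[OF Y]]
          is_inverse_op_apply(1)[OF resolvent_inverse[OF z]])
    then show "((Y - z *\<^sub>C id_blinfun) o\<^sub>L (id_blinfun + (z - w) *\<^sub>C ?R)) x = (Y - w *\<^sub>C id_blinfun) x"
      by (simp add: blinfun.add_left) (simp add: blinfun.diff_left scaleC.diff_left)
  qed
  then have "is_inverse_op (Y - w *\<^sub>C id_blinfun) (S o\<^sub>L ?R)"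
    using is_inverse_compose[OF resolvent_inverse[OF z] S] by simp
  then have wns: "w \<notin> spectrum Y" unfolding spectrum_def by blast
  have "resolvent Y w = ?R + (w - z) *\<^sub>C (resolvent Y w o\<^sub>L ?R)"
    using resolvent_identity[OF Y z wns] by (simp add: algebra_simps)
  then have "norm (resolvent Y w) \<le> norm ?R + cmod (w - z) * norm (resolvent Y w o\<^sub>L ?R)"
    by (metis norm_scaleC norm_triangle_ineq)
  also have "\<dots> \<le> norm ?R + cmod (w - z) * (norm (resolvent Y w) * norm ?R)"
    by (intro add_left_mono mult_left_mono norm_blinfun_compose) simp
  also have "cmod (w - z) * (norm (resolvent Y w) * norm ?R) \<le> 1 / 2 * norm (resolvent Y w)"
    using mult_right_mono[OF small norm_ge_zero[of "resolvent Y w"]] by (simp add: mult_ac)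
  finally show "w \<notin> spectrum Y \<and> norm (resolvent Y w) \<le> 2 * norm ?R" using wns by simp
qed

lemma open_resolvent_set: "clinear_op Y \<Longrightarrow> open (- spectrum (Y :: 'a::chilbert \<Rightarrow>\<^sub>L 'a))"
  unfolding open_dist dist_norm by (metis resolvent_near ComplD ComplI)

lemma resolvent_tendsto:
  fixes Y :: "'a::chilbert \<Rightarrow>\<^sub>L 'a"
  assumes Y: "clinear_op Y" and z: "z \<notin> spectrum Y"
  shows "(resolvent Y \<longlongrightarrow> resolvent Y z) (at z)"
proof -
  obtain r where r: "r > 0" "\<And>w. cmod (w - z) < r \<Longrightarrow> w \<notin> spectrum Y \<and> norm (resolvent Y w) \<le> 2 * norm (resolvent Y z)"
    using resolvent_near[OF Y z] by blast
  let ?N = "norm (resolvent Y z)"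
  have "((\<lambda>w. resolvent Y w - resolvent Y z) \<longlongrightarrow> 0) (at z)"
  proof (rule Lim_null_comparison)
    show "((\<lambda>w. cmod (w - z) * (2 * ?N * ?N)) \<longlongrightarrow> 0) (at z)" by (auto intro!: tendsto_eq_intros)
    show "\<forall>\<^sub>F w in at z. norm (resolvent Y w - resolvent Y z) \<le> cmod (w - z) * (2 * ?N * ?N)"
      unfolding eventually_at
    proof (intro exI[of _ r] conjI r(1) ballI impI)
      fix w assume "w \<noteq> z \<and> dist w z < r"
      then have "w \<notin> spectrum Y" "norm (resolvent Y w) \<le> 2 * ?N" using r(2) by (auto simp: dist_norm)
      then show "norm (resolvent Y w - resolvent Y z) \<le> cmod (w - z) * (2 * ?N * ?N)"
        unfolding resolvent_identity[OF Y z \<open>w \<notin> spectrum Y\<close>] norm_scaleC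
        by (intro mult_left_mono norm_blinfun_compose_le) auto
    qed
  qed
  then show ?thesis by (simp add: Lim_null[of "resolvent Y"])
qed

lemma continuous_on_resolvent:
  "clinear_op Y \<Longrightarrow> continuous_on (- spectrum (Y :: 'a::chilbert \<Rightarrow>\<^sub>L 'a)) (resolvent Y)"
  using resolvent_tendsto by (intro continuous_at_imp_continuous_on ballI) (simp add: isCont_def)

lemma resolvent_form_deriv:
  fixes Y :: "'a::chilbert \<Rightarrow>\<^sub>L 'a"
  assumes Y: "clinear_op Y" and z: "z \<notin> spectrum Y"
  shows "((\<lambda>z. cinner y (resolvent Y z x)) has_field_derivative cinner y (resolvent Y z (resolvent Y z x))) (at z)"
  unfolding has_field_derivative_iff
proof (rule Lim_transform_eventually)
  have "bounded_linear (\<lambda>T::'a \<Rightarrow>\<^sub>L 'a. cinner y (T (resolvent Y z x)))"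
    by (rule bounded_linear_compose[OF bounded_linear_cinner_right blinfun.bounded_linear_left])
  from bounded_linear.tendsto[OF this resolvent_tendsto[OF Y z]]
  show "((\<lambda>w. cinner y (resolvent Y w (resolvent Y z x))) \<longlongrightarrow> cinner y (resolvent Y z (resolvent Y z x))) (at z)" .
  have "open (- spectrum Y)" by (rule open_resolvent_set[OF Y])
  then have "eventually (\<lambda>w. w \<in> - spectrum Y) (at z)" using z by (intro eventually_at_in_open') auto
  moreover have "eventually (\<lambda>w. w \<noteq> z) (at z)" by (rule eventually_neq_at_within)
  ultimately show "\<forall>\<^sub>F w in at z. cinner y (resolvent Y w (resolvent Y z x)) =
      (cinner y (resolvent Y w x) - cinner y (resolvent Y z x)) / (w - z)"
  proof eventually_elim
    fix w assume w: "w \<in> - spectrum Y" "w \<noteq> z"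
    then have "w \<notin> spectrum Y" by simp
    from arg_cong[OF resolvent_identity[OF Y z this], of "\<lambda>T. cinner y (blinfun_apply T x)"]
    show "cinner y (resolvent Y w (resolvent Y z x)) =
      (cinner y (resolvent Y w x) - cinner y (resolvent Y z x)) / (w - z)"
      using w(2) by (simp add: blinfun.diff_left cinner_diff_right cinner_scaleC_right)
  qed
qed

lemma resolvent_large:
  fixes Y :: "'a::chilbert \<Rightarrow>\<^sub>L 'a"
  assumes z: "norm Y < cmod z"
  shows "z \<notin> spectrum Y" "norm (resolvent Y z) \<le> 1 / (cmod z - norm Y)"
proof -
  have z0: "z \<noteq> 0" using z norm_ge_zero[of Y] by auto
  have "norm (- inverse z *\<^sub>C Y) = norm Y / cmod z"
    by (simp add: norm_scaleC norm_inverse divide_inverse mult.commute)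
  then have "norm (- inverse z *\<^sub>C Y) < 1" using z z0 by simp
  then obtain S where S: "is_inverse_op (id_blinfun + - inverse z *\<^sub>C Y) S" using invertible_id_plus by blast
  define T where "T = - z *\<^sub>C (id_blinfun :: 'a \<Rightarrow>\<^sub>L 'a)"
  have T: "is_inverse_op T (- inverse z *\<^sub>C id_blinfun)"
    using z0 unfolding T_def by (intro is_inverse_opI) (simp_all add: blinfun.minus_left scaleC_scaleC)
  have "T o\<^sub>L (id_blinfun + - inverse z *\<^sub>C Y) = Y - z *\<^sub>C id_blinfun"
    using z0 unfolding T_def
    by (intro blinfun_eqI) (simp add: blinfun.add_left blinfun.diff_left blinfun.minus_left scaleC.diff_right scaleC_scaleC)
  then have "is_inverse_op (Y - z *\<^sub>C id_blinfun) (S o\<^sub>L (- inverse z *\<^sub>C id_blinfun))"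
    using is_inverse_compose[OF T S] by simp
  then show zs: "z \<notin> spectrum Y" unfolding spectrum_def by blast
  show "norm (resolvent Y z) \<le> 1 / (cmod z - norm Y)"
  proof (rule is_inverse_norm_le[OF resolvent_inverse[OF zs]])
    fix x
    have "cmod z * norm x - norm Y * norm x \<le> norm (z *\<^sub>C x) - norm (Y x)"
      using norm_blinfun[of Y x] by (simp add: norm_scaleC)
    also have "\<dots> \<le> norm ((Y - z *\<^sub>C id_blinfun) x)"
      using norm_triangle_ineq2[of "z *\<^sub>C x" "Y x"] by (simp add: blinfun.diff_left norm_minus_commute)
    finally show "(cmod z - norm Y) * norm x \<le> norm ((Y - z *\<^sub>C id_blinfun) x)"
      by (simp add: algebra_simps)
  qed (use z in simp)
qed

lemma field_differentiable_sum_list: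
  fixes f :: "'b \<Rightarrow> complex \<Rightarrow> complex"
  shows "(\<And>c. c \<in> set cs \<Longrightarrow> f c field_differentiable (at z)) \<Longrightarrow> (\<lambda>z. \<Sum>c\<leftarrow>cs. f c z) field_differentiable (at z)"
  by (induction cs) (auto intro: field_differentiable_add)

lemma field_differentiable_transform_within_open:
  "f field_differentiable (at z) \<Longrightarrow> open S \<Longrightarrow> z \<in> S \<Longrightarrow> (\<And>w. w \<in> S \<Longrightarrow> f w = g w)
    \<Longrightarrow> g field_differentiable (at z)"
  unfolding field_differentiable_def by (blast intro: has_field_derivative_transform_within_open)

lemma resolvent_loop_integral_exists:
  fixes Y :: "'a::chilbert \<Rightarrow>\<^sub>L 'a"
  assumes Y: "clinear_op Y" and c: "rectifiable_loop c" "path_image c \<inter> spectrum Y = {}"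
  shows "has_curve_integral (resolvent Y) (curve_integral (resolvent Y) c 0 1) c 0 1"
proof -
  obtain V where V: "var_bound V c 0 1" using rectifiable_var_bound c(1) unfolding rectifiable_loop_def by blast
  have "continuous_on {0..1} (\<lambda>t. resolvent Y (c t))"
    using c by (intro continuous_on_compose2[OF continuous_on_resolvent[OF Y]])
      (auto simp: rectifiable_loop_def path_def path_image_def)
  from has_curve_integral_exists[OF zero_le_one V this] show ?thesis using curve_integral_eq by metis
qed

text \<open>Dixon's argument for the resolvent, where the difference quotient of \<open>R\<close> factorises as
  \<open>R(w)R(z)\<close>: off the spectrum put \<open>E(z) = R(z)(\<integral>R(w)dw + 2\<pi>i)\<close>, and near the spectrum
  \<open>E(z) = \<integral>R(w)/(w-z)dw\<close>. The two agree where the total winding number is \<open>1\<close>, so \<open>E\<close> is entire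
  and vanishes at infinity.\<close>

lemma resolvent_cycle_integral:
  fixes Y :: "'a::chilbert \<Rightarrow>\<^sub>L 'a"
  assumes Y: "clinear_op Y" and \<gamma>: "goes_around \<gamma> (spectrum Y) U"
  shows "(\<Sum>c\<leftarrow>\<gamma>. curve_integral (resolvent Y) c 0 1 x) = - (2 * of_real pi * \<i>) *\<^sub>C x"
proof -
  have loop: "rectifiable_loop c" and im: "path_image c \<inter> spectrum Y = {}" if "c \<in> set \<gamma>" for c
    using \<gamma> that unfolding goes_around_def by blast+
  have path: "path c" "pathfinish c = pathstart c" if "c \<in> set \<gamma>" for c
    using loop[OF that] by (auto simp: rectifiable_loop_def)
  have vb: "\<exists>V. var_bound V c 0 1" if "c \<in> set \<gamma>" for c
    using rectifiable_var_bound loop[OF that] unfolding rectifiable_loop_def by blast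
  define J where "J c = curve_integral (resolvent Y) c 0 1" for c
  have J: "has_curve_integral (resolvent Y) (J c) c 0 1" if "c \<in> set \<gamma>" for c
    unfolding J_def by (rule resolvent_loop_integral_exists[OF Y loop[OF that] im[OF that]])
  \<comment> \<open>The defect of the claimed formula. Showing that its image under a resolvent is 0
    is enough, since resolvents are injective.\<close>
  define v where "v = (\<Sum>c\<leftarrow>\<gamma>. J c x) + (2 * of_real pi * \<i>) *\<^sub>C x"
  have zero: "cinner y (resolvent Y z v) = 0" if z: "z \<notin> spectrum Y" for y z
  proof -
    define u where "u w = cinner y (resolvent Y w x)" for w
    define T where "T c z = curve_integral (\<lambda>w. u w / (w - z)) c 0 1" for c z
    define E where "E z = (if z \<in> spectrum Y then \<Sum>c\<leftarrow>\<gamma>. T c z else cinner y (resolvent Y z v))" for z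
    have agree: "cinner y (resolvent Y z v) = (\<Sum>c\<leftarrow>\<gamma>. T c z)"
      if z: "z \<notin> spectrum Y" "\<And>c. c \<in> set \<gamma> \<Longrightarrow> z \<notin> path_image c" "(\<Sum>c\<leftarrow>\<gamma>. winding_number c z) = 1" for z
    proof -
      have T: "T c z = cinner y (resolvent Y z (J c x)) + u z * (2 * of_real pi * \<i> * winding_number c z)"
        if c: "c \<in> set \<gamma>" for c
      proof -
        obtain V where V: "var_bound V c 0 1" using vb[OF c] by blast
        have lin: "bounded_linear (\<lambda>S::'a \<Rightarrow>\<^sub>L 'a. cinner y (resolvent Y z (S x)))"
          by (rule bounded_linear_compose[OF bounded_linear_compose[OF bounded_linear_cinner_right
                blinfun.bounded_linear_right] blinfun.bounded_linear_left])
        \<comment> \<open>By the resolvent identity u(w)/(w - z) = \<langle>y, R(z) R(w) x\<rangle>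
          + u(z)/(w - z): the first term integrates through \<open>J c\<close>, the second gives the
          winding number.\<close>
        have "has_curve_integral (\<lambda>w. cinner y (resolvent Y z (resolvent Y w x))) (cinner y (resolvent Y z (J c x))) c 0 1"
          by (rule has_curve_integral_linear[OF J[OF c] lin])
            (simp add: clinear_opD[OF clinear_resolvent[OF Y z(1)]] cinner_simps scaleC_complex_def)
        from has_curve_integral_add[OF this has_curve_integral_scaleC[OF
            has_curve_integral_winding_number[OF path(1)[OF c] z(2)[OF c] V], of "u z"]]
        have "has_curve_integral (\<lambda>w. u w / (w - z))
            (cinner y (resolvent Y z (J c x)) + u z * (2 * of_real pi * \<i> * winding_number c z)) c 0 1"
          unfolding scaleC_complex_def
        proof (rule has_curve_integral_cong)
          fix t :: real assume "t \<in> {0..1}"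
          then have ct: "c t \<in> path_image c" by (auto simp: path_image_def)
          then have ns: "c t \<notin> spectrum Y" and ne: "c t \<noteq> z" using im[OF c] z(2)[OF c] by auto
          from arg_cong[OF resolvent_identity[OF Y ns z(1)], of "\<lambda>S. cinner y (blinfun_apply S x)"]
          have "u z - u (c t) = (z - c t) * cinner y (resolvent Y z (resolvent Y (c t) x))"
            by (simp add: u_def blinfun.diff_left cinner_simps)
          then show "cinner y (resolvent Y z (resolvent Y (c t) x)) + u z * (1 / (c t - z)) = u (c t) / (c t - z)"
            using ne by (simp add: field_simps)
        qed
        then show ?thesis unfolding T_def by (rule curve_integral_eq)
      qed
      have "(\<Sum>c\<leftarrow>\<gamma>. T c z) = (\<Sum>c\<leftarrow>\<gamma>. cinner y (resolvent Y z (J c x)) + (u z * (2 * of_real pi * \<i>)) * winding_number c z)"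
        by (intro arg_cong[of _ _ sum_list] map_cong refl) (simp add: T mult.assoc)
      also have "\<dots> = (\<Sum>c\<leftarrow>\<gamma>. cinner y (resolvent Y z (J c x))) + (u z * (2 * of_real pi * \<i>)) * (\<Sum>c\<leftarrow>\<gamma>. winding_number c z)"
        by (simp add: sum_list_addf sum_list_const_mult)
      also have "(\<Sum>c\<leftarrow>\<gamma>. cinner y (resolvent Y z (J c x))) = cinner y (resolvent Y z (\<Sum>c\<leftarrow>\<gamma>. J c x))"
        by (induction \<gamma>) (simp_all add: cinner_simps blinfun.add_right)
      finally show ?thesis
        by (simp add: z(3) v_def blinfun.add_right cinner_simps clinear_opD[OF clinear_resolvent[OF Y z(1)]] u_def)
    qed
    have "E field_differentiable (at z)" for z
    proof (cases "z \<in> spectrum Y")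
      case False
      have "(\<lambda>z. cinner y (resolvent Y z v)) field_differentiable (at z)"
        using resolvent_form_deriv[OF Y False] unfolding field_differentiable_def by blast
      then show ?thesis
        by (rule field_differentiable_transform_within_open[OF _ open_resolvent_set[OF Y]])
          (use False in \<open>auto simp: E_def\<close>)
    next
      case True
      \<comment> \<open>Near a spectral point no winding number changes, so the total remains 1
        there also off the spectrum, and both formulas for \<open>E\<close> agree on
        \<open>W\<close>.\<close>
      define W where "W = (\<Inter>c\<in>set \<gamma>. {w. w \<notin> path_image c \<and> winding_number c w = winding_number c z})"
      have zW: "z \<in> W" using True im by (auto simp: W_def)
      have "open W" unfolding W_def
        by (intro open_INT finite_set ballI open_winding_number_levelsets path)
      have W: "E w = (\<Sum>c\<leftarrow>\<gamma>. T c w)" if w: "w \<in> W" for w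
      proof (cases "w \<in> spectrum Y")
        case False
        have "(\<Sum>c\<leftarrow>\<gamma>. winding_number c w) = (\<Sum>c\<leftarrow>\<gamma>. winding_number c z)"
          using w by (intro arg_cong[of _ _ sum_list] map_cong refl) (auto simp: W_def)
        also have "\<dots> = 1" using \<gamma> True by (auto simp: goes_around_def)
        finally show ?thesis using False w by (simp add: E_def W_def agree)
      qed (simp add: E_def)
      have "T c field_differentiable (at z)" if c: "c \<in> set \<gamma>" for c
      proof -
        obtain V where V: "var_bound V c 0 1" using vb[OF c] by blast
        have "continuous_on (- spectrum Y) u"
          unfolding u_def
          by (rule continuous_at_imp_continuous_on)
            (auto intro: DERIV_isCont[OF resolvent_form_deriv[OF Y]])
        then have "continuous_on (path_image c) u"
          by (rule continuous_on_subset) (use im[OF c] in blast)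
        from loop_cauchy_transform_differentiable[OF path(1)[OF c] V this, of z]
        show ?thesis using True im[OF c] unfolding T_def by blast
      qed
      then have "(\<lambda>z. \<Sum>c\<leftarrow>\<gamma>. T c z) field_differentiable (at z)"
        by (rule field_differentiable_sum_list)
      then show ?thesis
        by (rule field_differentiable_transform_within_open[OF _ \<open>open W\<close> zW]) (simp add: W)
    qed
    then have "E holomorphic_on UNIV" by (simp add: holomorphic_on_def)
    moreover have "(E \<longlongrightarrow> 0) at_infinity"
    proof (rule Lim_null_comparison)
      have "((\<lambda>z. 1 / (cmod z - norm Y)) \<longlongrightarrow> 0) at_infinity"
        by (rule tendsto_divide_0[OF tendsto_const] filterlim_at_top_imp_at_infinity
            filterlim_tendsto_add_at_top[OF tendsto_const filterlim_norm_at_top, of "- norm Y", simplified] | simp)+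
      then have "((\<lambda>z. norm y * (1 / (cmod z - norm Y) * norm v)) \<longlongrightarrow> norm y * (0 * norm v)) at_infinity"
        by (intro tendsto_intros)
      then show "((\<lambda>z. norm y * (1 / (cmod z - norm Y) * norm v)) \<longlongrightarrow> 0) at_infinity" by simp
      have "eventually (\<lambda>z::complex. norm Y < norm z) at_infinity"
        unfolding eventually_at_infinity by (intro exI[of _ "norm Y + 1"]) auto
      then show "\<forall>\<^sub>F z in at_infinity. norm (E z) \<le> norm y * (1 / (cmod z - norm Y) * norm v)"
      proof eventually_elim
        fix z :: complex assume z: "norm Y < norm z"
        have "norm (E z) \<le> norm y * norm (resolvent Y z v)"
          using resolvent_large(1)[OF z] by (simp add: E_def cinner_Cauchy_Schwarz)
        also have "norm (resolvent Y z v) \<le> norm (resolvent Y z) * norm v" by (rule norm_blinfun)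
        also have "\<dots> \<le> 1 / (cmod z - norm Y) * norm v"
          by (intro mult_right_mono resolvent_large(2)[OF z]) simp
        finally show "norm (E z) \<le> norm y * (1 / (cmod z - norm Y) * norm v)"
          by (simp add: mult_left_mono)
      qed
    qed
    ultimately have "E z = 0" by (rule Liouville_weak_0)
    then show ?thesis using z by (simp add: E_def)
  qed
  define z where "z = complex_of_real (norm Y + 1)"
  have z: "z \<notin> spectrum Y" by (rule resolvent_large(1)) (simp add: z_def del: of_real_add)
  have "resolvent Y z v = 0" using zero[OF z] by (intro cinner_ext) simp
  then have "v = 0" using is_inverse_op_apply(1)[OF resolvent_inverse[OF z], of v] by simp
  then show ?thesis unfolding v_def J_def by (simp add: eq_neg_iff_add_eq_0)
qed

lemma continuous_on_blinfun_compose: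
  "continuous_on S F \<Longrightarrow> continuous_on S G \<Longrightarrow> continuous_on S (\<lambda>t. F t o\<^sub>L G t)"
  by (rule bounded_bilinear.continuous_on[OF bounded_bilinear_blinfun_compose])

section \<open>The contour and the basic equation\<close>

text \<open>The assumptions are symmetric under conjugation: \<open>conj_contour g\<close> gives
  another instance, from which everything about \<open>H'\<close> and the other \<Omega> is
  obtained. \<open>arc_length\<close> says that \<open>g\<close> is 1-Lipschitz.\<close>

locale kb_contour =
  fixes A :: "'h::chilbert \<Rightarrow>\<^sub>L 'h" and K :: "complex \<Rightarrow> 'h \<Rightarrow>\<^sub>L 'h" and g :: "real \<Rightarrow> complex"
  assumes selfadjoint: "selfadjoint_op A"
    and real_spectrum: "spectrum A \<subseteq> \<real>"
    and arc_length: "\<And>b. var_bound (\<lambda>t. t) g 0 b"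
    and K_cont: "continuous_on {0<..} (\<lambda>t. K (g t))"
    and K_clinear: "\<And>t. t > 0 \<Longrightarrow> clinear_op (K (g t))"
    and K_bounded: "K_B_bounded K g"
    and d_pos: "0 < d0 A g"
    and Var_less: "Var_A A K g < 1"
    and Var_small: "Var_A A K g * norm A < 1/4 * d0 A g * (1 - Var_A A K g)\<^sup>2"
    and K_adj: "\<And>t. t > 0 \<Longrightarrow> K (cnj (g t)) = adj (K (g t))"
begin

abbreviation "d \<equiv> d0 A g"
abbreviation "v \<equiv> Var_A A K g"
abbreviation "\<delta> t \<equiv> infdist (g t) (spectrum A)"

lemma clinear_A: "clinear_op A" using selfadjoint by (simp add: selfadjoint_op_def)

lemma spectrum_nonempty: "spectrum A \<noteq> {}"
  using d_pos unfolding d0_def by (auto simp: setdist_def)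

lemma d_le: "0 \<le> t \<Longrightarrow> d \<le> \<delta> t"
  unfolding infdist_notempty[OF spectrum_nonempty]
  by (rule cINF_greatest[OF spectrum_nonempty])
    (auto simp: d0_def dist_commute[of "g t"] intro!: setdist_le_dist)

lemma \<delta>_pos: "0 \<le> t \<Longrightarrow> 0 < \<delta> t" using d_le d_pos by (meson less_le_trans)

text \<open>The spectrum lies in the disc of radius \<open>norm A\<close>. This is the source of the
  factor \<open>d + norm A\<close> in \<kappa>.\<close>

lemma cmod_le: "cmod \<mu> \<le> infdist \<mu> (spectrum A) + norm A"
proof -
  have "cmod \<mu> - norm A \<le> dist \<mu> s" if "s \<in> spectrum A" for s
  proof -
    have "cmod s \<le> norm A" using resolvent_large(1)[of A s] that by force
    then show ?thesis using norm_triangle_ineq2[of \<mu> s] by (simp add: dist_norm)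
  qed
  then have "cmod \<mu> - norm A \<le> infdist \<mu> (spectrum A)"
    unfolding infdist_notempty[OF spectrum_nonempty] by (intro cINF_greatest spectrum_nonempty)
  then show ?thesis by simp
qed

lemma g_cont: "continuous_on {0..} g"
proof -
  have "dist (g s) (g t) \<le> 1 * dist s t" if "s \<in> {0..}" "t \<in> {0..}" for s t
    using var_boundD[OF arc_length[of "max s t"], of "min s t" "max s t"] that
    by (cases "s \<le> t") (auto simp: dist_norm norm_minus_commute)
  then have "1-lipschitz_on {0..} g" by (intro lipschitz_onI) auto
  then show ?thesis by (rule lipschitz_on_continuous_on)
qed

lemma g_cont': "continuous_on {0<..} g"
  by (rule continuous_on_subset[OF g_cont]) auto

text \<open>Passing from the weight 1 / (1 + |\<mu>|) to 1 / dist multiplies by \<open>h\<close>,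
  which is continuous and, by \<open>cmod_le\<close> and \<open>d_le\<close>, bounded; an absolutely
  integrable function stays integrable under such a factor.\<close>

lemma weight_integrable: "(\<lambda>t. norm (K (g t)) / \<delta> t) integrable_on {0..}"
proof -
  define h where "h t = (1 + cmod (g t)) / \<delta> t" for t
  have ne: "\<delta> t \<noteq> 0" if "t \<in> {0..}" for t using \<delta>_pos[of t] that by auto
  have "continuous_on {0..} h"
    unfolding h_def using ne by (intro continuous_intros g_cont) auto
  then have "h \<in> borel_measurable (lebesgue_on {0..})"
    by (rule continuous_imp_measurable_on_sets_lebesgue) simp
  moreover have "norm (h t) \<le> 1 + (1 + norm A) / d" if "t \<in> {0..}" for t
  proof -
    have t: "0 < \<delta> t" "d \<le> \<delta> t" using \<delta>_pos d_le that by auto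
    have "h t \<le> (\<delta> t + (1 + norm A)) / \<delta> t"
      unfolding h_def using cmod_le[of "g t"] t by (intro divide_right_mono) auto
    also have "\<dots> = 1 + (1 + norm A) / \<delta> t" using t by (simp add: field_simps)
    also have "\<dots> \<le> 1 + (1 + norm A) / d"
      using t d_pos by (intro add_left_mono divide_left_mono mult_pos_pos) auto
    finally show ?thesis using t by (simp add: h_def)
  qed
  then have "bounded (h ` {0..})" unfolding bounded_iff by blast
  moreover have "(\<lambda>t. norm (K (g t)) / (1 + cmod (g t))) absolutely_integrable_on {0..}"
    using K_bounded unfolding K_B_bounded_def
    by (intro nonnegative_absolutely_integrable_1) (auto intro: add_nonneg_nonneg)
  ultimately have "(\<lambda>t. h t * (norm (K (g t)) / (1 + cmod (g t)))) absolutely_integrable_on {0..}"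
    by (intro absolutely_integrable_bounded_measurable_product_real) auto
  then have "(\<lambda>t. h t * (norm (K (g t)) / (1 + cmod (g t)))) integrable_on {0..}"
    by (rule set_lebesgue_integral_eq_integral(1))
  moreover have "h t * (norm (K (g t)) / (1 + cmod (g t))) = norm (K (g t)) / \<delta> t" for t
  proof -
    have "1 + cmod (g t) \<noteq> 0" using norm_ge_zero[of "g t"] by linarith
    then show ?thesis by (simp add: h_def)
  qed
  ultimately show ?thesis by simp
qed

lemma weight_nonneg: "0 \<le> norm (K (g t)) / \<delta> t"
  by (simp add: infdist_nonneg)

lemma v_nonneg: "0 \<le> v"
  unfolding Var_A_def by (rule integral_nonneg[OF weight_integrable]) (simp add: infdist_nonneg)

lemma contour_int_exists:
  fixes F :: "complex \<Rightarrow> 'h \<Rightarrow>\<^sub>L 'h"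
  assumes cont: "continuous_on {0<..} (\<lambda>t. F (g t))" and c: "0 \<le> c"
    and le: "\<And>t. t > 0 \<Longrightarrow> norm (F (g t)) \<le> c * (norm (K (g t)) / \<delta> t)"
  shows "\<exists>I. has_contour_int g F I \<and> norm I \<le> c * v"
proof -
  have "\<exists>I. has_contour_int g F I \<and> norm I \<le> integral {0..} (\<lambda>t. c * (norm (K (g t)) / \<delta> t))"
    by (intro has_contour_int_exists arc_length cont le integrable_on_mult_right weight_integrable)
      (assumption, rule mult_nonneg_nonneg[OF c weight_nonneg])
  then show ?thesis unfolding Var_A_def integral_mult_right .
qed

text \<open>\<open>\<rho>\<close> is the radius in the definition of \<open>\<O>\<close>, and \<open>\<rho>1\<close> lies halfway between \<open>\<rho>\<close> and the largest
  radius for which \<open>\<kappa> v < 1\<close>. This leaves room for an open neighbourhood of \<open>\<O>\<close>.\<close>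

definition "\<rho> = d * (1 - v) / 2"
definition "\<rho>1 = d - (sqrt (v * d * (d + norm A)) + (d - \<rho>)) / 2"
definition "\<kappa> = d * (d + norm A) / (d - \<rho>1)\<^sup>2"

lemma \<rho>_pos: "0 < \<rho>" unfolding \<rho>_def using d_pos Var_less by simp

text \<open>Here d - \<rho> = d (1 + v) / 2, and v d^2 + d^2 (1 - v)^2 / 4 = (d - \<rho>)^2. So
  \<open>Var_small\<close> says precisely that v d (d + |A|) < (d - \<rho>)^2.\<close>

lemma sqrt_less: "sqrt (v * d * (d + norm A)) < d - \<rho>"
proof (rule real_less_lsqrt)
  show "0 \<le> d - \<rho>" using d_pos v_nonneg by (simp add: \<rho>_def field_simps)
  have "v * d * (d + norm A) = v * d\<^sup>2 + d * (v * norm A)" by (simp add: algebra_simps power2_eq_square)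
  also have "\<dots> < v * d\<^sup>2 + d * (1/4 * d * (1 - v)\<^sup>2)"
    using Var_small d_pos by simp
  also have "\<dots> = (d - \<rho>)\<^sup>2" by (simp add: \<rho>_def power2_eq_square field_simps)
  finally show "v * d * (d + norm A) < (d - \<rho>)\<^sup>2" .
qed

lemma \<rho>1_bounds: "\<rho> < \<rho>1" "\<rho>1 < d" "v * d * (d + norm A) < (d - \<rho>1)\<^sup>2"
proof -
  have s: "0 \<le> sqrt (v * d * (d + norm A))" using d_pos v_nonneg by simp
  define S where "S = sqrt (v * d * (d + norm A))"
  have S: "0 \<le> S" "S < d - \<rho>" using s sqrt_less by (simp_all only: S_def)
  have \<rho>1: "\<rho>1 = d - (S + (d - \<rho>)) / 2" by (simp only: \<rho>1_def S_def)
  have gap: "2 * (d - \<rho>1) = S + (d - \<rho>)" by (simp add: \<rho>1)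
  show "\<rho> < \<rho>1" "\<rho>1 < d" using S gap by simp_all
  have "S < d - \<rho>1" using S gap by simp
  then have "S\<^sup>2 < (d - \<rho>1)\<^sup>2" using S by (intro power_strict_mono) auto
  moreover have "S\<^sup>2 = v * d * (d + norm A)" unfolding S_def using d_pos v_nonneg by simp
  ultimately show "v * d * (d + norm A) < (d - \<rho>1)\<^sup>2" by simp
qed

lemma \<rho>1_pos: "0 < \<rho>1" using \<rho>_pos \<rho>1_bounds by linarith

lemma \<kappa>_nonneg: "0 \<le> \<kappa>" unfolding \<kappa>_def using d_pos by simp

lemma \<kappa>_less: "\<kappa> * v < 1"
  unfolding \<kappa>_def using \<rho>1_bounds by (simp add: field_simps)

lemma \<delta>_minus_pos: "0 \<le> t \<Longrightarrow> a \<le> \<rho>1 \<Longrightarrow> 0 < \<delta> t - a"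
  using d_le[of t] \<rho>1_bounds(2) by linarith

lemma inverse_\<delta>_minus_le:
  assumes "0 \<le> t" "a \<le> \<rho>1"
  shows "1 / (\<delta> t - a) \<le> d / (d - \<rho>1) / \<delta> t"
proof -
  have \<delta>: "0 < \<delta> t" "d \<le> \<delta> t" "0 < \<delta> t - a" "0 < d - \<rho>1"
    using assms \<delta>_pos d_le \<delta>_minus_pos \<rho>1_bounds by auto
  have "\<delta> t * (d - \<rho>1) \<le> d * (\<delta> t - \<rho>1)"
    using mult_right_mono[OF \<delta>(2), of \<rho>1] \<rho>1_pos by (simp add: algebra_simps)
  also have "\<dots> \<le> d * (\<delta> t - a)" using assms d_pos by simp
  finally show ?thesis using \<delta> by (simp add: field_simps)
qed

text \<open>Since dist \<ge> d, both |\<mu>| \<le> dist (d + |A|) / d and 1 / (dist - a) \<le> d /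
  ((d - \<rho>1) dist) hold. Their product has constant \<kappa> and retains one factor 1 / dist,
  the weight in \<open>Var_A\<close>.\<close>

lemma kernel_bound:
  assumes "0 \<le> t" "a \<le> \<rho>1" "b \<le> \<rho>1"
  shows "cmod (g t) * (1 / (\<delta> t - a)) * (1 / (\<delta> t - b)) \<le> \<kappa> / \<delta> t"
proof -
  have \<delta>: "0 < \<delta> t" "d \<le> \<delta> t" "0 < d - \<rho>1" "0 < \<delta> t - a" "0 < \<delta> t - b"
    using assms \<delta>_pos d_le \<delta>_minus_pos \<rho>1_bounds by auto
  have "norm A * d \<le> norm A * \<delta> t" using \<delta> by (intro mult_left_mono) auto
  then have "\<delta> t + norm A \<le> \<delta> t * ((d + norm A) / d)" using d_pos by (simp add: field_simps)
  then have "cmod (g t) \<le> \<delta> t * ((d + norm A) / d)" using cmod_le[of "g t"] by linarith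
  then have "cmod (g t) * (1 / (\<delta> t - a)) * (1 / (\<delta> t - b))
      \<le> \<delta> t * ((d + norm A) / d) * (d / (d - \<rho>1) / \<delta> t) * (d / (d - \<rho>1) / \<delta> t)"
    using \<delta> d_pos by (intro mult_mono inverse_\<delta>_minus_le assms) auto
  also have "\<dots> = \<kappa> / \<delta> t"
    unfolding \<kappa>_def using \<delta> d_pos by (simp add: power2_eq_square mult_ac)
  finally show ?thesis .
qed

section \<open>The basic equation as a fixed-point problem\<close>

lemma perturbed_resolvent:
  assumes "norm (Y - A) \<le> a" "a < infdist z (spectrum A)"
  shows "z \<notin> spectrum Y" "norm (resolvent Y z) \<le> 1 / (infdist z (spectrum A) - a)"
proof -
  note R = selfadjoint_perturbed_resolvent[OF selfadjoint real_spectrum assms]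
  show "z \<notin> spectrum Y" using R(1) unfolding spectrum_def by blast
  show "norm (resolvent Y z) \<le> 1 / (infdist z (spectrum A) - a)" using R(2) unfolding resolvent_def .
qed

lemma resolvent_g:
  assumes "norm (Y - A) \<le> a" "a \<le> \<rho>1" "0 \<le> t"
  shows "g t \<notin> spectrum Y" "norm (resolvent Y (g t)) \<le> 1 / (\<delta> t - a)"
  using perturbed_resolvent[OF assms(1), of "g t"] \<delta>_minus_pos[OF assms(3,2)] by auto

lemma resolvent_g_cont:
  assumes "clinear_op Y" "norm (Y - A) \<le> a" "a \<le> \<rho>1"
  shows "continuous_on {0<..} (\<lambda>t. resolvent Y (g t))"
  by (rule continuous_on_compose2[OF continuous_on_resolvent[OF assms(1)] g_cont'])
    (use resolvent_g(1)[OF assms(2,3)] in auto)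

lemma norm_le_of_ball: "norm (Y - A) \<le> a \<Longrightarrow> norm Y \<le> norm A + a"
  using norm_triangle_ineq2[of Y A] by linarith

text \<open>The constant is kept sharp in \<open>a\<close>: at \<open>a = r\<close> the bound equals
  \<open>r\<close>, so the ball is mapped into itself.\<close>

lemma V1_integral:
  assumes Y: "clinear_op Y" "norm (Y - A) \<le> a" "a \<le> \<rho>1"
  shows "\<exists>I. has_contour_int g (\<lambda>\<mu>. K \<mu> o\<^sub>L Y o\<^sub>L resolvent Y \<mu>) I \<and> norm I \<le> (norm A + a) * d / (d - a) * v"
proof (rule contour_int_exists)
  have a0: "0 \<le> a" using Y(2) norm_ge_zero order_trans by blast
  have da: "0 < d - a" using Y(3) \<rho>1_bounds by simp
  show "continuous_on {0<..} (\<lambda>t. K (g t) o\<^sub>L Y o\<^sub>L resolvent Y (g t))"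
    by (intro continuous_on_blinfun_compose K_cont continuous_on_const resolvent_g_cont[OF Y])
  show "0 \<le> (norm A + a) * d / (d - a)" using a0 d_pos da by simp
  fix t :: real assume t: "0 < t"
  have \<delta>: "0 < \<delta> t" "d \<le> \<delta> t" "0 < \<delta> t - a" using t \<delta>_pos d_le \<delta>_minus_pos Y(3) by auto
  have "\<delta> t * (d - a) \<le> d * (\<delta> t - a)"
    using mult_right_mono[OF \<delta>(2) a0] by (simp add: algebra_simps)
  then have *: "1 / (\<delta> t - a) \<le> d / (d - a) / \<delta> t" using \<delta> da by (simp add: field_simps)
  have "norm (K (g t) o\<^sub>L Y o\<^sub>L resolvent Y (g t)) \<le> norm (K (g t)) * (norm A + a) * (1 / (\<delta> t - a))"
    using t by (intro norm_blinfun_compose_le norm_le_of_ball Y order_refl resolvent_g(2)) auto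
  also have "\<dots> \<le> norm (K (g t)) * (norm A + a) * (d / (d - a) / \<delta> t)"
    using a0 by (intro mult_left_mono *) auto
  also have "\<dots> = (norm A + a) * d / (d - a) * (norm (K (g t)) / \<delta> t)" by simp
  finally show "norm (K (g t) o\<^sub>L Y o\<^sub>L resolvent Y (g t)) \<le> (norm A + a) * d / (d - a) * (norm (K (g t)) / \<delta> t)" .
qed

lemma V1_eq: "has_contour_int g (\<lambda>\<mu>. K \<mu> o\<^sub>L Y o\<^sub>L resolvent Y \<mu>) I \<Longrightarrow> V1 K Y g = I"
  unfolding V1_def resolvent_def by (rule contour_int_eq)

text \<open>From Y R_Y = 1 + \<mu> R_Y the integrands differ by \<mu> K (R_Y - R_Z) = \<mu> K R_Y (Z
  - Y) R_Z, to which the kernel bound applies.\<close>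

lemma V1_contraction:
  assumes Y: "clinear_op Y" "norm (Y - A) \<le> a" and Z: "clinear_op Z" "norm (Z - A) \<le> a" and a: "a \<le> \<rho>1"
  shows "norm (V1 K Y g - V1 K Z g) \<le> \<kappa> * v * norm (Y - Z)"
proof -
  obtain I where I: "has_contour_int g (\<lambda>\<mu>. K \<mu> o\<^sub>L Y o\<^sub>L resolvent Y \<mu>) I" using V1_integral[OF Y a] by blast
  obtain J where J: "has_contour_int g (\<lambda>\<mu>. K \<mu> o\<^sub>L Z o\<^sub>L resolvent Z \<mu>) J" using V1_integral[OF Z a] by blast
  have diff: "(K (g t) o\<^sub>L Y o\<^sub>L resolvent Y (g t)) - (K (g t) o\<^sub>L Z o\<^sub>L resolvent Z (g t))
      = g t *\<^sub>C (K (g t) o\<^sub>L (resolvent Y (g t) o\<^sub>L (Z - Y) o\<^sub>L resolvent Z (g t)))" if t: "t > 0" for t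
  proof (rule blinfun_eqI)
    fix x
    note y = resolvent_g(1)[OF Y(2) a less_imp_le[OF t]] and z = resolvent_g(1)[OF Z(2) a less_imp_le[OF t]]
    let ?R = "resolvent Y (g t)" and ?S = "resolvent Z (g t)"
    have "?R ((Z - Y) (?S x)) = ?R (Z (?S x)) - ?R (Y (?S x))" by (simp add: blinfun.diff_left blinfun.diff_right)
    also have "\<dots> = ?R x - ?S x"
      using resolvent_apply(1)[OF z, of x] resolvent_apply(2)[OF y, of "?S x"] by (simp add: blinfun.add_right)
    finally have RS: "?R ((Z - Y) (?S x)) = ?R x - ?S x" .
    show "((K (g t) o\<^sub>L Y o\<^sub>L ?R) - (K (g t) o\<^sub>L Z o\<^sub>L ?S)) x
        = (g t *\<^sub>C (K (g t) o\<^sub>L (?R o\<^sub>L (Z - Y) o\<^sub>L ?S))) x"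
      using resolvent_apply(1)[OF y, of x] resolvent_apply(1)[OF z, of x]
      by (simp add: blinfun.diff_left[of "K (g t) o\<^sub>L Y o\<^sub>L ?R"] RS blinfun.add_right blinfun.diff_right
          clinear_opD[OF K_clinear[OF t]] scaleC.diff_right)
  qed
  have "\<exists>L. has_contour_int g (\<lambda>\<mu>. (K \<mu> o\<^sub>L Y o\<^sub>L resolvent Y \<mu>) - (K \<mu> o\<^sub>L Z o\<^sub>L resolvent Z \<mu>)) L \<and>
      norm L \<le> (\<kappa> * norm (Y - Z)) * v"
  proof (rule contour_int_exists)
    show "continuous_on {0<..} (\<lambda>t. (K (g t) o\<^sub>L Y o\<^sub>L resolvent Y (g t)) - (K (g t) o\<^sub>L Z o\<^sub>L resolvent Z (g t)))"
      by (intro continuous_on_diff continuous_on_blinfun_compose K_cont continuous_on_const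
          resolvent_g_cont[OF Y a] resolvent_g_cont[OF Z a])
    fix t :: real assume t: "0 < t"
    have "norm (g t *\<^sub>C (K (g t) o\<^sub>L (resolvent Y (g t) o\<^sub>L (Z - Y) o\<^sub>L resolvent Z (g t))))
        \<le> cmod (g t) * (norm (K (g t)) * (1 / (\<delta> t - a) * norm (Z - Y) * (1 / (\<delta> t - a))))"
      unfolding norm_scaleC
      using t by (intro mult_left_mono norm_blinfun_compose_le order_refl resolvent_g(2) Y Z a) auto
    also have "\<dots> = norm (K (g t)) * norm (Y - Z) * (cmod (g t) * (1 / (\<delta> t - a)) * (1 / (\<delta> t - a)))"
      by (simp add: norm_minus_commute)
    also have "\<dots> \<le> norm (K (g t)) * norm (Y - Z) * (\<kappa> / \<delta> t)"
      using t a by (intro mult_left_mono kernel_bound) auto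
    finally show "norm ((K (g t) o\<^sub>L Y o\<^sub>L resolvent Y (g t)) - (K (g t) o\<^sub>L Z o\<^sub>L resolvent Z (g t)))
        \<le> \<kappa> * norm (Y - Z) * (norm (K (g t)) / \<delta> t)"
      by (simp add: diff[OF t] mult_ac)
  qed (use \<kappa>_nonneg in simp)
  then show ?thesis
    using has_contour_int_unique[OF has_contour_int_diff[OF I J]] by (auto simp: V1_eq[OF I] V1_eq[OF J] mult_ac)
qed

abbreviation "r \<equiv> r_min A K g"

text \<open>\<open>r\<close> is the smaller root of r^2 - 2 \<rho> r + d v |A| = 0. With 2 \<rho> =
  d (1 - v) this is the third claim, which says that the norm bound for V1 on the ball of radius r
  is exactly r.\<close>

lemma r_min_facts: "0 \<le> r" "r \<le> \<rho>" "r * (d - r) = d * v * (norm A + r)"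
proof -
  define s where "s = sqrt (\<rho>\<^sup>2 - d * v * norm A)"
  have r: "r = \<rho> - s" unfolding r_min_def s_def \<rho>_def by (simp add: power_divide power_mult_distrib)
  have "d * (v * norm A) \<le> d * (1/4 * d * (1 - v)\<^sup>2)" using Var_small d_pos by (intro mult_left_mono) auto
  then have "d * v * norm A \<le> \<rho>\<^sup>2" by (simp add: \<rho>_def power2_eq_square algebra_simps)
  then have s2: "s\<^sup>2 = \<rho>\<^sup>2 - d * v * norm A" by (simp add: s_def)
  have "s \<le> \<rho>" unfolding s_def using \<rho>_pos d_pos v_nonneg by (intro real_le_lsqrt) auto
  then show "0 \<le> r" by (simp add: r)
  show "r \<le> \<rho>" using s2 \<open>d * v * norm A \<le> \<rho>\<^sup>2\<close> by (simp add: r s_def)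
  have "2 * \<rho> = d * (1 - v)" by (simp add: \<rho>_def)
  have "(\<rho> - r)\<^sup>2 = \<rho>\<^sup>2 - d * v * norm A" using s2 by (simp add: r)
  moreover have "(\<rho> - r)\<^sup>2 = \<rho>\<^sup>2 - r * (2 * \<rho> - r)" by (simp add: power2_eq_square algebra_simps)
  ultimately have *: "r * (2 * \<rho> - r) = d * v * norm A" by linarith
  have "r * (d - r) = r * (d * (1 - v) - r) + d * v * r" by (simp add: algebra_simps)
  also have "\<dots> = d * v * norm A + d * v * r" using * \<open>2 * \<rho> = d * (1 - v)\<close> by simp
  finally show "r * (d - r) = d * v * (norm A + r)" by (simp only: distrib_left)
qed

lemma r_le_\<rho>1: "r \<le> \<rho>1" using r_min_facts \<rho>1_bounds by linarith

text \<open>Banach's theorem on the complex-linear operators in the ball. Complex linearity is a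
  closed condition and survives the contour integral, so this set is complete and invariant; the
  contraction constant is \<kappa> v.\<close>

lemma fixed_point_unique_exists:
  "\<exists>!X. clinear_op X \<and> norm X \<le> r \<and> X = V1 K (A + X) g"
proof -
  let ?S = "{X :: 'h \<Rightarrow>\<^sub>L 'h. clinear_op X \<and> norm X \<le> r}"
  have "?S = (\<Inter>c x. {X::'h \<Rightarrow>\<^sub>L 'h. X (c *\<^sub>C x) = c *\<^sub>C X x}) \<inter> cball 0 r"
    by (auto simp: clinear_op_def)
  also have "closed \<dots>"
    by (intro closed_Int closed_cball closed_INT ballI closed_Collect_eq
        bounded_linear.continuous_on[OF bounded_linear_compose[OF bounded_linear_scaleC_right blinfun.bounded_linear_left]]
        bounded_linear.continuous_on[OF blinfun.bounded_linear_left] continuous_on_id)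
  finally have "complete ?S" by (simp add: complete_eq_closed)
  have dr: "0 < d - r" using r_le_\<rho>1 \<rho>1_bounds by linarith
  have "\<exists>!X. X \<in> ?S \<and> V1 K (A + X) g = X"
  proof (rule Banach_fix[OF \<open>complete ?S\<close>])
    show "?S \<noteq> {}" using r_min_facts(1) by (auto intro!: exI[of _ 0])
    show "0 \<le> \<kappa> * v" using \<kappa>_nonneg v_nonneg by simp
    show "\<kappa> * v < 1" by (rule \<kappa>_less)
    show "(\<lambda>X. V1 K (A + X) g) ` ?S \<subseteq> ?S"
    proof clarify
      fix X :: "'h \<Rightarrow>\<^sub>L 'h" assume X: "clinear_op X" "norm X \<le> r"
      have Y: "clinear_op (A + X)" "norm (A + X - A) \<le> r" using X clinear_A by auto
      obtain I where I: "has_contour_int g (\<lambda>\<mu>. K \<mu> o\<^sub>L (A + X) o\<^sub>L resolvent (A + X) \<mu>) I"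
        "norm I \<le> (norm A + r) * d / (d - r) * v"
        using V1_integral[OF Y r_le_\<rho>1] by blast
      have "clinear_op I"
        by (rule has_contour_int_clinear[OF I(1)])
          (intro clinear_compose K_clinear Y clinear_resolvent resolvent_g(1)[OF Y(2) r_le_\<rho>1], auto)
      moreover have "(norm A + r) * d / (d - r) * v = d * v * (norm A + r) / (d - r)"
        by (simp add: mult_ac)
      then have "(norm A + r) * d / (d - r) * v = r"
        unfolding r_min_facts(3)[symmetric] using dr by simp
      ultimately show "clinear_op (V1 K (A + X) g) \<and> norm (V1 K (A + X) g) \<le> r"
        using I by (simp add: V1_eq)
    qed
    show "dist (V1 K (A + X) g) (V1 K (A + Y) g) \<le> \<kappa> * v * dist X Y" if "X \<in> ?S" "Y \<in> ?S" for X Y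
      using V1_contraction[of "A + X" r "A + Y"] that clinear_A r_le_\<rho>1 by (auto simp: dist_norm)
  qed
  then show ?thesis by (auto simp: conj_assoc eq_commute)
qed

definition "X = X1 A K g"
definition "H = A + X"

lemma H1_eq: "H1 A K g = H" by (simp add: H1_def H_def X_def)

lemma X_facts: "clinear_op X" "norm X \<le> r" "X = V1 K H g"
proof -
  have *: "clinear_op X \<and> norm X \<le> r \<and> X = V1 K (A + X) g"
    unfolding X_def X1_def by (rule theI'[OF fixed_point_unique_exists])
  then show "clinear_op X" "norm X \<le> r" by blast+
  show "X = V1 K H g" unfolding H_def using * by blast
qed

lemma H_facts: "clinear_op H" "norm (H - A) \<le> r"
  using X_facts(1,2) clinear_A by (auto simp: H_def)

lemma H_integral: "has_contour_int g (\<lambda>\<mu>. K \<mu> o\<^sub>L H o\<^sub>L resolvent H \<mu>) (H - A)"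
proof -
  obtain I where I: "has_contour_int g (\<lambda>\<mu>. K \<mu> o\<^sub>L H o\<^sub>L resolvent H \<mu>) I"
    using V1_integral[OF H_facts r_le_\<rho>1] by blast
  moreover have "X = I" using X_facts(3) unfolding V1_eq[OF I] .
  moreover have "H - A = X" by (simp add: H_def)
  ultimately show ?thesis by simp
qed

section \<open>The conjugate contour and the adjoint equation\<close>

lemma conj_infdist: "infdist (cnj \<mu>) (spectrum A) = infdist \<mu> (spectrum A)"
proof -
  have "dist (cnj \<mu>) s = dist \<mu> s" if "s \<in> spectrum A" for s
  proof -
    have "cnj s = s" using that real_spectrum by (auto simp: Reals_cnj_iff)
    then have "dist (cnj \<mu>) s = cmod (cnj (\<mu> - s))" by (simp add: dist_norm)
    then show ?thesis by (simp only: complex_mod_cnj dist_norm)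
  qed
  then show ?thesis unfolding infdist_notempty[OF spectrum_nonempty] by (intro INF_cong refl)
qed

lemma norm_K_conj: "t > 0 \<Longrightarrow> norm (K (cnj (g t))) = norm (K (g t))"
  by (simp add: K_adj norm_adj K_clinear)

lemma conj_d0: "d0 A (conj_contour g) = d0 A g"
proof -
  have "d0 A h = Inf ((\<lambda>t. infdist (h t) (spectrum A)) ` {0..})" for h
    unfolding d0_def setdist_sym[of "spectrum A"] using setdist_eq_infdist[of "h ` {0..}" "spectrum A"] spectrum_nonempty
    by (simp add: image_image)
  then show ?thesis by (simp add: conj_contour_def conj_infdist)
qed

lemma conj_Var: "Var_A A K (conj_contour g) = Var_A A K g"
  unfolding Var_A_def conj_contour_def
  \<comment> \<open>The relation between \<open>K\<close> and its adjoint is available for t > 0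
    only; the end point is a null set.\<close>
  by (rule integral_spike[OF negligible_sing[of 0]]) (auto simp: conj_infdist norm_K_conj)

lemma conj_bounded: "K_B_bounded K (conj_contour g)"
  using K_bounded unfolding K_B_bounded_def conj_contour_def
  by (rule integrable_spike[OF _ negligible_sing[of 0]]) (auto simp: norm_K_conj)

lemma conj_kb_contour: "kb_contour A K (conj_contour g)"
proof
  show "var_bound (\<lambda>t. t) (conj_contour g) 0 b" for b
    using arc_length[of b] unfolding var_bound_def conj_contour_def
    by (simp flip: complex_cnj_diff)
  \<comment> \<open>Taking adjoints is isometric, so continuity of \<open>K\<close> along
    \<open>g\<close> passes to the conjugate contour.\<close>
  have "dist (K (cnj (g s))) (K (cnj (g t))) = dist (K (g s)) (K (g t))" if "s > 0" "t > 0" for s t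
    using that by (simp add: dist_norm K_adj K_clinear norm_adj clinear_diff flip: adj_diff)
  then show "continuous_on {0<..} (\<lambda>t. K (conj_contour g t))"
    using K_cont unfolding continuous_on_iff conj_contour_def by (metis (no_types, lifting) greaterThan_iff)
  show "clinear_op (K (conj_contour g t))" if "t > 0" for t
    using that by (simp add: conj_contour_def K_adj clinear_adj K_clinear)
  show "K (cnj (conj_contour g t)) = adj (K (conj_contour g t))" if "t > 0" for t
    using that by (simp add: conj_contour_def K_adj adj_adj K_clinear)
qed (use selfadjoint real_spectrum conj_bounded d_pos Var_less Var_small in \<open>simp_all add: conj_d0 conj_Var\<close>)

lemma conj_conj: "conj_contour (conj_contour g) = g" by (simp add: conj_contour_def)

definition "H' = H1 A K (conj_contour g)"
definition "G = adj H'"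

lemma H'_facts: "clinear_op H'" "norm (H' - A) \<le> r"
    "has_contour_int (conj_contour g) (\<lambda>\<mu>. K \<mu> o\<^sub>L H' o\<^sub>L resolvent H' \<mu>) (H' - A)"
proof -
  interpret conj: kb_contour A K "conj_contour g" by (rule conj_kb_contour)
  have H': "H' = conj.H" unfolding H'_def by (rule conj.H1_eq)
  show "clinear_op H'" "has_contour_int (conj_contour g) (\<lambda>\<mu>. K \<mu> o\<^sub>L H' o\<^sub>L resolvent H' \<mu>) (H' - A)"
    unfolding H' by (rule conj.H_facts conj.H_integral)+
  have "r_min A K (conj_contour g) = r" unfolding r_min_def conj_d0 conj_Var ..
  then show "norm (H' - A) \<le> r" using conj.H_facts(2) by (simp add: H')
qed

lemma adj_A: "adj A = A" using selfadjoint by (simp add: selfadjoint_op_def)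

lemma G_facts: "clinear_op G" "norm (G - A) \<le> r"
proof -
  show "clinear_op G" unfolding G_def by (rule clinear_adj[OF H'_facts(1)])
  have "G - A = adj (H' - A)" by (simp add: G_def adj_diff H'_facts clinear_A adj_A)
  then show "norm (G - A) \<le> r" using H'_facts by (simp add: norm_adj clinear_diff clinear_A)
qed

lemma spectrum_adj_resolvent:
  assumes Y: "clinear_op Y" and z: "cnj z \<notin> spectrum Y"
  shows "z \<notin> spectrum (adj Y)" "adj (resolvent Y (cnj z)) = resolvent (adj Y) z"
proof -
  have "adj (Y - cnj z *\<^sub>C id_blinfun) = adj Y - z *\<^sub>C id_blinfun"
    by (simp add: adj_diff adj_scaleC Y clinear_scaleC)
  then have "is_inverse_op (adj Y - z *\<^sub>C id_blinfun) (adj (resolvent Y (cnj z)))"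
    using is_inverse_adj[OF resolvent_inverse[OF z] clinear_minus_scalar[OF Y]] by simp
  then show "z \<notin> spectrum (adj Y)" "adj (resolvent Y (cnj z)) = resolvent (adj Y) z"
    unfolding spectrum_def resolvent_def[of "adj Y"] using inv_op_eq by fastforce+
qed

lemma resolvent_H'_adj: "t > 0 \<Longrightarrow> adj (resolvent H' (cnj (g t))) = resolvent G (g t)"
    "t > 0 \<Longrightarrow> cnj (g t) \<notin> spectrum H'"
proof -
  assume t: "t > 0"
  have "r < infdist (cnj (g t)) (spectrum A)"
    using \<delta>_minus_pos[of t r] t r_le_\<rho>1 by (simp add: conj_infdist)
  from perturbed_resolvent(1)[OF H'_facts(2) this] show ns: "cnj (g t) \<notin> spectrum H'" .
  show "adj (resolvent H' (cnj (g t))) = resolvent G (g t)"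
    unfolding G_def by (rule spectrum_adj_resolvent(2)[OF H'_facts(1) ns])
qed

lemmas H_ns = resolvent_g(1)[OF H_facts(2) r_le_\<rho>1, OF less_imp_le]
lemmas G_ns = resolvent_g(1)[OF G_facts(2) r_le_\<rho>1, OF less_imp_le]
lemmas H_norm = resolvent_g(2)[OF H_facts(2) r_le_\<rho>1, OF less_imp_le]
lemmas G_norm = resolvent_g(2)[OF G_facts(2) r_le_\<rho>1, OF less_imp_le]
lemmas H_cont = resolvent_g_cont[OF H_facts r_le_\<rho>1]
lemmas G_cont = resolvent_g_cont[OF G_facts r_le_\<rho>1]
lemmas RH_clinear = clinear_resolvent[OF H_facts(1) H_ns]
lemmas RG_clinear = clinear_resolvent[OF G_facts(1) G_ns]

text \<open>Taking adjoints in the equation for \<open>H'\<close> reverses the factors and brings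
  the integral back to \<open>g\<close>. Convergence along \<open>g\<close> is established
  beforehand, because the adjoint rule compares two existing integrals.\<close>

lemma G_integral: "has_contour_int g (\<lambda>\<mu>. resolvent G \<mu> o\<^sub>L G o\<^sub>L K \<mu>) (G - A)"
proof -
  define b where "b = d / (d - \<rho>1) * norm G"
  have "\<exists>I. has_contour_int g (\<lambda>\<mu>. resolvent G \<mu> o\<^sub>L G o\<^sub>L K \<mu>) I \<and> norm I \<le> b * v"
  proof (rule contour_int_exists)
    show "continuous_on {0<..} (\<lambda>t. resolvent G (g t) o\<^sub>L G o\<^sub>L K (g t))"
      by (intro continuous_on_blinfun_compose K_cont continuous_on_const G_cont)
    show "0 \<le> b" using d_pos \<rho>1_bounds by (simp add: b_def)
    fix t :: real assume t: "0 < t"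
    have "norm (resolvent G (g t) o\<^sub>L G o\<^sub>L K (g t)) \<le> d / (d - \<rho>1) / \<delta> t * norm G * norm (K (g t))"
      using t r_le_\<rho>1
      by (intro norm_blinfun_compose_le order_refl order_trans[OF G_norm] inverse_\<delta>_minus_le) auto
    then show "norm (resolvent G (g t) o\<^sub>L G o\<^sub>L K (g t)) \<le> b * (norm (K (g t)) / \<delta> t)"
      by (simp add: b_def)
  qed
  then obtain I where I: "has_contour_int g (\<lambda>\<mu>. resolvent G \<mu> o\<^sub>L G o\<^sub>L K \<mu>) I" by blast
  have "adj (H' - A) = I"
  proof (rule has_contour_int_adj[OF H'_facts(3)])
    show "has_contour_int (conj_contour (conj_contour g)) (\<lambda>\<mu>. resolvent G \<mu> o\<^sub>L G o\<^sub>L K \<mu>) I"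
      unfolding conj_conj by (rule I)
    fix t :: real and x y assume t: "0 < t"
    note K = K_clinear[OF t] and R = clinear_resolvent[OF H'_facts(1) resolvent_H'_adj(2)[OF t]]
    have "cinner (adj (resolvent H' (cnj (g t))) (adj H' (K (g t) y))) x
        = cinner y (adj (K (g t)) (H' (resolvent H' (cnj (g t)) x)))"
      by (simp add: cinner_adj_left cinner_adj_right K R H'_facts)
    then show "cinner ((resolvent G (cnj (conj_contour g t)) o\<^sub>L G o\<^sub>L K (cnj (conj_contour g t))) y) x
        = cinner y ((K (conj_contour g t) o\<^sub>L H' o\<^sub>L resolvent H' (conj_contour g t)) x)"
      by (simp add: conj_contour_def K_adj[OF t] resolvent_H'_adj(1)[OF t] G_def[symmetric])
  qed
  then show ?thesis using I by (simp add: G_def adj_diff H'_facts clinear_A adj_A)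
qed

end

text \<open>Norm continuity gives existence of the vector integral; that it vanishes is tested on
  scalar products, where the holomorphic result applies.\<close>

lemma loop_integral_weakly_holomorphic:
  fixes \<Psi> :: "complex \<Rightarrow> 'a::chilbert"
  assumes S: "S \<subseteq> \<real>" and U: "U = {z. infdist z S < \<epsilon>}" and cont: "continuous_on U \<Psi>"
    and hol: "\<And>y. (\<lambda>z. cinner y (\<Psi> z)) holomorphic_on U"
    and c: "rectifiable_loop c" "path_image c \<subseteq> U"
  shows "has_curve_integral \<Psi> 0 c 0 1"
proof -
  have c': "path c" "pathfinish c = pathstart c" using c(1) by (auto simp: rectifiable_loop_def)
  obtain V where V: "var_bound V c 0 1" using rectifiable_var_bound c(1) unfolding rectifiable_loop_def by blast
  have "continuous_on {0..1} (\<lambda>t. \<Psi> (c t))"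
    by (rule continuous_on_compose2[OF cont]) (use c' c(2) in \<open>auto simp: path_def path_image_def\<close>)
  then obtain I where I: "has_curve_integral \<Psi> I c 0 1" using has_curve_integral_exists[OF zero_le_one V] by blast
  have "cinner y I = cinner y 0" for y
  proof -
    have "has_curve_integral (\<lambda>z. cinner y (\<Psi> z)) (cinner y I) c 0 1"
      by (rule has_curve_integral_linear[OF I bounded_linear_cinner_right]) (simp add: cinner_simps scaleC_complex_def)
    moreover have "has_curve_integral (\<lambda>z. cinner y (\<Psi> z)) 0 c 0 1"
      by (rule loop_integral_real_neighbourhood[OF S _ c' _ V]) (use hol c(2) in \<open>simp_all add: U\<close>)
    ultimately show ?thesis using has_curve_integral_unique by fastforce
  qed
  then have "I = 0" by (rule cinner_ext)
  then show ?thesis using I by simp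
qed

text \<open>The primitive \<open>c u *\<^sub>C x\<close> is exact on every subinterval. The lemma
  disposes of the constant term in z R(z) = H R(z) - 1.\<close>

lemma has_curve_integral_const:
  assumes "path c" "pathfinish c = pathstart c" "var_bound V c 0 1"
  shows "has_curve_integral (\<lambda>_. x) (0::'a::complex_normed_vector) c 0 1"
proof -
  have "has_curve_integral (\<lambda>_. x) (c 1 *\<^sub>C x - c 0 *\<^sub>C x) c 0 1"
  proof (rule has_curve_integral_local_primitive[OF zero_le_one assms(3)])
    fix e :: real assume "e > 0"
    have "norm ((c v - c u) *\<^sub>C x - (c v *\<^sub>C x - c u *\<^sub>C x)) \<le> e * (V v - V u)"
      if "0 \<le> u" "u \<le> v" "v \<le> 1" for u v
      using order_trans[OF norm_ge_zero var_boundD[OF assms(3) that]] \<open>e > 0\<close>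
      by (simp add: scaleC.diff_left)
    then show "\<exists>d>0. \<forall>u s v. 0 \<le> u \<and> u \<le> s \<and> s \<le> v \<and> v \<le> 1 \<and> v - u < d \<longrightarrow>
        norm ((c v - c u) *\<^sub>C x - (c v *\<^sub>C x - c u *\<^sub>C x)) \<le> e * (V v - V u)"
      by (intro exI[of _ 1]) (auto dest: order_trans)
  qed
  then show ?thesis using assms(2) by (simp add: pathfinish_def pathstart_def)
qed

section \<open>Factorization of the transfer function\<close>

context kb_contour
begin

abbreviation "Q \<mu> \<equiv> resolvent G \<mu> o\<^sub>L K \<mu> o\<^sub>L resolvent H \<mu>"

text \<open>The bounded multiplier \<open>s\<close> covers all integrals with the kernel
  \<open>Q\<close>: s = 1 gives \<Omega>, s = 1 / (z - \<mu>) gives \<open>L z\<close>, and further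
  choices give its derivative and the remainder.\<close>

lemma Q_integral:
  assumes s: "continuous_on {0<..} (\<lambda>t. s (g t))" "\<And>t. t > 0 \<Longrightarrow> cmod (s (g t)) \<le> c" and c: "0 \<le> c"
  shows "\<exists>I. has_contour_int g (\<lambda>\<mu>. (s \<mu> * \<mu>) *\<^sub>C Q \<mu>) I \<and> norm I \<le> c * \<kappa> * v"
proof (rule contour_int_exists)
  show "continuous_on {0<..} (\<lambda>t. (s (g t) * g t) *\<^sub>C Q (g t))"
    by (intro scaleC.continuous_on continuous_on_mult s g_cont' continuous_on_blinfun_compose K_cont G_cont H_cont)
  show "0 \<le> c * \<kappa>" using c \<kappa>_nonneg by simp
  fix t :: real assume t: "0 < t"
  have "norm ((s (g t) * g t) *\<^sub>C Q (g t))
      \<le> (c * cmod (g t)) * (1 / (\<delta> t - r) * norm (K (g t)) * (1 / (\<delta> t - r)))"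
    unfolding norm_scaleC norm_mult
    using t c by (intro mult_mono norm_blinfun_compose_le order_refl H_norm G_norm s(2) mult_nonneg_nonneg) auto
  also have "\<dots> = c * norm (K (g t)) * (cmod (g t) * (1 / (\<delta> t - r)) * (1 / (\<delta> t - r)))" by simp
  also have "\<dots> \<le> c * norm (K (g t)) * (\<kappa> / \<delta> t)"
    using t c r_le_\<rho>1 by (intro mult_left_mono kernel_bound) auto
  finally show "norm ((s (g t) * g t) *\<^sub>C Q (g t)) \<le> c * \<kappa> * (norm (K (g t)) / \<delta> t)" by (simp add: mult_ac)
qed

lemma Q_clinear: "t > 0 \<Longrightarrow> clinear_op (c *\<^sub>C Q (g t))"
  by (intro clinear_scaleC clinear_compose RG_clinear RH_clinear K_clinear)

definition "\<Omega> = Omega A K g"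

lemma \<Omega>_integral: "has_contour_int g (\<lambda>\<mu>. \<mu> *\<^sub>C Q \<mu>) \<Omega>" and norm_\<Omega>: "norm \<Omega> \<le> \<kappa> * v"
proof -
  have "\<exists>I. has_contour_int g (\<lambda>\<mu>. (1 * \<mu>) *\<^sub>C Q \<mu>) I \<and> norm I \<le> 1 * \<kappa> * v"
    by (rule Q_integral) auto
  then obtain I where I: "has_contour_int g (\<lambda>\<mu>. \<mu> *\<^sub>C Q \<mu>) I" "norm I \<le> \<kappa> * v" by auto
  have "\<Omega> = contour_int g (\<lambda>\<mu>. \<mu> *\<^sub>C Q \<mu>)"
    unfolding \<Omega>_def Omega_def resolvent_def G_def H'_def H1_eq ..
  then have "\<Omega> = I" using contour_int_eq[OF I(1)] by simp
  then show "has_contour_int g (\<lambda>\<mu>. \<mu> *\<^sub>C Q \<mu>) \<Omega>" "norm \<Omega> \<le> \<kappa> * v" using I by auto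
qed

lemma norm_\<Omega>_less: "norm \<Omega> < 1" using norm_\<Omega> \<kappa>_less by linarith

lemma clinear_\<Omega>: "clinear_op \<Omega>" by (rule has_contour_int_clinear[OF \<Omega>_integral Q_clinear])

definition "U = {z. infdist z (spectrum A) < \<rho>1}"

lemma open_U: "open U" unfolding U_def by (rule open_Collect_less) (intro continuous_intros)+

lemma U_far: "z \<in> U \<Longrightarrow> 0 \<le> t \<Longrightarrow> \<delta> t - infdist z (spectrum A) \<le> cmod (z - g t)"
  using infdist_triangle[of "g t" "spectrum A" z] by (simp add: dist_norm norm_minus_commute)

lemma U_gap: "z \<in> U \<Longrightarrow> 0 \<le> t \<Longrightarrow> d - \<rho>1 \<le> cmod (z - g t)"
  using U_far[of z t] d_le[of t] by (simp add: U_def)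

lemma U_ne: "z \<in> U \<Longrightarrow> 0 \<le> t \<Longrightarrow> z \<noteq> g t"
  using U_gap[of z t] \<rho>1_bounds by auto

lemma gap_pos: "0 < d - \<rho>1" using \<rho>1_bounds by simp

lemma U_inverse_cont: "z \<in> U \<Longrightarrow> continuous_on {0<..} (\<lambda>t. 1 / (z - g t))"
  using U_ne[of z] by (intro continuous_intros g_cont') auto

lemma U_inverse_le: "z \<in> U \<Longrightarrow> 0 \<le> t \<Longrightarrow> cmod (1 / (z - g t)) \<le> 1 / (d - \<rho>1)"
  using U_gap[of z t] gap_pos by (simp add: norm_divide frac_le)

definition "L z = contour_int g (\<lambda>\<mu>. (1 / (z - \<mu>) * \<mu>) *\<^sub>C Q \<mu>)"

lemma L_integral: "z \<in> U \<Longrightarrow> has_contour_int g (\<lambda>\<mu>. (1 / (z - \<mu>) * \<mu>) *\<^sub>C Q \<mu>) (L z)"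
proof -
  assume z: "z \<in> U"
  obtain I where I: "has_contour_int g (\<lambda>\<mu>. (1 / (z - \<mu>) * \<mu>) *\<^sub>C Q \<mu>) I"
    using Q_integral[of "\<lambda>\<mu>. 1 / (z - \<mu>)" "1 / (d - \<rho>1)"] U_inverse_cont[OF z] U_inverse_le[OF z] gap_pos by force
  then show ?thesis unfolding L_def contour_int_eq[OF I] .
qed

lemma clinear_L: "z \<in> U \<Longrightarrow> clinear_op (L z)"
  by (rule has_contour_int_clinear[OF L_integral]) (simp_all only: Q_clinear)

text \<open>This form has a single resolvent factor and can be estimated at once by the kernel
  bound; the expression through \<Omega> and \<open>L\<close> is derived in
  \<open>W_eq\<close>.\<close>

definition "W z = id_blinfun + contour_int g (\<lambda>\<mu>. (1 / (z - \<mu>) * \<mu>) *\<^sub>C (K \<mu> o\<^sub>L resolvent H \<mu>))"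

lemma W_integral: "z \<in> U \<Longrightarrow> has_contour_int g (\<lambda>\<mu>. (1 / (z - \<mu>) * \<mu>) *\<^sub>C (K \<mu> o\<^sub>L resolvent H \<mu>)) (W z - id_blinfun)"
  and W_norm: "z \<in> U \<Longrightarrow> norm (W z - id_blinfun) \<le> \<kappa> * v"
proof -
  assume z: "z \<in> U"
  have "\<exists>I. has_contour_int g (\<lambda>\<mu>. (1 / (z - \<mu>) * \<mu>) *\<^sub>C (K \<mu> o\<^sub>L resolvent H \<mu>)) I \<and> norm I \<le> \<kappa> * v"
  proof (rule contour_int_exists)
    show "continuous_on {0<..} (\<lambda>t. (1 / (z - g t) * g t) *\<^sub>C (K (g t) o\<^sub>L resolvent H (g t)))"
      by (intro scaleC.continuous_on continuous_on_mult U_inverse_cont z g_cont' continuous_on_blinfun_compose K_cont H_cont)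
    show "0 \<le> \<kappa>" by (rule \<kappa>_nonneg)
    fix t :: real assume t: "0 < t"
    \<comment> \<open>The distance of \<open>z\<close> from the spectrum plays the role of a
      perturbation radius: |z - \<mu>| \<ge> dist - a with a \<le> \<rho>1, as in
      \<open>kernel_bound\<close>.\<close>
    define a where "a = infdist z (spectrum A)"
    have a: "a \<le> \<rho>1" using z by (simp add: a_def U_def)
    have pos: "0 < \<delta> t - a" using \<delta>_minus_pos[of t a] t a by simp
    have "cmod (1 / (z - g t)) \<le> 1 / (\<delta> t - a)"
      using U_far[OF z, of t] t pos by (simp add: norm_divide frac_le a_def)
    then have "norm ((1 / (z - g t) * g t) *\<^sub>C (K (g t) o\<^sub>L resolvent H (g t)))
        \<le> (1 / (\<delta> t - a) * cmod (g t)) * (norm (K (g t)) * (1 / (\<delta> t - r)))"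
      unfolding norm_scaleC norm_mult
      using t pos by (intro mult_mono norm_blinfun_compose_le order_refl H_norm mult_nonneg_nonneg) auto
    also have "\<dots> = norm (K (g t)) * (cmod (g t) * (1 / (\<delta> t - a)) * (1 / (\<delta> t - r)))" by simp
    also have "\<dots> \<le> norm (K (g t)) * (\<kappa> / \<delta> t)"
      using t a r_le_\<rho>1 by (intro mult_left_mono kernel_bound) auto
    finally show "norm ((1 / (z - g t) * g t) *\<^sub>C (K (g t) o\<^sub>L resolvent H (g t))) \<le> \<kappa> * (norm (K (g t)) / \<delta> t)"
      by (simp add: mult_ac)
  qed
  then obtain I where I: "has_contour_int g (\<lambda>\<mu>. (1 / (z - \<mu>) * \<mu>) *\<^sub>C (K \<mu> o\<^sub>L resolvent H \<mu>)) I" "norm I \<le> \<kappa> * v"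
    by blast
  have "W z - id_blinfun = I" unfolding W_def contour_int_eq[OF I(1)] by simp
  then show "has_contour_int g (\<lambda>\<mu>. (1 / (z - \<mu>) * \<mu>) *\<^sub>C (K \<mu> o\<^sub>L resolvent H \<mu>)) (W z - id_blinfun)"
    "norm (W z - id_blinfun) \<le> \<kappa> * v" using I by auto
qed

text \<open>All factorizations come from \<open>R(\<mu>)(Y - z) = 1 - (z - \<mu>) R(\<mu>)\<close>.\<close>

lemma partial_fraction:
  assumes "z \<noteq> \<mu>"
  shows "(1 / (z - \<mu>) * \<mu>) *\<^sub>C (x + (\<mu> - z) *\<^sub>C (y::'h)) + \<mu> *\<^sub>C y = (1 / (z - \<mu>) * \<mu>) *\<^sub>C x"
    "(1 / (z - \<mu>) * \<mu>) *\<^sub>C (x + (\<mu> - z) *\<^sub>C y) + (x + \<mu> *\<^sub>C y) = (z / (z - \<mu>)) *\<^sub>C x"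
proof -
  have zm: "z - \<mu> \<noteq> 0" using assms by simp
  have 1: "(1 / (z - \<mu>) * \<mu>) * (\<mu> - z) = - \<mu>" using zm by (simp add: field_simps)
  have 2: "1 / (z - \<mu>) * \<mu> + 1 = z / (z - \<mu>)" using zm by (simp add: field_simps)
  show "(1 / (z - \<mu>) * \<mu>) *\<^sub>C (x + (\<mu> - z) *\<^sub>C y) + \<mu> *\<^sub>C y = (1 / (z - \<mu>) * \<mu>) *\<^sub>C x"
    unfolding scaleC_add_right scaleC_scaleC 1 by simp
  have "(1 / (z - \<mu>) * \<mu>) *\<^sub>C x + x = (z / (z - \<mu>)) *\<^sub>C x"
    unfolding 2[symmetric] scaleC_add_left by simp
  then show "(1 / (z - \<mu>) * \<mu>) *\<^sub>C (x + (\<mu> - z) *\<^sub>C y) + (x + \<mu> *\<^sub>C y) = (z / (z - \<mu>)) *\<^sub>C x"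
    unfolding scaleC_add_right scaleC_scaleC 1 by (simp add: algebra_simps)
qed

lemma resolvent_shift:
  assumes Y: "clinear_op Y" and \<mu>: "\<mu> \<notin> spectrum Y"
  shows "resolvent Y \<mu> (Y x - z *\<^sub>C x) = x + (\<mu> - z) *\<^sub>C resolvent Y \<mu> x"
    "Y (resolvent Y \<mu> x) - z *\<^sub>C resolvent Y \<mu> x = x + (\<mu> - z) *\<^sub>C resolvent Y \<mu> x"
  using resolvent_apply[OF \<mu>, of x] clinear_opD[OF clinear_resolvent[OF Y \<mu>]]
  by (simp_all add: blinfun.diff_right scaleC.diff_left)

text \<open>Multiplying the integrand of W - 1 by H - z yields \<mu>/(z - \<mu>) K - \<mu> K R_H.
  The equation for H adds K H R_H = K + \<mu> K R_H; the resolvent terms cancel and z/(z - \<mu>) K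
  remains.\<close>

lemma M1_integral_H:
  assumes z: "z \<in> U"
  shows "has_contour_int g (\<lambda>\<mu>. (z / (z - \<mu>)) *\<^sub>C K \<mu>) (((W z - id_blinfun) o\<^sub>L (H - z *\<^sub>C id_blinfun)) + (H - A))"
proof (rule has_contour_int_cong[OF has_contour_int_add[OF has_contour_int_compose_right[OF W_integral[OF z]] H_integral]])
  fix t :: real assume t: "0 < t"
  show "((1 / (z - g t) * g t) *\<^sub>C (K (g t) o\<^sub>L resolvent H (g t)) o\<^sub>L (H - z *\<^sub>C id_blinfun)) +
      (K (g t) o\<^sub>L H o\<^sub>L resolvent H (g t)) = (z / (z - g t)) *\<^sub>C K (g t)"
  proof (rule blinfun_eqI)
    fix x
    show "(((1 / (z - g t) * g t) *\<^sub>C (K (g t) o\<^sub>L resolvent H (g t)) o\<^sub>L (H - z *\<^sub>C id_blinfun)) +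
      (K (g t) o\<^sub>L H o\<^sub>L resolvent H (g t))) x = ((z / (z - g t)) *\<^sub>C K (g t)) x"
      using partial_fraction(2)[OF U_ne[OF z less_imp_le[OF t]], of "K (g t) x" "K (g t) (resolvent H (g t) x)"]
      by (simp add: blinfun.add_left blinfun.diff_left resolvent_shift[OF H_facts(1) H_ns[OF t]]
          resolvent_apply(1)[OF H_ns[OF t]] blinfun.add_right clinear_opD[OF K_clinear[OF t]] del: times_divide_eq_left)
  qed
qed

text \<open>The factor G - z cancels R_G in the integrand of L up to the term - \<mu> Q, and this is
  compensated by \<Omega>.\<close>

lemma W_eq:
  assumes z: "z \<in> U"
  shows "W z = id_blinfun + \<Omega> + ((G - z *\<^sub>C id_blinfun) o\<^sub>L L z)"
proof -
  have cl: "clinear_op (G - z *\<^sub>C id_blinfun)" by (rule clinear_minus_scalar[OF G_facts(1)])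
  have "has_contour_int g (\<lambda>\<mu>. (1 / (z - \<mu>) * \<mu>) *\<^sub>C (K \<mu> o\<^sub>L resolvent H \<mu>)) (((G - z *\<^sub>C id_blinfun) o\<^sub>L L z) + \<Omega>)"
  proof (rule has_contour_int_cong[OF has_contour_int_add[OF has_contour_int_compose_left[OF L_integral[OF z] cl] \<Omega>_integral]])
    fix t :: real assume t: "0 < t"
    show "((G - z *\<^sub>C id_blinfun) o\<^sub>L (1 / (z - g t) * g t) *\<^sub>C Q (g t)) + g t *\<^sub>C Q (g t)
        = (1 / (z - g t) * g t) *\<^sub>C (K (g t) o\<^sub>L resolvent H (g t))"
    proof (rule blinfun_eqI)
      fix x
      let ?y = "K (g t) (resolvent H (g t) x)"
      have "(G - z *\<^sub>C id_blinfun) ((1 / (z - g t) * g t) *\<^sub>C resolvent G (g t) ?y)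
          = (1 / (z - g t) * g t) *\<^sub>C (?y + (g t - z) *\<^sub>C resolvent G (g t) ?y)"
        unfolding clinear_opD[OF cl]
        by (simp add: blinfun.diff_left resolvent_shift(2)[OF G_facts(1) G_ns[OF t]] del: times_divide_eq_left)
      then show "(((G - z *\<^sub>C id_blinfun) o\<^sub>L (1 / (z - g t) * g t) *\<^sub>C Q (g t)) + g t *\<^sub>C Q (g t)) x
        = ((1 / (z - g t) * g t) *\<^sub>C (K (g t) o\<^sub>L resolvent H (g t))) x"
        using partial_fraction(1)[OF U_ne[OF z less_imp_le[OF t]], of ?y "resolvent G (g t) ?y"]
        by (simp add: blinfun.add_left del: times_divide_eq_left)
    qed
  qed
  from has_contour_int_unique[OF this W_integral[OF z]] show ?thesis by (simp add: algebra_simps)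
qed

text \<open>The factor H - z is removed first: \<Omega> + L (H - z) has the integrand \<mu>/(z -
  \<mu>) R_G K. Then G - z acts from the left, and the equation for G cancels the remaining
  resolvent.\<close>

lemma M1_integral_G:
  assumes z: "z \<in> U"
  shows "has_contour_int g (\<lambda>\<mu>. (z / (z - \<mu>)) *\<^sub>C K \<mu>)
    (((G - z *\<^sub>C id_blinfun) o\<^sub>L (\<Omega> + (L z o\<^sub>L (H - z *\<^sub>C id_blinfun)))) + (G - A))"
proof (rule has_contour_int_cong[OF has_contour_int_add[OF has_contour_int_compose_left[OF
        has_contour_int_add[OF \<Omega>_integral has_contour_int_compose_right[OF L_integral[OF z]]]
        clinear_minus_scalar[OF G_facts(1)]] G_integral]])
  fix t :: real assume t: "0 < t"
  let ?c = "1 / (z - g t) * g t"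
  show "((G - z *\<^sub>C id_blinfun) o\<^sub>L (g t *\<^sub>C Q (g t) + (?c *\<^sub>C Q (g t) o\<^sub>L (H - z *\<^sub>C id_blinfun))))
      + (resolvent G (g t) o\<^sub>L G o\<^sub>L K (g t)) = (z / (z - g t)) *\<^sub>C K (g t)"
  proof (rule blinfun_eqI)
    fix x
    note ne = U_ne[OF z less_imp_le[OF t]]
    let ?y = "K (g t) x" and ?u = "resolvent H (g t) x"
    have "?c *\<^sub>C Q (g t) (H x - z *\<^sub>C x) + g t *\<^sub>C Q (g t) x = ?c *\<^sub>C resolvent G (g t) ?y"
      using partial_fraction(1)[OF ne, of "resolvent G (g t) ?y" "Q (g t) x"]
      by (simp add: resolvent_shift(1)[OF H_facts(1) H_ns[OF t]] blinfun.add_right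
          clinear_opD[OF K_clinear[OF t]] clinear_opD[OF RG_clinear[OF t]] del: times_divide_eq_left)
    then have "(G - z *\<^sub>C id_blinfun) (g t *\<^sub>C Q (g t) x + ?c *\<^sub>C Q (g t) (H x - z *\<^sub>C x))
        = (G - z *\<^sub>C id_blinfun) (?c *\<^sub>C resolvent G (g t) ?y)" by (simp only: add.commute)
    also have "\<dots> = ?c *\<^sub>C (?y + (g t - z) *\<^sub>C resolvent G (g t) ?y)"
      unfolding clinear_opD[OF clinear_minus_scalar[OF G_facts(1)]]
      by (simp add: blinfun.diff_left resolvent_shift(2)[OF G_facts(1) G_ns[OF t]] del: times_divide_eq_left)
    finally have 1: "(G - z *\<^sub>C id_blinfun) (g t *\<^sub>C Q (g t) x + ?c *\<^sub>C Q (g t) (H x - z *\<^sub>C x))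
        = ?c *\<^sub>C (?y + (g t - z) *\<^sub>C resolvent G (g t) ?y)" .
    have 2: "resolvent G (g t) (G ?y) = ?y + g t *\<^sub>C resolvent G (g t) ?y"
      using resolvent_apply(2)[OF G_ns[OF t], of ?y] clinear_opD[OF RG_clinear[OF t]] by simp
    have "(((G - z *\<^sub>C id_blinfun) o\<^sub>L (g t *\<^sub>C Q (g t) + (?c *\<^sub>C Q (g t) o\<^sub>L (H - z *\<^sub>C id_blinfun))))
      + (resolvent G (g t) o\<^sub>L G o\<^sub>L K (g t))) x
      = (G - z *\<^sub>C id_blinfun) (g t *\<^sub>C Q (g t) x + ?c *\<^sub>C Q (g t) (H x - z *\<^sub>C x)) + resolvent G (g t) (G ?y)"
      by (simp add: blinfun.add_left blinfun.diff_left[of H] del: times_divide_eq_left)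
    also have "\<dots> = (z / (z - g t)) *\<^sub>C ?y"
      unfolding 1 2 by (rule partial_fraction(2)[OF ne])
    finally show "(((G - z *\<^sub>C id_blinfun) o\<^sub>L (g t *\<^sub>C Q (g t) + (?c *\<^sub>C Q (g t) o\<^sub>L (H - z *\<^sub>C id_blinfun))))
      + (resolvent G (g t) o\<^sub>L G o\<^sub>L K (g t))) x = ((z / (z - g t)) *\<^sub>C K (g t)) x" by simp
  qed
qed

lemma M1_factorization:
  assumes z: "z \<in> U"
  shows "M1 A K g z = W z o\<^sub>L (H - z *\<^sub>C id_blinfun)"
  unfolding M1_def contour_int_eq[OF M1_integral_H[OF z]]
  by (rule blinfun_eqI) (simp add: blinfun.add_left blinfun.diff_left)

text \<open>Equating the two factorizations and inserting \<open>W_eq\<close>, the terms with L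
  cancel and so does z \<Omega>. One point z is therefore enough, and any spectral point of A lies
  in \<open>U\<close>.\<close>

lemma intertwining: "G (x + \<Omega> x) = H x + \<Omega> (H x)"
proof -
  obtain z where "z \<in> spectrum A" using spectrum_nonempty by blast
  then have z: "z \<in> U" using \<rho>1_pos by (simp add: U_def)
  define h where "h = H x - z *\<^sub>C x"
  have "((W z - id_blinfun) o\<^sub>L (H - z *\<^sub>C id_blinfun)) + (H - A)
      = ((G - z *\<^sub>C id_blinfun) o\<^sub>L (\<Omega> + (L z o\<^sub>L (H - z *\<^sub>C id_blinfun)))) + (G - A)"
    by (rule has_contour_int_unique[OF M1_integral_H[OF z] M1_integral_G[OF z]])
  from arg_cong[OF this, of "\<lambda>T. blinfun_apply T x"]
  have "W z h - h + H x = (G - z *\<^sub>C id_blinfun) (\<Omega> x + L z h) + G x"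
    by (simp add: blinfun.add_left blinfun.diff_left[of H] blinfun.diff_left[of _ A] blinfun.diff_left[of "W z"] flip: h_def)
  moreover have "W z h = h + \<Omega> h + (G - z *\<^sub>C id_blinfun) (L z h)"
    unfolding W_eq[OF z] by (simp add: blinfun.add_left)
  ultimately have "\<Omega> h + H x = (G - z *\<^sub>C id_blinfun) (\<Omega> x) + G x"
    by (simp add: blinfun.add_right)
  then show ?thesis
    by (simp add: h_def blinfun.diff_left blinfun.diff_right blinfun.add_right clinear_opD[OF clinear_\<Omega>] algebra_simps)
qed

section \<open>The inverse of the transfer function\<close>

definition "T = inv_op (id_blinfun + \<Omega>)"

lemma T_inverse: "is_inverse_op (id_blinfun + \<Omega>) T"
  unfolding T_def using invertible_id_plus[OF norm_\<Omega>_less] is_inverse_inv_op by blast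

lemma clinear_T: "clinear_op T"
  by (rule is_inverse_clinear[OF T_inverse]) (intro clinear_add clinear_id clinear_\<Omega>)

lemma T_G: "T (G x) = H (T x)"
proof -
  have "T x + \<Omega> (T x) = x" using is_inverse_op_apply(1)[OF T_inverse, of x] by (simp add: blinfun.add_left)
  then have "G x = H (T x) + \<Omega> (H (T x))" using intertwining[of "T x"] by simp
  then show ?thesis using is_inverse_op_apply(2)[OF T_inverse, of "H (T x)"] by (simp add: blinfun.add_left)
qed

definition "S z = inv_op (W z)"

lemma S_inverse: "z \<in> U \<Longrightarrow> is_inverse_op (W z) (S z)"
proof -
  assume z: "z \<in> U"
  have "norm (W z - id_blinfun) < 1" using W_norm[OF z] \<kappa>_less by linarith
  from invertible_id_plus[OF this] show ?thesis unfolding S_def using is_inverse_inv_op by fastforce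
qed

lemma S_norm: "z \<in> U \<Longrightarrow> norm (S z) \<le> 1 / (1 - \<kappa> * v)"
proof -
  assume z: "z \<in> U"
  show ?thesis
  proof (rule is_inverse_norm_le[OF S_inverse[OF z]])
    fix x
    have "norm ((W z - id_blinfun) x) \<le> \<kappa> * v * norm x"
      using norm_blinfun[of "W z - id_blinfun" x] mult_right_mono[OF W_norm[OF z] norm_ge_zero[of x]] by linarith
    then have "norm (W z x - x) \<le> \<kappa> * v * norm x" by (simp add: blinfun.diff_left)
    then show "(1 - \<kappa> * v) * norm x \<le> norm (W z x)"
      using norm_triangle_ineq2[of x "W z x"] by (simp add: norm_minus_commute left_diff_distrib)
  qed (use \<kappa>_less in simp)
qed

lemma clinear_W: "z \<in> U \<Longrightarrow> clinear_op (W z)"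
  unfolding W_eq by (intro clinear_add clinear_id clinear_\<Omega> clinear_compose clinear_minus_scalar G_facts clinear_L)

lemma clinear_S: "z \<in> U \<Longrightarrow> clinear_op (S z)"
  by (rule is_inverse_clinear[OF S_inverse clinear_W])

definition "\<Phi> z = T o\<^sub>L L z o\<^sub>L S z"

text \<open>Apply T to W S x = x. Since T (1 + \<Omega>) = 1 and T G = H T, this reads S x + (H - z)
  T L S x = T x; applying the resolvent of H leaves R S x = R T x - \<Phi> x, and the left side is
  the inverse from the factorization.\<close>

lemma inverse_M1:
  assumes z: "z \<in> U" "z \<notin> spectrum H"
  shows "inv_op (M1 A K g z) x = resolvent H z (T x) - \<Phi> z x"
proof -
  have "is_inverse_op (M1 A K g z) (resolvent H z o\<^sub>L S z)"
    unfolding M1_factorization[OF z(1)] by (rule is_inverse_compose[OF S_inverse[OF z(1)] resolvent_inverse[OF z(2)]])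
  then have "inv_op (M1 A K g z) x = resolvent H z (S z x)" by (simp add: inv_op_eq)
  also have "\<dots> = resolvent H z (T x) - \<Phi> z x"
  proof -
    define u where "u = L z (S z x)"
    have "W z (S z x) = x" by (rule is_inverse_op_apply(1)[OF S_inverse[OF z(1)]])
    then have "(id_blinfun + \<Omega>) (S z x) + (G u - z *\<^sub>C u) = x"
      unfolding W_eq[OF z(1)] by (simp add: blinfun.add_left blinfun.diff_left u_def)
    from arg_cong[OF this, of T] have "S z x + (H (T u) - z *\<^sub>C T u) = T x"
      by (simp add: blinfun.add_right[of T] is_inverse_op_apply(2)[OF T_inverse] blinfun.diff_right T_G clinear_opD[OF clinear_T])
    moreover have "resolvent H z (H (T u) - z *\<^sub>C T u) = T u"
      using resolvent_shift(1)[OF H_facts(1) z(2), of "T u" z] by simp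
    ultimately have "resolvent H z (S z x) + T u = resolvent H z (T x)"
      by (metis blinfun.add_right)
    then show ?thesis by (simp add: \<Phi>_def u_def algebra_simps)
  qed
  finally show ?thesis .
qed

section \<open>Holomorphy of the regular part\<close>

lemma L_quotient:
  assumes z: "z \<in> U"
  shows "\<exists>D. ((\<lambda>w. inverse (w - z) *\<^sub>C (L w - L z)) \<longlongrightarrow> D) (at z)"
proof -
  define \<eta> where "\<eta> = d - \<rho>1"
  have \<eta>: "\<eta> > 0" using gap_pos by (simp add: \<eta>_def)
  obtain e where e: "e > 0" "ball z e \<subseteq> U" using open_U z open_contains_ball by blast
  have gap: "\<eta> \<le> cmod (g t - w)" if "w \<in> U" "t > 0" for w t
    using U_gap[of w t] that by (simp add: \<eta>_def norm_minus_commute)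
  have ne: "g t - w \<noteq> 0" if "w \<in> U" "t > 0" for w t
    using gap[OF that] \<eta> by auto
  have c2: "continuous_on {0<..} (\<lambda>t. - 1 / (z - g t)\<^sup>2)"
    using U_ne[OF z] by (intro continuous_intros g_cont') auto
  have "\<exists>D. has_contour_int g (\<lambda>\<mu>. (- 1 / (z - \<mu>)\<^sup>2 * \<mu>) *\<^sub>C Q \<mu>) D \<and> norm D \<le> 1 / \<eta>\<^sup>2 * \<kappa> * v"
  proof (rule Q_integral[OF c2])
    fix t :: real assume "t > 0"
    from gap[OF z this] show "cmod (- 1 / (z - g t)\<^sup>2) \<le> 1 / \<eta>\<^sup>2"
      using \<eta> by (simp add: norm_divide norm_power norm_minus_commute frac_le power_mono)
  qed (use \<eta> in simp)
  then obtain D where D: "has_contour_int g (\<lambda>\<mu>. (- 1 / (z - \<mu>)\<^sup>2 * \<mu>) *\<^sub>C Q \<mu>) D" by blast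
  have "((\<lambda>w. inverse (w - z) *\<^sub>C (L w - L z)) \<longlongrightarrow> D) (at z)"
  proof (rule quadratic_remainder_imp_derivative[OF e(1)])
    fix w assume "cmod (w - z) < e"
    then have w: "w \<in> U" using e(2) by (auto simp: dist_norm norm_minus_commute)
    \<comment> \<open>The first-order remainder of the kernel as a multiplier for
      \<open>Q_integral\<close>. It is at most |w - z|^2 / \<eta>^3 along the contour, since all
      points of \<open>U\<close> keep distance \<eta> from it.\<close>
    define s where "s \<mu> = 1 / (w - \<mu>) - 1 / (z - \<mu>) - (w - z) * (- 1 / (z - \<mu>)\<^sup>2)" for \<mu>
    have "has_contour_int g (\<lambda>\<mu>. (1 / (w - \<mu>) * \<mu>) *\<^sub>C Q \<mu> - (1 / (z - \<mu>) * \<mu>) *\<^sub>C Q \<mu>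
        - (w - z) *\<^sub>C ((- 1 / (z - \<mu>)\<^sup>2 * \<mu>) *\<^sub>C Q \<mu>)) (L w - L z - (w - z) *\<^sub>C D)"
      by (intro has_contour_int_diff has_contour_int_scaleC L_integral w z D)
    then have rem: "has_contour_int g (\<lambda>\<mu>. (s \<mu> * \<mu>) *\<^sub>C Q \<mu>) (L w - L z - (w - z) *\<^sub>C D)"
      by (rule has_contour_int_cong) (simp only: s_def scaleC_scaleC left_diff_distrib scaleC.diff_left mult.assoc)
    have "\<exists>I. has_contour_int g (\<lambda>\<mu>. (s \<mu> * \<mu>) *\<^sub>C Q \<mu>) I \<and> norm I \<le> (cmod (w - z))\<^sup>2 / \<eta>^3 * \<kappa> * v"
    proof (rule Q_integral)
      show "continuous_on {0<..} (\<lambda>t. s (g t))"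
        unfolding s_def by (intro continuous_on_diff continuous_on_mult continuous_on_const U_inverse_cont w z c2)
      show "0 \<le> (cmod (w - z))\<^sup>2 / \<eta>^3" using \<eta> by simp
      fix t :: real assume t: "t > 0"
      have "1 / (w - g t) = - (1 / (g t - w))" "1 / (z - g t) = - (1 / (g t - z))"
        by (metis minus_diff_eq divide_minus_right)+
      then have "s (g t) = - (1 / (g t - w) - 1 / (g t - z) - (w - z) * (1 / (g t - z)\<^sup>2))"
        unfolding s_def power2_commute[of z] by simp
      also have "\<dots> = - ((w - z)\<^sup>2 / ((g t - w) * (g t - z)\<^sup>2))"
        using ne[OF z t] ne[OF w t] by (subst cauchy_kernel_remainder) auto
      finally have "cmod (s (g t)) = (cmod (w - z))\<^sup>2 / (cmod (g t - w) * (cmod (g t - z))\<^sup>2)"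
        by (simp add: norm_divide norm_mult norm_power)
      also have "\<dots> \<le> (cmod (w - z))\<^sup>2 / (\<eta> * \<eta>\<^sup>2)"
        using \<eta> gap[OF z t] gap[OF w t] by (intro divide_left_mono mult_mono power_mono mult_pos_pos) auto
      also have "\<eta> * \<eta>\<^sup>2 = \<eta>^3" by (simp add: power2_eq_square power3_eq_cube)
      finally show "cmod (s (g t)) \<le> (cmod (w - z))\<^sup>2 / \<eta>^3" .
    qed
    then show "norm (L w - L z - (w - z) *\<^sub>C D) \<le> (\<kappa> * v / \<eta>^3) * (cmod (w - z))\<^sup>2"
      using has_contour_int_unique[OF rem] by (auto simp: mult_ac)
  qed
  then show ?thesis by blast
qed

lemma eventually_U: "z \<in> U \<Longrightarrow> eventually (\<lambda>w. w \<in> U \<and> w \<noteq> z) (at z)"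
  using eventually_at_in_open[OF open_U, of z] by (simp add: conj_commute)

lemma tendsto_of_quotient:
  fixes F :: "complex \<Rightarrow> 'b::complex_normed_vector"
  assumes "((\<lambda>w. inverse (w - z) *\<^sub>C (F w - F z)) \<longlongrightarrow> D) (at z)"
  shows "(F \<longlongrightarrow> F z) (at z)"
proof -
  have "((\<lambda>w. (w - z) *\<^sub>C (inverse (w - z) *\<^sub>C (F w - F z)) + F z) \<longlongrightarrow> 0 *\<^sub>C D + F z) (at z)"
    by (intro tendsto_add tendsto_const scaleC.tendsto assms) (auto intro!: tendsto_eq_intros)
  then have "((\<lambda>w. (w - z) *\<^sub>C (inverse (w - z) *\<^sub>C (F w - F z)) + F z) \<longlongrightarrow> F z) (at z)" by simp
  then show ?thesis
    by (rule Lim_transform_eventually) (auto simp: eventually_at scaleC_scaleC intro!: exI[of _ 1])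
qed

text \<open>The product rule by hand. The identity S w - S z = - S w (W w - W z) S z, with
  \<open>S\<close> uniformly bounded on \<open>U\<close>, gives first the continuity of
  \<open>S\<close> and then its difference quotient.\<close>

lemma \<Phi>_quotient:
  assumes z: "z \<in> U"
  shows "\<exists>D. ((\<lambda>w. inverse (w - z) *\<^sub>C (\<Phi> w - \<Phi> z)) \<longlongrightarrow> D) (at z)"
proof -
  obtain D where D: "((\<lambda>w. inverse (w - z) *\<^sub>C (L w - L z)) \<longlongrightarrow> D) (at z)" using L_quotient[OF z] by blast
  define q where "q w = inverse (w - z) *\<^sub>C (L w - L z)" for w
  have q: "(q \<longlongrightarrow> D) (at z)" using D unfolding q_def .
  note comp = bounded_bilinear.tendsto[OF bounded_bilinear_blinfun_compose]
  have Lz: "(L \<longlongrightarrow> L z) (at z)" by (rule tendsto_of_quotient[OF D])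
  have Gz: "((\<lambda>w. G - w *\<^sub>C id_blinfun) \<longlongrightarrow> G - z *\<^sub>C id_blinfun) (at z)"
    by (intro tendsto_diff tendsto_const scaleC.tendsto tendsto_ident_at)
  have S_diff: "S w - S z = - (S w o\<^sub>L (W w - W z) o\<^sub>L S z)" if "w \<in> U" for w
    by (rule blinfun_eqI)
      (simp add: blinfun.diff_left blinfun.minus_left blinfun.diff_right is_inverse_op_apply[OF S_inverse[OF that]]
        is_inverse_op_apply[OF S_inverse[OF z]])
  have "(W \<longlongrightarrow> id_blinfun + \<Omega> + ((G - z *\<^sub>C id_blinfun) o\<^sub>L L z)) (at z)"
  proof (rule Lim_transform_eventually)
    show "((\<lambda>w. id_blinfun + \<Omega> + ((G - w *\<^sub>C id_blinfun) o\<^sub>L L w)) \<longlongrightarrow> id_blinfun + \<Omega> + ((G - z *\<^sub>C id_blinfun) o\<^sub>L L z)) (at z)"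
      by (intro tendsto_add tendsto_const comp Gz Lz)
    show "\<forall>\<^sub>F w in at z. id_blinfun + \<Omega> + ((G - w *\<^sub>C id_blinfun) o\<^sub>L L w) = W w"
      using eventually_U[OF z] by eventually_elim (simp add: W_eq)
  qed
  then have Wz: "(W \<longlongrightarrow> W z) (at z)" by (simp add: W_eq[OF z])
  have "((\<lambda>w. S w - S z) \<longlongrightarrow> 0) (at z)"
  proof (rule Lim_null_comparison)
    have "((\<lambda>w. 1 / (1 - \<kappa> * v) * norm (W w - W z) * norm (S z)) \<longlongrightarrow> 1 / (1 - \<kappa> * v) * norm (W z - W z) * norm (S z)) (at z)"
      by (intro tendsto_intros Wz)
    then show "((\<lambda>w. 1 / (1 - \<kappa> * v) * norm (W w - W z) * norm (S z)) \<longlongrightarrow> 0) (at z)" by simp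
    show "\<forall>\<^sub>F w in at z. norm (S w - S z) \<le> 1 / (1 - \<kappa> * v) * norm (W w - W z) * norm (S z)"
      using eventually_U[OF z]
    proof eventually_elim
      fix w assume w: "w \<in> U \<and> w \<noteq> z"
      then show "norm (S w - S z) \<le> 1 / (1 - \<kappa> * v) * norm (W w - W z) * norm (S z)"
        using S_diff[of w] by (simp only: norm_minus_cancel) (intro norm_blinfun_compose_le S_norm order_refl, simp)
    qed
  qed
  then have Sz: "(S \<longlongrightarrow> S z) (at z)" by (simp add: Lim_null[of S])
  \<comment> \<open>The quotient of \<Phi> in terms of the quotient \<open>q\<close> of L: it rests
    on W w - W z = (w - z) ((G - w) q w - L z), verified below as \<open>W_diff\<close>.\<close>
  have "((\<lambda>w. (T o\<^sub>L q w o\<^sub>L S w) - (T o\<^sub>L L z o\<^sub>L (S w o\<^sub>L (((G - w *\<^sub>C id_blinfun) o\<^sub>L q w) - L z) o\<^sub>L S z)))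
      \<longlongrightarrow> (T o\<^sub>L D o\<^sub>L S z) - (T o\<^sub>L L z o\<^sub>L (S z o\<^sub>L (((G - z *\<^sub>C id_blinfun) o\<^sub>L D) - L z) o\<^sub>L S z))) (at z)"
    by (intro tendsto_diff comp tendsto_const q Sz Gz)
  then have "((\<lambda>w. inverse (w - z) *\<^sub>C (\<Phi> w - \<Phi> z))
      \<longlongrightarrow> (T o\<^sub>L D o\<^sub>L S z) - (T o\<^sub>L L z o\<^sub>L (S z o\<^sub>L (((G - z *\<^sub>C id_blinfun) o\<^sub>L D) - L z) o\<^sub>L S z))) (at z)"
  proof (rule Lim_transform_eventually)
    show "\<forall>\<^sub>F w in at z. (T o\<^sub>L q w o\<^sub>L S w) - (T o\<^sub>L L z o\<^sub>L (S w o\<^sub>L (((G - w *\<^sub>C id_blinfun) o\<^sub>L q w) - L z) o\<^sub>L S z))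
        = inverse (w - z) *\<^sub>C (\<Phi> w - \<Phi> z)"
      using eventually_U[OF z]
    proof eventually_elim
      fix w assume "w \<in> U \<and> w \<noteq> z"
      then have w: "w \<in> U" "w - z \<noteq> 0" by auto
      have Lw: "L w y = L z y + (w - z) *\<^sub>C q w y" for y
        using w(2) by (simp add: q_def scaleC_scaleC blinfun.diff_left)
      define p where "p y = (G - w *\<^sub>C id_blinfun) (q w y) - L z y" for y
      have qc: "q w (c *\<^sub>C y) = c *\<^sub>C q w y" for c y
        unfolding q_def by (simp add: blinfun.diff_left clinear_opD[OF clinear_L[OF w(1)]] clinear_opD[OF clinear_L[OF z]]
            scaleC.diff_right scaleC_scaleC mult.commute)
      have Gc: "(G - w *\<^sub>C id_blinfun) (c *\<^sub>C y) = c *\<^sub>C (G - w *\<^sub>C id_blinfun) y" for c y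
        by (rule clinear_opD[OF clinear_minus_scalar[OF G_facts(1)]])
      have W_diff: "(W w - W z) y = (w - z) *\<^sub>C p y" for y
      proof -
        have "(W w - W z) y = (G - w *\<^sub>C id_blinfun) (L w y) - (G - z *\<^sub>C id_blinfun) (L z y)"
          unfolding W_eq[OF w(1)] W_eq[OF z] by (simp add: blinfun.add_left blinfun.diff_left)
        also have "\<dots> = (w - z) *\<^sub>C (G - w *\<^sub>C id_blinfun) (q w y) + ((G - w *\<^sub>C id_blinfun) (L z y) - (G - z *\<^sub>C id_blinfun) (L z y))"
          unfolding Lw blinfun.add_right Gc by simp
        also have "(G - w *\<^sub>C id_blinfun) (L z y) - (G - z *\<^sub>C id_blinfun) (L z y) = - ((w - z) *\<^sub>C L z y)"
          by (simp add: blinfun.diff_left scaleC.diff_left)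
        finally show ?thesis by (simp add: p_def scaleC.diff_right)
      qed
      show "(T o\<^sub>L q w o\<^sub>L S w) - (T o\<^sub>L L z o\<^sub>L (S w o\<^sub>L (((G - w *\<^sub>C id_blinfun) o\<^sub>L q w) - L z) o\<^sub>L S z))
          = inverse (w - z) *\<^sub>C (\<Phi> w - \<Phi> z)"
      proof (rule blinfun_eqI)
        fix x
        have "S w x - S z x = - (S w ((W w - W z) (S z x)))"
          using arg_cong[OF S_diff[OF w(1)], of "\<lambda>T. blinfun_apply T x"] by (simp add: blinfun.diff_left blinfun.minus_left)
        also have "\<dots> = - ((w - z) *\<^sub>C S w (p (S z x)))"
          unfolding W_diff clinear_opD[OF clinear_S[OF w(1)]] ..
        finally have Sw: "S w x = S z x - (w - z) *\<^sub>C S w (p (S z x))" by (simp add: algebra_simps)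
        have "L w (S w x) - L z (S z x) = (w - z) *\<^sub>C q w (S w x) + (L z (S w x) - L z (S z x))"
          by (simp add: Lw)
        also have "L z (S w x) - L z (S z x) = - ((w - z) *\<^sub>C L z (S w (p (S z x))))"
          by (subst Sw) (simp add: blinfun.diff_right clinear_opD[OF clinear_L[OF z]])
        finally have "L w (S w x) - L z (S z x) = (w - z) *\<^sub>C (q w (S w x) - L z (S w (p (S z x))))"
          by (simp add: scaleC.diff_right)
        then have "inverse (w - z) *\<^sub>C T (L w (S w x) - L z (S z x)) = T (q w (S w x) - L z (S w (p (S z x))))"
          using w(2) by (simp add: clinear_opD[OF clinear_T] scaleC_scaleC)
        then show "((T o\<^sub>L q w o\<^sub>L S w) - (T o\<^sub>L L z o\<^sub>L (S w o\<^sub>L (((G - w *\<^sub>C id_blinfun) o\<^sub>L q w) - L z) o\<^sub>L S z))) x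
          = (inverse (w - z) *\<^sub>C (\<Phi> w - \<Phi> z)) x"
          by (simp add: \<Phi>_def p_def blinfun.diff_left[of "(T o\<^sub>L _) o\<^sub>L _"] blinfun.diff_left[of _ "L z"] blinfun.diff_right)
      qed
    qed
  qed
  then show ?thesis by blast
qed

lemma \<Phi>_cont: "continuous_on U \<Phi>"
  using \<Phi>_quotient tendsto_of_quotient
  by (intro continuous_at_imp_continuous_on ballI) (unfold isCont_def, blast)

lemma \<Phi>_holomorphic: "(\<lambda>z. cinner y (\<Phi> z x)) holomorphic_on U"
  unfolding holomorphic_on_def
proof
  fix z assume z: "z \<in> U"
  obtain D where D: "((\<lambda>w. inverse (w - z) *\<^sub>C (\<Phi> w - \<Phi> z)) \<longlongrightarrow> D) (at z)" using \<Phi>_quotient[OF z] by blast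
  have "bounded_linear (\<lambda>F::'h \<Rightarrow>\<^sub>L 'h. cinner y (F x))"
    by (rule bounded_linear_compose[OF bounded_linear_cinner_right blinfun.bounded_linear_left])
  from bounded_linear.tendsto[OF this D]
  have "((\<lambda>w. (cinner y (\<Phi> w x) - cinner y (\<Phi> z x)) / (w - z)) \<longlongrightarrow> cinner y (D x)) (at z)"
    by (simp add: cinner_simps blinfun.diff_left divide_inverse mult.commute)
  then have "((\<lambda>z. cinner y (\<Phi> z x)) has_field_derivative cinner y (D x)) (at z)"
    by (simp add: has_field_derivative_iff)
  then show "(\<lambda>z. cinner y (\<Phi> z x)) field_differentiable at z within U"
    unfolding field_differentiable_def using has_field_derivative_at_within by blast
qed

section \<open>The contour integrals\<close>

lemma O_set_subset: "O_set A K g \<subseteq> U"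
  using \<rho>1_bounds(1) by (auto simp: O_set_def U_def \<rho>_def)

text \<open>On each loop \<Phi> integrates to 0, with or without the factor z, so the resolvent
  alone contributes. For the moment z R(z) = H R(z) - 1 is used, and the constant vanishes on a
  closed loop.\<close>

lemma loop_integrals:
  assumes c: "rectifiable_loop c" "path_image c \<subseteq> O_set A K g - spectrum H"
  defines "J \<equiv> curve_integral (resolvent H) c 0 1"
  shows "has_curve_integral (\<lambda>z. inv_op (M1 A K g z) x) (J (T x)) c 0 1"
    "has_curve_integral (\<lambda>z. (z *\<^sub>C inv_op (M1 A K g z)) x) (H (J (T x))) c 0 1"
proof -
  have cU: "path_image c \<subseteq> U" "path_image c \<inter> spectrum H = {}" using c(2) O_set_subset by auto
  have ct: "c t \<in> U" "c t \<notin> spectrum H" if "t \<in> {0..1}" for t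
  proof -
    have "c t \<in> path_image c" using that by (simp add: path_image_def)
    then show "c t \<in> U" "c t \<notin> spectrum H" using cU by blast+
  qed
  have c': "path c" "pathfinish c = pathstart c" using c(1) by (auto simp: rectifiable_loop_def)
  obtain V where V: "var_bound V c 0 1" using rectifiable_var_bound c(1) unfolding rectifiable_loop_def by blast
  have "has_curve_integral (resolvent H) J c 0 1"
    unfolding J_def by (rule resolvent_loop_integral_exists[OF H_facts(1) c(1) cU(2)])
  then have R: "has_curve_integral (\<lambda>z. resolvent H z (T x)) (J (T x)) c 0 1"
    by (rule has_curve_integral_linear[OF _ blinfun.bounded_linear_left]) simp
  have contx: "continuous_on U (\<lambda>z. \<Phi> z x)"
    by (rule bounded_linear.continuous_on[OF blinfun.bounded_linear_left \<Phi>_cont])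
  have \<Phi>0: "has_curve_integral (\<lambda>z. \<Phi> z x) 0 c 0 1"
    by (rule loop_integral_weakly_holomorphic[OF real_spectrum U_def contx \<Phi>_holomorphic c(1) cU(1)])
  have \<Phi>1: "has_curve_integral (\<lambda>z. z *\<^sub>C \<Phi> z x) 0 c 0 1"
  proof (rule loop_integral_weakly_holomorphic[OF real_spectrum U_def _ _ c(1) cU(1)])
    show "continuous_on U (\<lambda>z. z *\<^sub>C \<Phi> z x)" by (intro scaleC.continuous_on continuous_on_id contx)
    show "(\<lambda>z. cinner y (z *\<^sub>C \<Phi> z x)) holomorphic_on U" for y
      unfolding cinner_scaleC_right by (intro holomorphic_intros \<Phi>_holomorphic)
  qed
  have "has_curve_integral (\<lambda>z. resolvent H z (T x) + (-1) *\<^sub>C \<Phi> z x) (J (T x) + (-1) *\<^sub>C 0) c 0 1"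
    by (intro has_curve_integral_add has_curve_integral_scaleC R \<Phi>0)
  then show "has_curve_integral (\<lambda>z. inv_op (M1 A K g z) x) (J (T x)) c 0 1"
    using ct by (auto simp: inverse_M1 elim!: has_curve_integral_cong)
  have "has_curve_integral (\<lambda>z. H (resolvent H z (T x))) (H (J (T x))) c 0 1"
    by (rule has_curve_integral_linear[OF R blinfun.bounded_linear_right]) (rule clinear_opD[OF H_facts(1)])
  then have "has_curve_integral (\<lambda>z. H (resolvent H z (T x)) + (-1) *\<^sub>C T x + (-1) *\<^sub>C (z *\<^sub>C \<Phi> z x))
      (H (J (T x)) + (-1) *\<^sub>C 0 + (-1) *\<^sub>C 0) c 0 1"
    by (intro has_curve_integral_add has_curve_integral_scaleC has_curve_integral_const[OF c' V] \<Phi>1)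
  then show "has_curve_integral (\<lambda>z. (z *\<^sub>C inv_op (M1 A K g z)) x) (H (J (T x))) c 0 1"
    using ct by (auto simp: inverse_M1 resolvent_apply(1) scaleC.diff_right elim!: has_curve_integral_cong)
qed

text \<open>A single loop has no prescribed value; only the sum over all loops is known, from the
  total winding number 1, and it turns \<open>J (T x)\<close> into the multiple -2 \<pi> i of
  \<open>T x\<close>.\<close>

lemma strong_integrals:
  assumes \<gamma>: "goes_around \<gamma> (spectrum H) (O_set A K g)"
  shows "has_strong_integral (\<lambda>z. inv_op (M1 A K g z)) (- (2 * of_real pi * \<i>) *\<^sub>C T) \<gamma>"
    "has_strong_integral (\<lambda>z. z *\<^sub>C inv_op (M1 A K g z)) (- (2 * of_real pi * \<i>) *\<^sub>C (H o\<^sub>L T)) \<gamma>"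
proof -
  define J where "J c = curve_integral (resolvent H) c 0 1" for c
  have loop: "rectifiable_loop c" "path_image c \<subseteq> O_set A K g - spectrum H" if "c \<in> set \<gamma>" for c
    using \<gamma> that unfolding goes_around_def by auto
  have sum: "(\<Sum>c\<leftarrow>\<gamma>. J c x) = - (2 * of_real pi * \<i>) *\<^sub>C x" for x
    unfolding J_def by (rule resolvent_cycle_integral[OF H_facts(1) \<gamma>])
  show "has_strong_integral (\<lambda>z. inv_op (M1 A K g z)) (- (2 * of_real pi * \<i>) *\<^sub>C T) \<gamma>"
    unfolding has_strong_integral_def
  proof (intro allI exI conjI)
    fix x
    show "list_all2 (\<lambda>c I. has_curve_integral (\<lambda>z. inv_op (M1 A K g z) x) I c 0 1) \<gamma> (map (\<lambda>c. J c (T x)) \<gamma>)"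
      unfolding list_all2_map2 J_def using loop_integrals(1)[OF loop] by (intro list.rel_refl_strong) auto
    show "(- (2 * of_real pi * \<i>) *\<^sub>C T) x = sum_list (map (\<lambda>c. J c (T x)) \<gamma>)"
      unfolding sum by (simp add: blinfun.minus_left)
  qed
  have sumH: "(\<Sum>c\<leftarrow>cs. H (J c y)) = H (\<Sum>c\<leftarrow>cs. J c y)" for cs y
    by (induction cs) (simp_all add: blinfun.add_right)
  show "has_strong_integral (\<lambda>z. z *\<^sub>C inv_op (M1 A K g z)) (- (2 * of_real pi * \<i>) *\<^sub>C (H o\<^sub>L T)) \<gamma>"
    unfolding has_strong_integral_def
  proof (intro allI exI conjI)
    fix x
    show "list_all2 (\<lambda>c I. has_curve_integral (\<lambda>z. (z *\<^sub>C inv_op (M1 A K g z)) x) I c 0 1) \<gamma> (map (\<lambda>c. H (J c (T x))) \<gamma>)"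
      unfolding list_all2_map2 J_def using loop_integrals(2)[OF loop] by (intro list.rel_refl_strong) auto
    show "(- (2 * of_real pi * \<i>) *\<^sub>C (H o\<^sub>L T)) x = sum_list (map (\<lambda>c. H (J c (T x))) \<gamma>)"
      unfolding sumH sum clinear_opD[OF H_facts(1)] by (simp add: blinfun.minus_left)
  qed
qed

text \<open>In the instance for the conjugate contour H becomes H' and G becomes the adjoint of H,
  so its \<Omega> integrand is the pointwise adjoint of the original one.\<close>

lemma Omega_conj: "Omega A K (conj_contour g) = adj (Omega A K g)"
proof -
  interpret conj: kb_contour A K "conj_contour g" by (rule conj_kb_contour)
  have cH: "conj.H = H'" unfolding H'_def by (rule conj.H1_eq[symmetric])
  have cG: "conj.G = adj H" unfolding conj.G_def conj.H'_def conj_conj H1_eq ..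
  have "adj \<Omega> = conj.\<Omega>"
  proof (rule has_contour_int_adj[OF \<Omega>_integral])
    show "has_contour_int (conj_contour g) (\<lambda>\<mu>. \<mu> *\<^sub>C (resolvent (adj H) \<mu> o\<^sub>L K \<mu> o\<^sub>L resolvent H' \<mu>)) conj.\<Omega>"
      using conj.\<Omega>_integral unfolding cH cG .
    fix t :: real and x y assume t: "0 < t"
    note K = K_clinear[OF t] and R' = clinear_resolvent[OF H'_facts(1) resolvent_H'_adj(2)[OF t]]
    have RH: "resolvent (adj H) (cnj (g t)) = adj (resolvent H (g t))"
      using spectrum_adj_resolvent(2)[OF H_facts(1), of "cnj (g t)"] H_ns[OF t] by simp
    show "cinner ((cnj (g t) *\<^sub>C (resolvent (adj H) (cnj (g t)) o\<^sub>L K (cnj (g t)) o\<^sub>L resolvent H' (cnj (g t)))) y) x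
        = cinner y ((g t *\<^sub>C Q (g t)) x)"
      unfolding RH K_adj[OF t] resolvent_H'_adj(1)[OF t, symmetric]
      by (simp add: cinner_simps cinner_adj_left cinner_adj_right K R' RH_clinear[OF t])
  qed
  then show ?thesis by (simp add: \<Omega>_def conj.\<Omega>_def)
qed

end

section \<open>The operator matrix\<close>

lemma linear_lop_scaleC:
  assumes "linear_lop L" "L z = Some y"
  shows "L (c *\<^sub>C z) = Some (c *\<^sub>C y)"
proof -
  have "L (c *\<^sub>C z) = Some (c *\<^sub>C the (L z))"
    using assms domI[of L z y] unfolding linear_lop_def by blast
  then show ?thesis using assms(2) by simp
qed

lemma linear_lop_add:
  assumes "linear_lop L" "L z = Some y" "L z' = Some y'"
  shows "L (z + z') = Some (y + y')"
proof -
  have "L (z + z') = Some (the (L z) + the (L z'))"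
    using assms domI[of L z y] domI[of L z' y'] unfolding linear_lop_def by blast
  then show ?thesis using assms(2,3) by simp
qed

context operator_matrix
begin

text \<open>\<open>B\<^sub>1\<^sub>0\<close> is only given as a real-linear map equal to the
  composition of \<open>T\<^sub>1\<^sub>0\<close> with the inverse of \<open>R\<^sub>0\<close>. That
  inverse is a description, so injectivity of \<open>R\<^sub>0\<close> is shown first: its kernel
  lies in that of \<open>A\<^sub>0\<close>, and 0 is a resolvent point because
  \<open>\<alpha>\<^sub>0\<close> is positive. Surjectivity is read off from
  \<open>B\<^sub>1\<^sub>0\<close> being everywhere defined.\<close>

lemma clinear_B10: "clinear_op B\<^sub>1\<^sub>0"
  unfolding clinear_op_def
proof (intro allI)
  fix c x
  have R_lin: "linear_lop R\<^sub>0" and RR: "R\<^sub>0 \<circ>\<^sub>m R\<^sub>0 = A\<^sub>0"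
    using R0 by (auto simp: is_sqrt_lop_def selfadjoint_lop_def)
  have inj: "z = w" if z: "R\<^sub>0 z = Some y" and w: "R\<^sub>0 w = Some y" for z w y
  proof -
    have "R\<^sub>0 (z + (-1) *\<^sub>C w) = Some (y + (-1) *\<^sub>C y)"
      by (rule linear_lop_add[OF R_lin z linear_lop_scaleC[OF R_lin w]])
    then have "R\<^sub>0 (z - w) = Some 0" by simp
    moreover have "R\<^sub>0 0 = Some 0" using R_lin by (simp add: linear_lop_def)
    ultimately have A: "A\<^sub>0 (z - w) = Some 0" unfolding RR[symmetric] by (simp add: map_comp_def)
    have "(0::complex) \<notin> spectrum_lop A\<^sub>0" unfolding A0_spectrum using alpha0_pos by auto
    then obtain S :: "'h0 \<Rightarrow>\<^sub>L 'h0" where S: "\<And>x. x \<in> dom A\<^sub>0 \<Longrightarrow> S (the (A\<^sub>0 x) - 0 *\<^sub>C x) = x"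
      unfolding spectrum_lop_def by blast
    from S[of "z - w"] A have "S 0 = z - w" by (auto simp: domI)
    then show "z = w" by simp
  qed
  have inv: "inv_lop R\<^sub>0 y = Some z" if "R\<^sub>0 z = Some y" for y z
  proof -
    have "(THE w. R\<^sub>0 w = Some y) = z" using that inj by blast
    then show ?thesis unfolding inv_lop_def using that by auto
  qed
  have B: "T\<^sub>1\<^sub>0 z = Some (B\<^sub>1\<^sub>0 y)" if "R\<^sub>0 z = Some y" for y z
    using fun_cong[OF B10, of y] inv[OF that] by (simp add: map_comp_def)
  have "\<exists>z. R\<^sub>0 z = Some x"
    using fun_cong[OF B10, of x] by (auto simp: map_comp_def inv_lop_def split: if_splits)
  then obtain z where z: "R\<^sub>0 z = Some x" by blast
  have "R\<^sub>0 (c *\<^sub>C z) = Some (c *\<^sub>C x)" by (rule linear_lop_scaleC[OF R_lin z])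
  from B[OF this] have "T\<^sub>1\<^sub>0 (c *\<^sub>C z) = Some (B\<^sub>1\<^sub>0 (c *\<^sub>C x))" .
  moreover have "T\<^sub>1\<^sub>0 (c *\<^sub>C z) = Some (c *\<^sub>C B\<^sub>1\<^sub>0 x)"
    by (rule linear_lop_scaleC[OF T10(1) B[OF z]])
  ultimately show "B\<^sub>1\<^sub>0 (c *\<^sub>C x) = c *\<^sub>C B\<^sub>1\<^sub>0 x" by simp
qed

lemma selfadjoint_A1_tilde: "selfadjoint_op (A1_tilde A\<^sub>1 B\<^sub>1\<^sub>0)"
proof -
  have A1: "clinear_op A\<^sub>1" "adj A\<^sub>1 = A\<^sub>1" using A1_selfadjoint by (auto simp: selfadjoint_op_def)
  have "clinear_op (B\<^sub>1\<^sub>0 o\<^sub>L adj B\<^sub>1\<^sub>0)" by (intro clinear_compose clinear_adj clinear_B10)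
  then show ?thesis
    unfolding selfadjoint_op_def A1_tilde_def
    by (simp add: clinear_diff A1 adj_diff adj_compose adj_adj clinear_B10 clinear_adj)
qed

lemma kb_contour_of_deformed_contour:
  assumes l: "l = 1 \<or> l = -1"
    and contour: "deformed_contour \<alpha>\<^sub>0 (D_side D l) g"
    and A: "A = A1_tilde A\<^sub>1 B\<^sub>1\<^sub>0"
    and bounded: "K_B_bounded K' g" and d: "0 < d0 A g"
    and small: "Var_A A K' g < 1" "Var_A A K' g * norm A < 1/4 * d0 A g * (1 - Var_A A K' g)\<^sup>2"
  shows "kb_contour A K' g"
proof
  show "selfadjoint_op A" unfolding A by (rule selfadjoint_A1_tilde)
  show "spectrum A \<subseteq> \<real>" using spectrum_A1_tilde unfolding A by auto
  show vb: "var_bound (\<lambda>t. t) g 0 b" for b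
    unfolding var_bound_def
  proof (intro allI impI, elim conjE)
    fix s t :: real assume "0 \<le> s" "s \<le> t" "t \<le> b"
    then have "ennreal (dist (g s) (g t)) \<le> ennreal (t - s)"
      using contour curve_length_ge_dist[of s t g] unfolding deformed_contour_def by metis
    then show "cmod (g t - g s) \<le> t - s"
      using \<open>s \<le> t\<close> by (simp add: dist_norm norm_minus_commute)
  qed
  have "dist (g s) (g t) \<le> 1 * dist s t" if "s \<in> {0<..}" "t \<in> {0<..}" for s t
    using var_boundD[OF vb[of "max s t"], of "min s t" "max s t"] that
    by (cases "s \<le> t") (auto simp: dist_norm norm_minus_commute)
  then have "1-lipschitz_on {0<..} g" by (intro lipschitz_onI) auto
  then have gc: "continuous_on {0<..} g" by (rule lipschitz_on_continuous_on)
  have KD: "continuous_on D K'" by (rule continuous_on_subset[OF K_continuous]) auto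
  have "(\<forall>t>0. clinear_op (K' (g t)) \<and> K' (cnj (g t)) = adj (K' (g t))) \<and> continuous_on {0<..} (\<lambda>t. K' (g t))"
  proof (cases "l = 1")
    case True
    then have gD: "\<And>t. t > 0 \<Longrightarrow> g t \<in> D" using contour by (simp add: deformed_contour_def D_side_def)
    then have "continuous_on {0<..} (\<lambda>t. K' (g t))"
      by (intro continuous_on_compose2[OF KD gc]) auto
    then show ?thesis using gD K_clinear K_conj by blast
  next
    \<comment> \<open>For l = -1 the contour lies in the conjugate domain, while linearity and
      continuity of \<open>K'\<close> are given on \<open>D\<close>. They are carried over by
      K'(\<mu>) = adj K'(cnj \<mu>), an isometric relation.\<close>
    case False
    then have gD: "cnj (g t) \<in> D" if "t > 0" for t
      using contour that by (auto simp: deformed_contour_def D_side_def)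
    have K: "K' (g t) = adj (K' (cnj (g t)))" if "t > 0" for t using K_conj[OF gD[OF that]] by simp
    have "continuous_on {0<..} (\<lambda>t. K' (cnj (g t)))"
      using gD by (intro continuous_on_compose2[OF KD continuous_on_cnj[OF gc]]) auto
    moreover have "dist (K' (g s)) (K' (g t)) = dist (K' (cnj (g s))) (K' (cnj (g t)))" if "s > 0" "t > 0" for s t
      using that by (simp add: dist_norm K K_clinear gD norm_adj clinear_diff flip: adj_diff)
    ultimately have "continuous_on {0<..} (\<lambda>t. K' (g t))"
      unfolding continuous_on_iff by (metis (no_types, lifting) greaterThan_iff)
    then show ?thesis using K K_clinear[OF gD] by (auto simp: adj_adj clinear_adj)
  qed
  then show "continuous_on {0<..} (\<lambda>t. K' (g t))" "\<And>t. t > 0 \<Longrightarrow> clinear_op (K' (g t))"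
    "\<And>t. t > 0 \<Longrightarrow> K' (cnj (g t)) = adj (K' (g t))" by blast+
qed (use bounded d small in blast)+

end

theorem theorem3p3:
  fixes \<alpha>\<^sub>0 :: real
    and A\<^sub>0 :: "('h0::chilbert, 'h0) lop"
    and E\<^sub>0 :: "real set \<Rightarrow> 'h0 \<Rightarrow>\<^sub>L 'h0"
    and R\<^sub>0 :: "('h0, 'h0) lop"
    and A\<^sub>1 A :: "'h1::chilbert \<Rightarrow>\<^sub>L 'h1"
    and T\<^sub>0\<^sub>1 :: "('h1, 'h0) lop"
    and T\<^sub>1\<^sub>0 :: "('h0, 'h1) lop"
    and B\<^sub>1\<^sub>0 :: "'h0 \<Rightarrow>\<^sub>L 'h1"
    and D :: "complex set"
    and K' :: "complex \<Rightarrow> 'h1 \<Rightarrow>\<^sub>L 'h1"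
    and C \<gamma>\<^sub>0 :: real
    and l :: int
    and \<Gamma> :: "real \<Rightarrow> complex"
  assumes setting: "operator_matrix \<alpha>\<^sub>0 A\<^sub>0 E\<^sub>0 R\<^sub>0 A\<^sub>1 T\<^sub>0\<^sub>1 T\<^sub>1\<^sub>0 B\<^sub>1\<^sub>0 D K' C \<gamma>\<^sub>0"
    and A_eq: "A = A1_tilde A\<^sub>1 B\<^sub>1\<^sub>0"
    and l: "l = 1 \<or> l = -1"
    and contour: "deformed_contour \<alpha>\<^sub>0 (D_side D l) \<Gamma>"
    and bounded: "K_B_bounded K' \<Gamma>"
    and d0_pos: "d0 A \<Gamma> > 0"
    and Var_less_1: "Var_A A K' \<Gamma> < 1"
    and Var_small: "Var_A A K' \<Gamma> * norm A < 1/4 * d0 A \<Gamma> * (1 - Var_A A K' \<Gamma>)\<^sup>2"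
  shows "norm (Omega A K' \<Gamma>) < 1 \<and>
    Omega A K' (conj_contour \<Gamma>) = adj (Omega A K' \<Gamma>) \<and>
    (\<forall>\<gamma>. goes_around \<gamma> (spectrum (H1 A K' \<Gamma>)) (O_set A K' \<Gamma>) \<longrightarrow>
      (\<exists>J\<^sub>0 J\<^sub>1.
        has_strong_integral (\<lambda>z. inv_op (M1 A K' \<Gamma> z)) J\<^sub>0 \<gamma> \<and>
        - (1 / (2 * complex_of_real pi * \<i>)) *\<^sub>C J\<^sub>0 = inv_op (id_blinfun + Omega A K' \<Gamma>) \<and>
        has_strong_integral (\<lambda>z. z *\<^sub>C inv_op (M1 A K' \<Gamma> z)) J\<^sub>1 \<gamma> \<and>
        - (1 / (2 * complex_of_real pi * \<i>)) *\<^sub>C J\<^sub>1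
          = inv_op (id_blinfun + Omega A K' \<Gamma>) o\<^sub>L adj (H1 A K' (conj_contour \<Gamma>)) \<and>
        - (1 / (2 * complex_of_real pi * \<i>)) *\<^sub>C J\<^sub>1
          = H1 A K' \<Gamma> o\<^sub>L inv_op (id_blinfun + Omega A K' \<Gamma>)))"
proof -
  interpret operator_matrix \<alpha>\<^sub>0 A\<^sub>0 E\<^sub>0 R\<^sub>0 A\<^sub>1 T\<^sub>0\<^sub>1 T\<^sub>1\<^sub>0 B\<^sub>1\<^sub>0 D K' C \<gamma>\<^sub>0 by (rule setting)
  interpret kb: kb_contour A K' \<Gamma>
    by (rule kb_contour_of_deformed_contour[OF l contour A_eq bounded d0_pos Var_less_1 Var_small])
  have T: "inv_op (id_blinfun + Omega A K' \<Gamma>) = kb.T" by (simp add: kb.T_def kb.\<Omega>_def)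
  have G: "adj (H1 A K' (conj_contour \<Gamma>)) = kb.G" by (simp add: kb.G_def kb.H'_def)
  have TG: "kb.T o\<^sub>L kb.G = kb.H o\<^sub>L kb.T" by (rule blinfun_eqI) (simp add: kb.T_G)
  have cancel: "- (1 / (2 * complex_of_real pi * \<i>)) *\<^sub>C (- (2 * of_real pi * \<i>) *\<^sub>C S) = S" for S :: "'h1 \<Rightarrow>\<^sub>L 'h1"
    by (simp add: scaleC_scaleC)
  \<comment> \<open>The witnesses are the strong integrals -2 \<pi> i T and -2 \<pi> i H T;
    \<open>TG\<close> identifies the two forms of the first moment.\<close>
  show ?thesis
    using kb.norm_\<Omega>_less kb.Omega_conj kb.strong_integrals cancel
    unfolding T G TG kb.H1_eq kb.\<Omega>_def by blast
qed

end
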